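(* Let $\mathbf Y\in\mathscr C^{0,\alpha,1}$ and let $\mu_0=\varsigma_0$ be a probability measure on $\mathbb R^{d_X}$. Then the following are equivalent: 1. there exists at most one measure-valued solution $\mu$ (in the sense defined in the context) to the rough Zakai equation $$\mu_t(\varphi)=\mu_0(\varphi)+\int_0^t\mu_r(A_r^{\mathbf Y}\varphi)\,dr+\int_0^t\mu_r(\Gamma_r^{\mathbf Y}\varphi)\,d\mathbf Y_r$$ starting from $\mu_0$ and such that $\mu_t(1)>0$ for any $t\in[0,T]$; 2. there exists at most one measure-valued solution $\varsigma$ (in the sense defined in the context) of the rough Kushner–Stratonovich equation $$\varsigma_t(\varphi)=\varsigma_0(\varphi)+\int_0^t\varsigma_r(A_r^{\mathbf Y}\varphi)\,dr+\int_0^t\big(\varsigma_r(\Gamma_r^{\mathbf Y}\varphi)-\varsigma_r(\varphi)\varsigma_r(h(r,\cdot;\mathbf Y))\big)\big(d\mathbf Y_r-\dot{[\mathbf Y]}_r\,\varsigma_r(h(r,\cdot;\mathbf Y)^\top)\,dr\big)$$ starting from $\varsigma_0$ and such that $(\Psi^\varsigma,(\Psi^\varsigma)')\in\mathscr D_Y^{2\alpha}([0,T],\mathbb R^{1\times d_Y})$, i.e. for all $\kappa,\lambda\in\{1,\dots,d_Y\}$ and $0\le s\le t\le T$, $|(\Psi_t^\varsigma)'_{\kappa\lambda}-(\Psi_s^\varsigma)'_{\kappa\lambda}|\lesssim|t-s|^\alpha$ and $|(\Psi_t^\varsigma)_\kappa-(\Psi_s^\varsigma)_\kappa-\sum_{\eta=1}^{d_Y}(\Psi_s^\varsigma)'_{\kappa\eta}\delta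 Y^\eta_{s,t}|\lesssim|t-s|^{2\alpha}$, where $$(\Psi_t^\varsigma)_\kappa:=\varsigma_t(h_\kappa(t,\cdot;\mathbf Y)),$$ $$(\Psi_t^\varsigma)'_{\kappa\lambda}:=\varsigma_t\big((\Gamma_t^{\mathbf Y})_\lambda h_\kappa(t,\cdot;\mathbf Y)+h'_{\kappa\lambda}(t,\cdot;\mathbf Y)\big)-\varsigma_t(h_\kappa(t,\cdot;\mathbf Y))\,\varsigma_t(h_\lambda(t,\cdot;\mathbf Y)).$$
   Context: **Rough paths.** Fix $T>0$, $\alpha\in(1/3,1/2]$. An $\alpha$-Hölder rough path over $\mathbb R^{d_Y}$ on $[0,T]$ is a pair $\mathbf Y=(Y,\mathbb Y)$, $Y:[0,T]\to\mathbb R^{d_Y}$, $\mathbb Y_{s,t}\in\mathbb R^{d_Y}\otimes\mathbb R^{d_Y}$ ($0\le s\le t\le T$), with Chen's relation $\mathbb Y_{s,t}=\mathbb Y_{s,u}+\mathbb Y_{u,t}+\delta Y_{s,u}\otimes\delta Y_{u,t}$ and $|\delta Y|_\alpha+|\mathbb Y|_{2\alpha}<\infty$, where $\delta Y_{s,t}=Y_t-Y_s$ and $|\Xi|_\gamma=\sup_{s<t}|\Xi_{s,t}|/|t-s|^\gamma$. Metric: $\rho_\alpha(\mathbf Y,\bar{\mathbf Y})=|\delta Y-\delta\bar Y|_\alpha+|\mathbb Y-\bar{\mathbb Y}|_{2\alpha}$. The bracket $[\mathbf Y]$ is defined by $\delta Y\otimes\delta Y=\mathbb Y+\mathbb Y^\top+\delta[\mathbf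 Y]$. $\mathscr C^{0,\alpha,1}$ is the set of rough paths in the $\rho_\alpha$-closure of smooth rough paths (smooth pairs satisfying Chen's relation) for which $t\mapsto\delta[\mathbf Y]_{0,t}$ is $C^1$; $\dot{[\mathbf Y]}_t=d[\mathbf Y]_t/dt$. $a\lesssim b$ means $a\le Cb$ for a constant $C$ independent of $s,t$. **Function spaces.** For $N\in\{0,1,\dots\}$, $\kappa\in(0,1]$, $\mathcal C^{N+\kappa}_b$ is the space of bounded $N$-times continuously differentiable functions with bounded derivatives up to order $N$ and $\kappa$-Hölder $N$-th derivative, with the usual norm (so $\mathcal C^3_b$ means $C^2$ with bounded Lipschitz second derivative). $\mathcal M_F(\mathbb R^d)$: finite Borel measures; $\mu(\psi)=\int\psi\,d\mu$. **Controlled vector fields.** Let $\beta=N+\kappa>1$. A pair of measurable maps $g:[0,T]\to\mathcal C^\beta_b(\mathbb R^{d_X};\mathrm{Lin}(\mathbb R^{d_Y},V))$, $g':[0,T]\to\mathcal C^{\beta-1}_b(\mathbb R^{d_X};\mathrm{Lin}(\mathbb R^{d_Y},\mathrm{Lin}(\mathbb R^{d_Y},V)))$ ($V=\mathbb R^{d_X}$ or $\mathbb R$) is in $\mathscr D_Y^{2\alpha}\mathcal C_b^\beta$ if $\sup_t|g_t|_{\mathcal C^\beta_b}+\sup_t|g'_t|_{\mathcal C_b^{\beta-1}}<\infty$ and $\sum_{j=0}^N[\delta D_x^jg]_\alpha+\sum_{j=0}^{N-1}([\delta D_x^jg']_\alpha+[R^{D_x^jg}]_{2\alpha})<\infty$,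 where $R^{D_x^jg}_{s,t}=D_x^jg_t-D_x^jg_s-D_x^jg'_s\,\delta Y_{s,t}$ and $[\zeta]_\gamma=\sup_{s<t}\sup_x|\zeta_{s,t}(x)|/|t-s|^\gamma$. Components: $g_\kappa$ is $g$ applied to the $\kappa$-th basis vector; $g'_{\kappa\lambda}$ is such that $g_\kappa(t,\cdot)-g_\kappa(s,\cdot)\approx\sum_\lambda g'_{\kappa\lambda}(s,\cdot)\delta Y^\lambda_{s,t}$. **Standing Assumption E on the coefficients.** For any $\mathbf Y\in\mathscr C^{0,\alpha,1}$, the measurable functions $b(\cdot,\cdot;\mathbf Y):[0,T]\times\mathbb R^{d_X}\to\mathbb R^{d_X}$, $\sigma(\cdot,\cdot;\mathbf Y)\in\mathrm{Lin}(\mathbb R^{d_B},\mathbb R^{d_X})$, $f(\cdot,\cdot;\mathbf Y)\in\mathrm{Lin}(\mathbb R^{d_Y},\mathbb R^{d_X})$, $h(\cdot,\cdot;\mathbf Y)\in\mathrm{Lin}(\mathbb R^{d_Y},\mathbb R)$ satisfy: $b,\sigma$ are bounded and Lipschitz in $x$ uniformly in $t$; there are a measurable $f'(\cdot,\cdot;\mathbf Y)$ and $\beta\in(1/\alpha,3]$ with $(f,f')\in\mathscr D_Y^{2\alpha}\mathcal C^\beta_b$; there is a measurable $h'(\cdot,\cdot;\mathbf Y)$ with $(h,h')\in\mathscr D_Y^{2\alpha}\mathcal C^2_b$. **Operators** (coefficients evaluated at $(t,x;\mathbf Y)$): $A_t^{\mathbf Y}\varphi=\sum_i\big(b^i+\sum_{\kappa,\lambda}f_\kappa^i\dot{[\mathbf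 Y]}^{\kappa\lambda}_th_\lambda\big)\partial_i\varphi+\frac12\sum_{i,j}\big(\sum_\theta\sigma^i_\theta\sigma^j_\theta+\sum_{\kappa,\lambda}f^i_\kappa\dot{[\mathbf Y]}_t^{\kappa\lambda}f^j_\lambda\big)\partial^2_{ij}\varphi$; $(\Gamma_t^{\mathbf Y})_\kappa\varphi=\sum_if^i_\kappa\partial_i\varphi+h_\kappa\varphi$; $(\Gamma_t^{\mathbf Y})'_{\kappa\lambda}\varphi=\sum_i(f'_{\kappa\lambda})^i\partial_i\varphi+h'_{\kappa\lambda}\varphi$. The superscript $\mathbf Y$ on $\Gamma$ is omitted below. **Solution of the rough Zakai equation.** A weakly continuous curve $\mu:[0,T]\to\mathcal M_F(\mathbb R^{d_X})$ (i.e. $t\mapsto\mu_t(\varphi)$ continuous for bounded continuous $\varphi$) such that for every $\varphi\in\mathcal C^3_b(\mathbb R^{d_X};\mathbb R)$: (i) $t\mapsto\mu_t(A_t^{\mathbf Y}\varphi)\in L_1([0,T],dt)$; (ii) there is $C_\varphi>0$, uniform over bounded sets of $\varphi$ in $\mathcal C_b^3$, such that for $0\le s\le t\le T$ and all $\kappa,\lambda$, $|\mu_t((\Gamma_t)_\kappa(\Gamma_t)_\lambda\varphi+(\Gamma_t)'_{\lambda\kappa}\varphi)-\mu_s((\Gamma_s)_\kappa(\Gamma_s)_\lambda\varphi+(\Gamma_s)'_{\lambda\kappa}\varphi)|\le C_\varphi|t-s|^\alpha$ and $|\mu_t((\Gamma_t)_\kappa\varphi)-\mu_s((\Gamma_s)_\kappa\varphi)-\sum_\eta\mu_s((\Gamma_s)_\eta(\Gamma_s)_\kappa\varphi+(\Gamma_s)'_{\kappa\eta}\varphi)\delta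 Y^\eta_{s,t}|\le C_\varphi|t-s|^{2\alpha}$; (iii) $\mu_t(\varphi)-\mu_s(\varphi)=\int_s^t\mu_r(A^{\mathbf Y}_r\varphi)dr+\sum_\kappa\mu_s((\Gamma_s)_\kappa\varphi)\delta Y^\kappa_{s,t}+\sum_{\kappa,\lambda}\mu_s((\Gamma_s)_\kappa(\Gamma_s)_\lambda\varphi+(\Gamma_s)'_{\lambda\kappa}\varphi)\mathbb Y^{\kappa\lambda}_{s,t}+o(|t-s|)$ as $|t-s|\to0$, $s\le t$. **Solution of the rough Kushner–Stratonovich equation.** For $\varsigma:[0,T]\to\mathcal M_F(\mathbb R^{d_X})$ and a test function $\varphi$ put $h_\kappa(t)=h_\kappa(t,\cdot;\mathbf Y)=(\Gamma_t)_\kappa1$ and $(\Phi^{\varsigma,\varphi}_t)_\kappa=\varsigma_t((\Gamma_t)_\kappa\varphi)-\varsigma_t(\varphi)\varsigma_t(h_\kappa(t))$; $\varsigma_t((\Gamma_t)_\kappa\varphi)'_\eta=\varsigma_t((\Gamma_t)_\eta(\Gamma_t)_\kappa\varphi+(\Gamma_t)'_{\kappa\eta}\varphi)-\varsigma_t((\Gamma_t)_\kappa\varphi)\varsigma_t(h_\eta(t))$; $\varsigma_t(\varphi)'_\eta=\varsigma_t((\Gamma_t)_\eta\varphi)-\varsigma_t(\varphi)\varsigma_t(h_\eta(t))$; $(\Phi^{\varsigma,\varphi}_t)'_{\kappa\lambda}=\varsigma_t((\Gamma_t)_\kappa\varphi)'_\lambda-\varsigma_t(\varphi)'_\lambda\varsigma_t(h_\kappa(t))-\varsigma_t(\varphi)\varsigma_t((\Gamma_t)_\kappa1)'_\lambda$.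 A measure-valued solution is a weakly continuous curve $\varsigma:[0,T]\to\mathcal M_F(\mathbb R^{d_X})$ such that for every $\varphi\in\mathcal C_b^3(\mathbb R^{d_X};\mathbb R)$: (1) $t\mapsto\varsigma_t(A^{\mathbf Y}_t\varphi)$ and $t\mapsto\sum_{\kappa,\lambda}(\Phi_t^{\varsigma,\varphi})_\kappa\dot{[\mathbf Y]}^{\kappa\lambda}_t\varsigma_t(h_\lambda(t))$ are in $L^1([0,T],dt)$; (2) there is $C_\varphi>0$, uniform over bounded sets of $\varphi$ in $\mathcal C_b^3$, with $|(\Phi_t^{\varsigma,\varphi})'_{\kappa\lambda}-(\Phi_s^{\varsigma,\varphi})'_{\kappa\lambda}|\le C_\varphi|t-s|^\alpha$ and $|(\Phi_t^{\varsigma,\varphi})_\kappa-(\Phi_s^{\varsigma,\varphi})_\kappa-\sum_\eta(\Phi^{\varsigma,\varphi}_s)'_{\kappa\eta}\delta Y^\eta_{s,t}|\le C_\varphi|t-s|^{2\alpha}$; (3) for $s\le t$, $\varsigma_t(\varphi)-\varsigma_s(\varphi)=\int_s^t\big(\varsigma_r(A_r^{\mathbf Y}\varphi)-\sum_{\kappa,\lambda}(\Phi_r^{\varsigma,\varphi})_\kappa\dot{[\mathbf Y]}^{\kappa\lambda}_r\varsigma_r(h_\lambda(r))\big)dr+\sum_\kappa(\Phi_s^{\varsigma,\varphi})_\kappa\delta Y^\kappa_{s,t}+\sum_{\kappa,\lambda}(\Phi_s^{\varsigma,\varphi})'_{\lambda\kappa}\mathbb Y^{\kappa\lambda}_{s,t}+o(|t-s|)$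 as $|t-s|\to0$. *)

theory Defs
  imports "HOL-Analysis.Analysis" "HOL-Probability.Probability_Measure"
begin

section \<open>Iterated derivatives and Hoelder spaces\<close>

text \<open>
  The \<open>j\<close>-th derivative \<open>D\<^sup>j g\<close> is represented by its components: for a list \<open>vs\<close> of \<open>j\<close> basis
  vectors, \<open>iter_pd vs g x\<close> is \<open>D\<^sup>j g (x)\<close> evaluated on \<open>vs\<close>. Norms of \<open>D\<^sup>j g\<close> are summed
  over these finitely many components, and all norms take values in \<^typ>\<open>ennreal\<close>.
\<close>

primrec iter_pd :: "'e::euclidean_space list \<Rightarrow> ('e \<Rightarrow> 'v::real_normed_vector) \<Rightarrow> 'e \<Rightarrow> 'v" where
  "iter_pd [] g = g"
| "iter_pd (v # vs) g = (\<lambda>x. frechet_derivative (iter_pd vs g) (at x) v)"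

definition dirs :: "nat \<Rightarrow> 'e::euclidean_space list set" where
  "dirs j = {vs. set vs \<subseteq> Basis \<and> length vs = j}"

definition cont_diff :: "nat \<Rightarrow> ('e::euclidean_space \<Rightarrow> 'v::real_normed_vector) \<Rightarrow> bool" where
  "cont_diff N g \<longleftrightarrow>
     (\<forall>j<N. \<forall>vs\<in>dirs j. iter_pd vs g differentiable_on UNIV) \<and>
     (\<forall>j\<le>N. \<forall>vs\<in>dirs j. continuous_on UNIV (iter_pd vs g))"

text \<open>The decomposition \<open>\<beta> = N + \<kappa>\<close> with \<open>\<kappa> \<in> (0, 1]\<close>; in particular \<open>3 = 2 + 1\<close>.\<close>

definition int_order :: "real \<Rightarrow> nat" where
  "int_order \<beta> = nat (\<lceil>\<beta>\<rceil> - 1)"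

definition frac_order :: "real \<Rightarrow> real" where
  "frac_order \<beta> = \<beta> - real (int_order \<beta>)"

definition Cb_norm :: "real \<Rightarrow> ('e::euclidean_space \<Rightarrow> 'v::real_normed_vector) \<Rightarrow> ennreal" where
  "Cb_norm \<beta> g =
     (\<Sum>j\<le>int_order \<beta>. \<Sum>vs\<in>dirs j. SUP x. ennreal (norm (iter_pd vs g x))) +
     (\<Sum>vs\<in>dirs (int_order \<beta>). SUP (x, y)\<in>{(x, y). x \<noteq> y}.
        ennreal (norm (iter_pd vs g x - iter_pd vs g y) / norm (x - y) powr frac_order \<beta>))"

definition Cb :: "real \<Rightarrow> ('e::euclidean_space \<Rightarrow> 'v::real_normed_vector) set" where
  "Cb \<beta> = {g. cont_diff (int_order \<beta>) g \<and> Cb_norm \<beta> g < \<infinity>}"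

text \<open>The Borel \<open>\<sigma>\<close>-algebra of the norm topology on \<^term>\<open>Cb \<beta>\<close>.\<close>

definition Cb_borel :: "real \<Rightarrow> ('e::euclidean_space \<Rightarrow> 'v::real_normed_vector) measure" where
  "Cb_borel \<beta> = sigma (Cb \<beta>)
     {U. U \<subseteq> Cb \<beta> \<and>
         (\<forall>g\<in>U. \<exists>e>0. \<forall>k\<in>Cb \<beta>. Cb_norm \<beta> (\<lambda>x. k x - g x) < ennreal e \<longrightarrow> k \<in> U)}"


section \<open>Rough paths\<close>

text \<open>
  A pair \<open>(Y, YY)\<close>; only the values \<open>Y t\<close> for \<open>0 \<le> t \<le> T\<close> and \<open>YY s t\<close> for
  \<open>0 \<le> s \<le> t \<le> T\<close> are meaningful.
\<close>

type_synonym 'y rough_path = "(real \<Rightarrow> real^'y) \<times> (real \<Rightarrow> real \<Rightarrow> real^'y^'y)"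

definition incr :: "(real \<Rightarrow> 'v::ab_group_add) \<Rightarrow> real \<Rightarrow> real \<Rightarrow> 'v" where
  "incr F s t = F t - F s"

definition outer :: "real^'y \<Rightarrow> real^'y \<Rightarrow> real^'y^'y" where
  "outer u v = (\<chi> \<kappa> \<iota>. u $ \<kappa> * v $ \<iota>)"

definition holder_seminorm :: "real \<Rightarrow> real \<Rightarrow> (real \<Rightarrow> real \<Rightarrow> 'v::real_normed_vector) \<Rightarrow> ennreal" where
  "holder_seminorm T \<gamma> \<Xi> =
     (SUP (s, t)\<in>{(s, t). 0 \<le> s \<and> s < t \<and> t \<le> T}. ennreal (norm (\<Xi> s t) / (t - s) powr \<gamma>))"

definition chen :: "real \<Rightarrow> 'y::finite rough_path \<Rightarrow> bool" where
  "chen T Y \<longleftrightarrow> (\<forall>s u t. 0 \<le> s \<and> s \<le> u \<and> u \<le> t \<and> t \<le> T \<longrightarrow>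
     snd Y s t = snd Y s u + snd Y u t + outer (incr (fst Y) s u) (incr (fst Y) u t))"

definition rough_path :: "real \<Rightarrow> real \<Rightarrow> 'y::finite rough_path \<Rightarrow> bool" where
  "rough_path T \<alpha> Y \<longleftrightarrow> chen T Y \<and>
     holder_seminorm T \<alpha> (incr (fst Y)) + holder_seminorm T (2 * \<alpha>) (snd Y) < \<infinity>"

definition rough_dist :: "real \<Rightarrow> real \<Rightarrow> 'y::finite rough_path \<Rightarrow> 'y rough_path \<Rightarrow> ennreal" where
  "rough_dist T \<alpha> Y Z =
     holder_seminorm T \<alpha> (\<lambda>s t. incr (fst Y) s t - incr (fst Z) s t) +
     holder_seminorm T (2 * \<alpha>) (\<lambda>s t. snd Y s t - snd Z s t)"

text \<open>Smoothness up to the boundary of the interval and of the simplex, via smooth extensions.\<close>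

definition smooth_rough_path :: "real \<Rightarrow> 'y::finite rough_path \<Rightarrow> bool" where
  "smooth_rough_path T Y \<longleftrightarrow> chen T Y \<and>
     (\<exists>F. (\<forall>N. cont_diff N F) \<and> (\<forall>t\<in>{0..T}. fst Y t = F t)) \<and>
     (\<exists>G. (\<forall>N. cont_diff N G) \<and> (\<forall>s t. 0 \<le> s \<and> s \<le> t \<and> t \<le> T \<longrightarrow> snd Y s t = G (s, t)))"

text \<open>\<open>bracket_incr Y s t\<close> is the increment of the bracket of \<open>Y\<close> between \<open>s\<close> and \<open>t\<close>.\<close>

definition bracket_incr :: "'y::finite rough_path \<Rightarrow> real \<Rightarrow> real \<Rightarrow> real^'y^'y" where
  "bracket_incr Y s t =
     outer (incr (fst Y) s t) (incr (fst Y) s t) - snd Y s t - transpose (snd Y s t)"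

definition bracket_dot :: "real \<Rightarrow> 'y::finite rough_path \<Rightarrow> real \<Rightarrow> real^'y^'y" where
  "bracket_dot T Y t = vector_derivative (bracket_incr Y 0) (at t within {0..T})"

text \<open>The set \<open>C\<^bsup>0,\<alpha>,1\<^esup>\<close> of rough paths in the closure of the smooth ones whose bracket is \<open>C\<^sup>1\<close> on \<open>[0, T]\<close>.\<close>

definition rough_paths_0_1 :: "real \<Rightarrow> real \<Rightarrow> 'y::finite rough_path set" where
  "rough_paths_0_1 T \<alpha> = {Y. rough_path T \<alpha> Y \<and>
     (\<forall>e>0. \<exists>Z. smooth_rough_path T Z \<and> rough_dist T \<alpha> Y Z < ennreal e) \<and>
     bracket_incr Y 0 differentiable_on {0..T} \<and>
     continuous_on {0..T} (bracket_dot T Y)}"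


section \<open>Controlled vector fields and the standing assumption\<close>

definition unif_holder_seminorm ::
  "real \<Rightarrow> real \<Rightarrow> (real \<Rightarrow> real \<Rightarrow> 'e \<Rightarrow> 'v::real_normed_vector) \<Rightarrow> ennreal" where
  "unif_holder_seminorm T \<gamma> \<zeta> =
     (SUP (s, t)\<in>{(s, t). 0 \<le> s \<and> s < t \<and> t \<le> T}. SUP x.
        ennreal (norm (\<zeta> s t x) / (t - s) powr \<gamma>))"

text \<open>
  In \<open>g' s x\<close> the first argument is the direction of \<open>\<delta>Y\<close>, so that the component \<open>g'\<^sub>\<kappa>\<^sub>\<iota>\<close> is
  \<open>g'\<close> applied first to the \<open>\<iota>\<close>-th and then to the \<open>\<kappa>\<close>-th basis vector.
\<close>

definition controlled_vf ::
  "real \<Rightarrow> real \<Rightarrow> real \<Rightarrow> (real \<Rightarrow> real^'y::finite) \<Rightarrow>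
   (real \<Rightarrow> 'e::euclidean_space \<Rightarrow> ((real^'y) \<Rightarrow>\<^sub>L 'v::real_normed_vector)) \<Rightarrow>
   (real \<Rightarrow> 'e \<Rightarrow> ((real^'y) \<Rightarrow>\<^sub>L ((real^'y) \<Rightarrow>\<^sub>L 'v))) \<Rightarrow> bool" where
  "controlled_vf T \<alpha> \<beta> Y g g' \<longleftrightarrow>
     g \<in> measurable (restrict_space borel {0..T}) (Cb_borel \<beta>) \<and>
     g' \<in> measurable (restrict_space borel {0..T}) (Cb_borel (\<beta> - 1)) \<and>
     (SUP t\<in>{0..T}. Cb_norm \<beta> (g t)) + (SUP t\<in>{0..T}. Cb_norm (\<beta> - 1) (g' t)) < \<infinity> \<and>
     (\<Sum>j\<le>int_order \<beta>. \<Sum>vs\<in>dirs j.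
        unif_holder_seminorm T \<alpha> (\<lambda>s t x. iter_pd vs (g t) x - iter_pd vs (g s) x)) +
     (\<Sum>j<int_order \<beta>. \<Sum>vs\<in>dirs j.
        unif_holder_seminorm T \<alpha> (\<lambda>s t x. iter_pd vs (g' t) x - iter_pd vs (g' s) x) +
        unif_holder_seminorm T (2 * \<alpha>) (\<lambda>s t x.
          iter_pd vs (g t) x - iter_pd vs (g s) x
          - blinfun_apply (iter_pd vs (g' s) x) (incr Y s t))) < \<infinity>"

record ('x, 'y, 'b) coeffs =
  co_b :: "real \<Rightarrow> real^'x \<Rightarrow> real^'x"
  co_\<sigma> :: "real \<Rightarrow> real^'x \<Rightarrow> ((real^'b) \<Rightarrow>\<^sub>L (real^'x))"
  co_f :: "real \<Rightarrow> real^'x \<Rightarrow> ((real^'y) \<Rightarrow>\<^sub>L (real^'x))"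
  co_f' :: "real \<Rightarrow> real^'x \<Rightarrow> ((real^'y) \<Rightarrow>\<^sub>L ((real^'y) \<Rightarrow>\<^sub>L (real^'x)))"
  co_h :: "real \<Rightarrow> real^'x \<Rightarrow> ((real^'y) \<Rightarrow>\<^sub>L real)"
  co_h' :: "real \<Rightarrow> real^'x \<Rightarrow> ((real^'y) \<Rightarrow>\<^sub>L ((real^'y) \<Rightarrow>\<^sub>L real))"

definition jointly_measurable ::
  "real \<Rightarrow> (real \<Rightarrow> 'e::euclidean_space \<Rightarrow> 'v::topological_space) \<Rightarrow> bool" where
  "jointly_measurable T g \<longleftrightarrow>
     (\<lambda>(t, x). g t x) \<in> borel_measurable (restrict_space borel ({0..T} \<times> UNIV))"

definition bounded_lipschitz ::
  "real \<Rightarrow> (real \<Rightarrow> 'e::euclidean_space \<Rightarrow> 'v::real_normed_vector) \<Rightarrow> bool" where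
  "bounded_lipschitz T g \<longleftrightarrow>
     (\<exists>C. \<forall>t\<in>{0..T}. (\<forall>x. norm (g t x) \<le> C) \<and> C-lipschitz_on UNIV (g t))"

definition assumption_E ::
  "real \<Rightarrow> real \<Rightarrow> ('y::finite rough_path \<Rightarrow> ('x::finite, 'y, 'b::finite) coeffs) \<Rightarrow> bool" where
  "assumption_E T \<alpha> c \<longleftrightarrow> (\<forall>Y\<in>rough_paths_0_1 T \<alpha>.
     jointly_measurable T (co_b (c Y)) \<and> jointly_measurable T (co_\<sigma> (c Y)) \<and>
     jointly_measurable T (co_f (c Y)) \<and> jointly_measurable T (co_f' (c Y)) \<and>
     jointly_measurable T (co_h (c Y)) \<and> jointly_measurable T (co_h' (c Y)) \<and>
     bounded_lipschitz T (co_b (c Y)) \<and> bounded_lipschitz T (co_\<sigma> (c Y)) \<and>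
     (\<exists>\<beta>. 1 / \<alpha> < \<beta> \<and> \<beta> \<le> 3 \<and> controlled_vf T \<alpha> \<beta> (fst Y) (co_f (c Y)) (co_f' (c Y))) \<and>
     controlled_vf T \<alpha> 2 (fst Y) (co_h (c Y)) (co_h' (c Y)))"


section \<open>Operators\<close>

text \<open>Indices in \<open>{1, \<dots>, d\<^sub>Y}\<close> are written \<open>\<kappa>, \<iota>, \<eta> :: 'y\<close>.\<close>

definition comp1 :: "((real^'y::finite) \<Rightarrow>\<^sub>L 'v::real_normed_vector) \<Rightarrow> 'y \<Rightarrow> 'v" where
  "comp1 L \<kappa> = blinfun_apply L (axis \<kappa> 1)"

definition comp2 :: "((real^'y::finite) \<Rightarrow>\<^sub>L ((real^'y) \<Rightarrow>\<^sub>L 'v::real_normed_vector)) \<Rightarrow> 'y \<Rightarrow> 'y \<Rightarrow> 'v" where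
  "comp2 L \<kappa> \<iota> = comp1 (comp1 L \<iota>) \<kappa>"

definition pd :: "'x::finite \<Rightarrow> (real^'x \<Rightarrow> real) \<Rightarrow> real^'x \<Rightarrow> real" where
  "pd i \<phi> = iter_pd [axis i 1] \<phi>"

definition pd2 :: "'x::finite \<Rightarrow> 'x \<Rightarrow> (real^'x \<Rightarrow> real) \<Rightarrow> real^'x \<Rightarrow> real" where
  "pd2 i j \<phi> = iter_pd [axis i 1, axis j 1] \<phi>"

definition A_op ::
  "real \<Rightarrow> 'y::finite rough_path \<Rightarrow> ('x::finite, 'y, 'b::finite) coeffs \<Rightarrow>
   real \<Rightarrow> (real^'x \<Rightarrow> real) \<Rightarrow> real^'x \<Rightarrow> real" where
  "A_op T Y c t \<phi> x =
     (\<Sum>i\<in>UNIV.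
        (co_b c t x $ i +
         (\<Sum>\<kappa>\<in>UNIV. \<Sum>\<iota>\<in>UNIV.
            comp1 (co_f c t x) \<kappa> $ i * bracket_dot T Y t $ \<kappa> $ \<iota> * comp1 (co_h c t x) \<iota>))
        * pd i \<phi> x) +
     1 / 2 * (\<Sum>i\<in>UNIV. \<Sum>j\<in>UNIV.
        ((\<Sum>\<theta>\<in>UNIV. comp1 (co_\<sigma> c t x) \<theta> $ i * comp1 (co_\<sigma> c t x) \<theta> $ j) +
         (\<Sum>\<kappa>\<in>UNIV. \<Sum>\<iota>\<in>UNIV.
            comp1 (co_f c t x) \<kappa> $ i * bracket_dot T Y t $ \<kappa> $ \<iota> * comp1 (co_f c t x) \<iota> $ j))
        * pd2 i j \<phi> x)"

definition Gam ::
  "('x::finite, 'y::finite, 'b::finite) coeffs \<Rightarrow> real \<Rightarrow> 'y \<Rightarrow> (real^'x \<Rightarrow> real) \<Rightarrow> real^'x \<Rightarrow> real" where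
  "Gam c t \<kappa> \<phi> x =
     (\<Sum>i\<in>UNIV. comp1 (co_f c t x) \<kappa> $ i * pd i \<phi> x) + comp1 (co_h c t x) \<kappa> * \<phi> x"

definition Gam' ::
  "('x::finite, 'y::finite, 'b::finite) coeffs \<Rightarrow> real \<Rightarrow> 'y \<Rightarrow> 'y \<Rightarrow> (real^'x \<Rightarrow> real) \<Rightarrow> real^'x \<Rightarrow> real" where
  "Gam' c t \<kappa> \<iota> \<phi> x =
     (\<Sum>i\<in>UNIV. comp2 (co_f' c t x) \<kappa> \<iota> $ i * pd i \<phi> x) + comp2 (co_h' c t x) \<kappa> \<iota> * \<phi> x"

text \<open>\<open>\<Gamma>\<^sub>\<kappa> \<Gamma>\<^sub>\<iota> \<phi> + \<Gamma>'\<^sub>\<iota>\<^sub>\<kappa> \<phi>\<close>; note the order of the indices in the second summand.\<close>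

definition Gam2 ::
  "('x::finite, 'y::finite, 'b::finite) coeffs \<Rightarrow> real \<Rightarrow> 'y \<Rightarrow> 'y \<Rightarrow> (real^'x \<Rightarrow> real) \<Rightarrow> real^'x \<Rightarrow> real" where
  "Gam2 c t \<kappa> \<iota> \<phi> x = Gam c t \<kappa> (Gam c t \<iota> \<phi>) x + Gam' c t \<iota> \<kappa> \<phi> x"


section \<open>Measure-valued curves and the rough Zakai equation\<close>

definition weakly_continuous :: "real \<Rightarrow> (real \<Rightarrow> (real^'x::finite) measure) \<Rightarrow> bool" where
  "weakly_continuous T \<mu> \<longleftrightarrow>
     (\<forall>t\<in>{0..T}. finite_measure (\<mu> t) \<and> sets (\<mu> t) = sets borel) \<and>
     (\<forall>\<phi>::real^'x \<Rightarrow> real. continuous_on UNIV \<phi> \<and> bounded (range \<phi>) \<longrightarrow>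
        continuous_on {0..T} (\<lambda>t. integral\<^sup>L (\<mu> t) \<phi>))"

definition small_o_incr :: "real \<Rightarrow> (real \<Rightarrow> real \<Rightarrow> real) \<Rightarrow> bool" where
  "small_o_incr T R \<longleftrightarrow>
     (\<forall>e>0. \<exists>d>0. \<forall>s t. 0 \<le> s \<and> s \<le> t \<and> t \<le> T \<and> t - s < d \<longrightarrow> \<bar>R s t\<bar> \<le> e * (t - s))"

text \<open>
  A constant that is uniform over bounded sets of test functions is one that may depend on a
  bound \<open>R\<close> for the norm of \<open>\<phi>\<close>, but not otherwise on \<open>\<phi>\<close>.
\<close>

definition zakai_solution ::
  "real \<Rightarrow> real \<Rightarrow> 'y::finite rough_path \<Rightarrow> ('x::finite, 'y, 'b::finite) coeffs \<Rightarrow>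
   (real \<Rightarrow> (real^'x) measure) \<Rightarrow> bool" where
  "zakai_solution T \<alpha> Y c \<mu> \<longleftrightarrow>
     weakly_continuous T \<mu> \<and>
     (\<forall>\<phi>\<in>Cb 3. set_integrable lborel {0..T} (\<lambda>t. integral\<^sup>L (\<mu> t) (A_op T Y c t \<phi>))) \<and>
     (\<forall>R. \<exists>C>0. \<forall>\<phi>\<in>Cb 3. Cb_norm 3 \<phi> \<le> ennreal R \<longrightarrow>
        (\<forall>s t. 0 \<le> s \<and> s \<le> t \<and> t \<le> T \<longrightarrow>
          (\<forall>\<kappa> \<iota>. \<bar>integral\<^sup>L (\<mu> t) (Gam2 c t \<kappa> \<iota> \<phi>) - integral\<^sup>L (\<mu> s) (Gam2 c s \<kappa> \<iota> \<phi>)\<bar>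
             \<le> C * \<bar>t - s\<bar> powr \<alpha>) \<and>
          (\<forall>\<kappa>. \<bar>integral\<^sup>L (\<mu> t) (Gam c t \<kappa> \<phi>) - integral\<^sup>L (\<mu> s) (Gam c s \<kappa> \<phi>)
              - (\<Sum>\<eta>\<in>UNIV. integral\<^sup>L (\<mu> s) (Gam2 c s \<eta> \<kappa> \<phi>) * incr (fst Y) s t $ \<eta>)\<bar>
             \<le> C * \<bar>t - s\<bar> powr (2 * \<alpha>)))) \<and>
     (\<forall>\<phi>\<in>Cb 3. small_o_incr T (\<lambda>s t.
        integral\<^sup>L (\<mu> t) \<phi> - integral\<^sup>L (\<mu> s) \<phi>
        - ((LBINT r:{s..t}. integral\<^sup>L (\<mu> r) (A_op T Y c r \<phi>))
           + (\<Sum>\<kappa>\<in>UNIV. integral\<^sup>L (\<mu> s) (Gam c s \<kappa> \<phi>) * incr (fst Y) s t $ \<kappa>)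
           + (\<Sum>\<kappa>\<in>UNIV. \<Sum>\<iota>\<in>UNIV.
                integral\<^sup>L (\<mu> s) (Gam2 c s \<kappa> \<iota> \<phi>) * snd Y s t $ \<kappa> $ \<iota>))))"


section \<open>The rough Kushner--Stratonovich equation\<close>

text \<open>In this section \<open>M\<close> plays the role of the measure \<open>\<varsigma>\<^sub>t\<close> at the given time \<open>t\<close>.\<close>

definition h_comp :: "('x::finite, 'y::finite, 'b::finite) coeffs \<Rightarrow> real \<Rightarrow> 'y \<Rightarrow> real^'x \<Rightarrow> real" where
  "h_comp c t \<kappa> x = comp1 (co_h c t x) \<kappa>"

definition Phi ::
  "('x::finite, 'y::finite, 'b::finite) coeffs \<Rightarrow> real \<Rightarrow> (real^'x) measure \<Rightarrow> (real^'x \<Rightarrow> real) \<Rightarrow> 'y \<Rightarrow> real" where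
  "Phi c t M \<phi> \<kappa> =
     integral\<^sup>L M (Gam c t \<kappa> \<phi>) - integral\<^sup>L M \<phi> * integral\<^sup>L M (h_comp c t \<kappa>)"

text \<open>\<open>\<varsigma>\<^sub>t(\<phi>)'\<^sub>\<eta>\<close> and \<open>\<varsigma>\<^sub>t(\<Gamma>\<^sub>\<kappa> \<phi>)'\<^sub>\<eta>\<close>\<close>

definition test_deriv ::
  "('x::finite, 'y::finite, 'b::finite) coeffs \<Rightarrow> real \<Rightarrow> (real^'x) measure \<Rightarrow> (real^'x \<Rightarrow> real) \<Rightarrow> 'y \<Rightarrow> real" where
  "test_deriv c t M \<phi> \<eta> =
     integral\<^sup>L M (Gam c t \<eta> \<phi>) - integral\<^sup>L M \<phi> * integral\<^sup>L M (h_comp c t \<eta>)"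

definition Gam_deriv ::
  "('x::finite, 'y::finite, 'b::finite) coeffs \<Rightarrow> real \<Rightarrow> (real^'x) measure \<Rightarrow> (real^'x \<Rightarrow> real) \<Rightarrow> 'y \<Rightarrow> 'y \<Rightarrow> real" where
  "Gam_deriv c t M \<phi> \<kappa> \<eta> =
     integral\<^sup>L M (Gam2 c t \<eta> \<kappa> \<phi>) - integral\<^sup>L M (Gam c t \<kappa> \<phi>) * integral\<^sup>L M (h_comp c t \<eta>)"

definition Phi' ::
  "('x::finite, 'y::finite, 'b::finite) coeffs \<Rightarrow> real \<Rightarrow> (real^'x) measure \<Rightarrow> (real^'x \<Rightarrow> real) \<Rightarrow> 'y \<Rightarrow> 'y \<Rightarrow> real" where
  "Phi' c t M \<phi> \<kappa> \<iota> =
     Gam_deriv c t M \<phi> \<kappa> \<iota> - test_deriv c t M \<phi> \<iota> * integral\<^sup>L M (h_comp c t \<kappa>)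
     - integral\<^sup>L M \<phi> * Gam_deriv c t M (\<lambda>_. 1) \<kappa> \<iota>"

definition Phi_bracket_h ::
  "real \<Rightarrow> 'y::finite rough_path \<Rightarrow> ('x::finite, 'y, 'b::finite) coeffs \<Rightarrow>
   real \<Rightarrow> (real^'x) measure \<Rightarrow> (real^'x \<Rightarrow> real) \<Rightarrow> real" where
  "Phi_bracket_h T Y c t M \<phi> =
     (\<Sum>\<kappa>\<in>UNIV. \<Sum>\<iota>\<in>UNIV.
        Phi c t M \<phi> \<kappa> * bracket_dot T Y t $ \<kappa> $ \<iota> * integral\<^sup>L M (h_comp c t \<iota>))"

definition kushner_solution ::
  "real \<Rightarrow> real \<Rightarrow> 'y::finite rough_path \<Rightarrow> ('x::finite, 'y, 'b::finite) coeffs \<Rightarrow>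
   (real \<Rightarrow> (real^'x) measure) \<Rightarrow> bool" where
  "kushner_solution T \<alpha> Y c \<nu> \<longleftrightarrow>
     weakly_continuous T \<nu> \<and>
     (\<forall>\<phi>\<in>Cb 3.
        set_integrable lborel {0..T} (\<lambda>t. integral\<^sup>L (\<nu> t) (A_op T Y c t \<phi>)) \<and>
        set_integrable lborel {0..T} (\<lambda>t. Phi_bracket_h T Y c t (\<nu> t) \<phi>)) \<and>
     (\<forall>R. \<exists>C>0. \<forall>\<phi>\<in>Cb 3. Cb_norm 3 \<phi> \<le> ennreal R \<longrightarrow>
        (\<forall>s t. 0 \<le> s \<and> s \<le> t \<and> t \<le> T \<longrightarrow>
          (\<forall>\<kappa> \<iota>. \<bar>Phi' c t (\<nu> t) \<phi> \<kappa> \<iota> - Phi' c s (\<nu> s) \<phi> \<kappa> \<iota>\<bar> \<le> C * \<bar>t - s\<bar> powr \<alpha>) \<and>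
          (\<forall>\<kappa>. \<bar>Phi c t (\<nu> t) \<phi> \<kappa> - Phi c s (\<nu> s) \<phi> \<kappa>
              - (\<Sum>\<eta>\<in>UNIV. Phi' c s (\<nu> s) \<phi> \<kappa> \<eta> * incr (fst Y) s t $ \<eta>)\<bar>
             \<le> C * \<bar>t - s\<bar> powr (2 * \<alpha>)))) \<and>
     (\<forall>\<phi>\<in>Cb 3. small_o_incr T (\<lambda>s t.
        integral\<^sup>L (\<nu> t) \<phi> - integral\<^sup>L (\<nu> s) \<phi>
        - ((LBINT r:{s..t}. integral\<^sup>L (\<nu> r) (A_op T Y c r \<phi>) - Phi_bracket_h T Y c r (\<nu> r) \<phi>)
           + (\<Sum>\<kappa>\<in>UNIV. Phi c s (\<nu> s) \<phi> \<kappa> * incr (fst Y) s t $ \<kappa>)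
           + (\<Sum>\<kappa>\<in>UNIV. \<Sum>\<iota>\<in>UNIV. Phi' c s (\<nu> s) \<phi> \<iota> \<kappa> * snd Y s t $ \<kappa> $ \<iota>))))"

definition Psi ::
  "('x::finite, 'y::finite, 'b::finite) coeffs \<Rightarrow> real \<Rightarrow> (real^'x) measure \<Rightarrow> 'y \<Rightarrow> real" where
  "Psi c t M \<kappa> = integral\<^sup>L M (h_comp c t \<kappa>)"

definition Psi' ::
  "('x::finite, 'y::finite, 'b::finite) coeffs \<Rightarrow> real \<Rightarrow> (real^'x) measure \<Rightarrow> 'y \<Rightarrow> 'y \<Rightarrow> real" where
  "Psi' c t M \<kappa> \<iota> =
     integral\<^sup>L M (\<lambda>x. Gam c t \<iota> (h_comp c t \<kappa>) x + comp2 (co_h' c t x) \<kappa> \<iota>)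
     - integral\<^sup>L M (h_comp c t \<kappa>) * integral\<^sup>L M (h_comp c t \<iota>)"

definition Psi_controlled ::
  "real \<Rightarrow> real \<Rightarrow> 'y::finite rough_path \<Rightarrow> ('x::finite, 'y, 'b::finite) coeffs \<Rightarrow>
   (real \<Rightarrow> (real^'x) measure) \<Rightarrow> bool" where
  "Psi_controlled T \<alpha> Y c \<nu> \<longleftrightarrow>
     (\<forall>\<kappa> \<iota>. \<exists>C. \<forall>s t. 0 \<le> s \<and> s \<le> t \<and> t \<le> T \<longrightarrow>
        \<bar>Psi' c t (\<nu> t) \<kappa> \<iota> - Psi' c s (\<nu> s) \<kappa> \<iota>\<bar> \<le> C * \<bar>t - s\<bar> powr \<alpha>) \<and>
     (\<forall>\<kappa>. \<exists>C. \<forall>s t. 0 \<le> s \<and> s \<le> t \<and> t \<le> T \<longrightarrow>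
        \<bar>Psi c t (\<nu> t) \<kappa> - Psi c s (\<nu> s) \<kappa>
          - (\<Sum>\<eta>\<in>UNIV. Psi' c s (\<nu> s) \<kappa> \<eta> * incr (fst Y) s t $ \<eta>)\<bar>
        \<le> C * \<bar>t - s\<bar> powr (2 * \<alpha>))"

text \<open>Curves are identified when they agree on \<open>[0, T]\<close>.\<close>

definition at_most_one_curve :: "real \<Rightarrow> ((real \<Rightarrow> 'm) \<Rightarrow> bool) \<Rightarrow> bool" where
  "at_most_one_curve T P \<longleftrightarrow> (\<forall>\<mu> \<nu>. P \<mu> \<and> P \<nu> \<longrightarrow> (\<forall>t\<in>{0..T}. \<mu> t = \<nu> t))"

end

theory Submission
  imports Defs
begin

text \<open>
  The two equations are equivalent up to the total mass. Let \<open>\<mu>\<close> be a curve of measures with positive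
  mass, \<open>m\<^sub>t = \<mu>\<^sub>t(1)\<close>, and \<open>\<nu> = \<mu> / m\<close> its normalisation; write \<open>\<Psi>\<^sub>t = \<nu>\<^sub>t(h(t))\<close>. If \<open>\<mu>\<close> solves the Zakai
  equation, the choice \<open>\<phi> = 1\<close> gives the linear equation \<open>dm = m \<Psi> dY\<close>, because \<open>A 1 = 0\<close> and
  \<open>\<Gamma> 1 = h\<close>. By the Ito formula for rough paths with a \<open>C\<^sup>1\<close> bracket \<open>[Y]\<close>, its logarithm \<open>L = ln m\<close> satisfies
  \<open>dL = \<Psi> dY - (1/2) \<Psi> [Y]' \<Psi>\<^sup>T dt\<close>, and the product rule applied to \<open>\<nu> = exp (- L) \<mu>\<close> gives the
  Kushner--Stratonovich equation. Conversely, if \<open>\<nu>\<close> is a Kushner--Stratonovich solution for which \<open>\<Psi>\<close> is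
  controlled by \<open>Y\<close>, then the rough integral defining \<open>L\<close> from \<open>\<nu>\<close> exists and \<open>\<mu> = exp L \<nu>\<close> solves the
  Zakai equation. The total mass of \<open>\<mu>\<close> is then \<open>exp L\<close>, because both have the same expansion and the same
  initial value; hence \<open>\<nu>(1) = 1\<close>.

  The passage in both directions is one statement, \<open>zakai_solution_iff_kushner_solution\<close>: if \<open>L\<close> is the
  rough logarithm attached to \<open>\<nu>\<close> and \<open>\<mu> = exp L \<nu>\<close>, then \<open>\<mu>\<close> solves one equation if and only if
  \<open>\<nu>\<close> solves the other. Since \<open>L\<close> is determined by \<open>\<nu>\<close>, and also by \<open>\<mu>\<close> as \<open>ln \<mu>(1)\<close>, two different
  solutions of one equation yield two different solutions of the other.

  All expansions are handled by a calculus of families of real processes \<open>X\<close>, indexed by a parameter \<open>p\<close>, that satisfy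
  \<open>X\<^sub>t - X\<^sub>s = \<integral>\<^bsub>[s,t]\<^esub> a dr + X1\<^sub>s \<bullet> \<delta>Y\<^bsub>s,t\<^esub> + X2\<^sub>s \<bullet> YY\<^bsub>s,t\<^esub> + O(|t-s|\<^bsup>3\<alpha>\<^esup>)\<close>
  with \<open>X1\<close> controlled by \<open>Y\<close> with derivative \<open>X2\<close> (\<open>rough_ito\<close>). The error bounds are uniform in the parameter \<open>p\<close>,
  because the solution concepts ask for constants that are uniform over bounded sets of test functions.
  The definitions only provide an error \<open>o(|t - s|)\<close> in the expansion, and not uniformly in \<open>\<phi>\<close>; the quantitative
  uniqueness part of the sewing lemma (\<open>sewing_bound\<close>) improves it to a uniform \<open>O(|t-s|\<^bsup>3\<alpha>\<^esup>)\<close>. The existence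
  part (\<open>sewing\<close>) provides \<open>L\<close>. With these, the class is closed under products (\<open>rough_ito_prod\<close>)
  and smooth functions (\<open>rough_ito_comp\<close>), and the theorem becomes a computation with coefficients.
\<close>

section \<open>The sewing lemma\<close>


text \<open>
  Halving \<open>[s, t]\<close> repeatedly, the defects at level \<open>k\<close> add up to \<open>C |t - s|\<^sup>\<theta> q\<^sup>k\<close> with \<open>q = 2 powr (1 - \<theta>) < 1\<close>,
  while the \<open>2\<^sup>n\<close> remaining pieces contribute at most \<open>\<epsilon> |t - s|\<close> once they are short enough. Hence the
  uncontrolled \<open>o(|t - s|)\<close> disappears and the bound depends on \<open>C\<close> and \<open>\<theta>\<close> alone.
\<close>

lemma sewing_bound:
  fixes R :: "real \<Rightarrow> real \<Rightarrow> real"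
  assumes C: "0 \<le> C" and \<theta>: "1 < \<theta>" and o: "small_o_incr T R"
    and defect: "\<And>s u t. 0 \<le> s \<Longrightarrow> s \<le> u \<Longrightarrow> u \<le> t \<Longrightarrow> t \<le> T \<Longrightarrow>
      \<bar>R s t - R s u - R u t\<bar> \<le> C * (t - s) powr \<theta>"
    and st: "0 \<le> s" "s \<le> t" "t \<le> T"
  shows "\<bar>R s t\<bar> \<le> C / (1 - 2 powr (1 - \<theta>)) * (t - s) powr \<theta>"
proof -
  define q where "q = (2::real) powr (1 - \<theta>)"
  have q: "0 < q" "q < 1"
    using \<theta> by (auto simp: q_def powr_less_one)
  have half: "2 * (x / 2) powr \<theta> = q * x powr \<theta>" if "0 \<le> x" for x :: real
    using that by (simp add: q_def powr_divide powr_diff)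
  have step: "\<bar>R s t\<bar> \<le> C * (t - s) powr \<theta> * (\<Sum>k<n. q ^ k) + e * (t - s)"
    if "0 \<le> s" "s \<le> t" "t \<le> T" "t - s < d * 2 ^ n"
      and d: "\<And>u v. 0 \<le> u \<Longrightarrow> u \<le> v \<Longrightarrow> v \<le> T \<Longrightarrow> v - u < d \<Longrightarrow> \<bar>R u v\<bar> \<le> e * (v - u)"
    for s t d e n
    using that(1-4)
  proof (induction n arbitrary: s t)
    case 0
    then show ?case using d[of s t] by simp
  next
    case (Suc n)
    define u where "u = (s + t) / 2"
    have u: "u - s = (t - s) / 2" "t - u = (t - s) / 2" by (auto simp: u_def field_simps)
    have su: "s \<le> u" "u \<le> t" using Suc.prems by (auto simp: u_def)
    have "\<bar>R s t\<bar> \<le> \<bar>R s u\<bar> + \<bar>R u t\<bar> + C * (t - s) powr \<theta>"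
      using defect[of s u t] su Suc.prems by linarith
    also have "\<bar>R s u\<bar> \<le> C * (u - s) powr \<theta> * (\<Sum>k<n. q ^ k) + e * (u - s)"
      by (rule Suc.IH) (use su Suc.prems u in auto)
    also have "\<bar>R u t\<bar> \<le> C * (t - u) powr \<theta> * (\<Sum>k<n. q ^ k) + e * (t - u)"
      by (rule Suc.IH) (use su Suc.prems u in auto)
    also have "C * (u - s) powr \<theta> * (\<Sum>k<n. q ^ k) + e * (u - s)
        + (C * (t - u) powr \<theta> * (\<Sum>k<n. q ^ k) + e * (t - u)) + C * (t - s) powr \<theta>
        = C * (2 * ((t - s) / 2) powr \<theta>) * (\<Sum>k<n. q ^ k) + C * (t - s) powr \<theta> + e * (t - s)"
      unfolding u by (simp add: algebra_simps)
    also have "\<dots> = C * (t - s) powr \<theta> * (1 + q * (\<Sum>k<n. q ^ k)) + e * (t - s)"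
      using Suc.prems by (subst half) (auto simp: algebra_simps)
    also have "1 + q * (\<Sum>k<n. q ^ k) = (\<Sum>k<Suc n. q ^ k)"
      by (subst sum.lessThan_Suc_shift) (simp add: sum_distrib_left)
    finally show ?case by simp
  qed
  have geo: "(\<Sum>k<n. q ^ k) \<le> 1 / (1 - q)" for n
    using q by (simp add: sum_gp_strict divide_right_mono)
  have main: "\<bar>R s t\<bar> \<le> C / (1 - q) * (t - s) powr \<theta> + e * (t - s)" if e: "0 < e" for e
  proof -
    obtain d where d: "0 < d"
      "\<And>u v. 0 \<le> u \<Longrightarrow> u \<le> v \<Longrightarrow> v \<le> T \<Longrightarrow> v - u < d \<Longrightarrow> \<bar>R u v\<bar> \<le> e * (v - u)"
      using o[unfolded small_o_incr_def, rule_format, OF e] by auto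
    obtain n where "(t - s) / d < 2 ^ n" using real_arch_pow[of 2] by auto
    then have "t - s < d * 2 ^ n" using d by (simp add: field_simps)
    from step[OF st this d(2)] have
      "\<bar>R s t\<bar> \<le> C * (t - s) powr \<theta> * (\<Sum>k<n. q ^ k) + e * (t - s)" .
    also have "C * (t - s) powr \<theta> * (\<Sum>k<n. q ^ k) \<le> C * (t - s) powr \<theta> * (1 / (1 - q))"
      using C geo by (intro mult_left_mono) auto
    finally show ?thesis by simp
  qed
  have "\<bar>R s t\<bar> \<le> C / (1 - q) * (t - s) powr \<theta>"
  proof (rule field_le_epsilon)
    fix e :: real assume "0 < e"
    then have e': "0 < e / (t - s + 1)" using st by simp
    have "e / (t - s + 1) * (t - s) \<le> e"
      using st \<open>0 < e\<close> by (simp add: field_simps)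
    with main[OF e'] show "\<bar>R s t\<bar> \<le> C / (1 - q) * (t - s) powr \<theta> + e" by linarith
  qed
  then show ?thesis by (simp add: q_def)
qed

lemma card_nats_in_open_interval:
  fixes x y :: real
  assumes "x \<le> y"
  shows "finite {k::nat. x < k \<and> k < y}" "real (card {k::nat. x < k \<and> k < y}) \<le> y - x + 1"
proof -
  have sub: "int ` {k::nat. x < k \<and> k < y} \<subseteq> {\<lfloor>x\<rfloor> + 1 .. \<lceil>y\<rceil> - 1}"
  proof safe
    fix k :: nat assume "x < k" "k < y"
    then show "int k \<in> {\<lfloor>x\<rfloor> + 1..\<lceil>y\<rceil> - 1}"
      by (simp; linarith)
  qed
  then have "finite (int ` {k::nat. x < k \<and> k < y})" by (rule finite_subset) simp
  then show "finite {k::nat. x < k \<and> k < y}" by (rule finite_imageD) simp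
  have "card {k::nat. x < k \<and> k < y} = card (int ` {k::nat. x < k \<and> k < y})"
    by (simp add: card_image)
  also have "\<dots> \<le> card {\<lfloor>x\<rfloor> + 1 .. \<lceil>y\<rceil> - 1}" by (rule card_mono[OF _ sub]) simp
  finally have "card {k::nat. x < k \<and> k < y} \<le> nat (\<lceil>y\<rceil> - 1 - \<lfloor>x\<rfloor>)" by simp
  moreover have "real (nat (\<lceil>y\<rceil> - 1 - \<lfloor>x\<rfloor>)) \<le> y - x + 1" using assms by linarith
  ultimately show "real (card {k::nat. x < k \<and> k < y}) \<le> y - x + 1" by linarith
qed

lemma sum_lessThan_double:
  fixes g :: "nat \<Rightarrow> real"
  shows "(\<Sum>k<2*m. g k) = (\<Sum>k<m. g (2*k) + g (2*k+1))"
  by (induction m) (auto simp: algebra_simps)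

text \<open>
  Sums of the germ \<open>\<Xi>\<close> over the dyadic grid of level \<open>n\<close>, truncated at \<open>t\<close>, define \<open>J n t\<close>. Refining the grid changes
  \<open>J n t - J n s\<close> only through the cells that meet \<open>[s, t]\<close>; there are at most \<open>(t - s) / h n + 2\<close> of them, and each
  contributes \<open>O((h n)\<^sup>\<theta>)\<close>. The series of these changes converges because \<open>\<theta> > 1\<close>. To compare \<open>I t - I s\<close>
  with \<open>\<Xi> s t\<close>, start the series at the level with \<open>h n\<close> comparable to \<open>t - s\<close>, where \<open>s\<close> and \<open>t\<close> lie in the same cell or
  in adjacent cells.
\<close>

lemma sewing:
  fixes \<Xi> :: "real \<Rightarrow> real \<Rightarrow> real"
  assumes T: "0 < T" and C: "0 \<le> C" and \<theta>: "1 < \<theta>"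
    and defect: "\<And>s u t. 0 \<le> s \<Longrightarrow> s \<le> u \<Longrightarrow> u \<le> t \<Longrightarrow> t \<le> T \<Longrightarrow>
      \<bar>\<Xi> s t - \<Xi> s u - \<Xi> u t\<bar> \<le> C * (t - s) powr \<theta>"
  shows "\<exists>I K. 0 \<le> K \<and> I 0 = 0 \<and>
    (\<forall>s t. 0 \<le> s \<longrightarrow> s \<le> t \<longrightarrow> t \<le> T \<longrightarrow> \<bar>I t - I s - \<Xi> s t\<bar> \<le> K * (t - s) powr \<theta>)"
proof -
  have diag: "\<Xi> t t = 0" if "0 \<le> t" "t \<le> T" for t
    using defect[of t t t] that by simp
  define h where "h n = T / 2 ^ n" for n :: nat
  have h: "0 < h n" "h n = 2 * h (Suc n)" for n using T by (auto simp: h_def)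
  \<comment> \<open>\<open>2\<^sup>n\<close> cells cover \<open>[0, T]\<close>. Beyond \<open>t\<close> the truncated terms vanish, and the surplus ensures that
    the cell after the one that contains \<open>s\<close> is always in the range, even for \<open>n = 0\<close> and \<open>s = T\<close>.\<close>
  define J where "J n t = (\<Sum>k<3*2^n. \<Xi> (min (k * h n) t) (min (Suc k * h n) t))" for n :: nat and t
  define m where "m n k = real (2*k+1) * h (Suc n)" for n k
  \<comment> \<open>the change caused by halving the \<open>k\<close>-th cell\<close>
  define e where "e n k t = \<Xi> (min (k * h n) t) (min (Suc k * h n) t)
      - \<Xi> (min (k * h n) t) (min (m n k) t) - \<Xi> (min (m n k) t) (min (Suc k * h n) t)"
    for n k t
  have m: "real k * h n \<le> m n k" "m n k \<le> Suc k * h n" for n k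
    using h(1)[of "Suc n"] by (auto simp: m_def h(2)[of n] algebra_simps)
  define D where "D n t = (\<Sum>k<3*2^n. e n k t)" for n t
  have J_Suc: "J (Suc n) t = J n t - D n t" for n t
  proof -
    have pw: "3 * 2 ^ Suc n = 2 * (3 * 2 ^ n :: nat)" by simp
    have "J (Suc n) t = (\<Sum>k<3*2^n. \<Xi> (min (real (2*k) * h (Suc n)) t) (min (Suc (2*k) * h (Suc n)) t)
        + \<Xi> (min (real (2*k+1) * h (Suc n)) t) (min (Suc (2*k+1) * h (Suc n)) t))"
      unfolding J_def pw by (rule sum_lessThan_double)
    also have "\<dots> = (\<Sum>k<3*2^n. \<Xi> (min (k * h n) t) (min (Suc k * h n) t) - e n k t)"
      by (intro sum.cong) (simp_all add: e_def m_def h(2)[of n] algebra_simps)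
    finally show ?thesis by (simp add: J_def D_def sum_subtractf)
  qed
  have e_bound: "\<bar>e n k t\<bar> \<le> C * h n powr \<theta>" if "0 \<le> t" "t \<le> T" for n k t
  proof -
    have kh: "0 \<le> k * h n" using h(1)[of n] by simp
    have "\<bar>e n k t\<bar> \<le> C * (min (Suc k * h n) t - min (k * h n) t) powr \<theta>"
      unfolding e_def
      by (rule defect) (use that m[where n=n and k=k] kh in \<open>auto simp: min_def simp del: of_nat_Suc\<close>)
    also have "\<dots> \<le> C * h n powr \<theta>"
      using C \<theta> h(1)[of n] by (intro mult_left_mono powr_mono2) (auto simp: algebra_simps min_def)
    finally show ?thesis .
  qed
  have e0: "e n k t = 0" if "0 \<le> t" "t \<le> T" "t \<le> k * h n" for n k t
  proof -
    have "t \<le> m n k" "t \<le> Suc k * h n" using that m[where n=n and k=k] by linarith+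
    with that show ?thesis by (simp add: e_def diag min_absorb2 del: of_nat_Suc)
  qed
  have D_incr: "\<bar>D n t - D n s\<bar> \<le> 2 * C * h n powr \<theta> * ((t - s) / h n + 2)"
    if st: "0 \<le> s" "s \<le> t" "t \<le> T" for n s t
  proof -
    define A where "A = {k::nat. s / h n - 1 < k \<and> k < t / h n}"
    have le: "s / h n - 1 \<le> t / h n" using st h(1)[of n] divide_right_mono[of s t "h n"] by simp
    note A = card_nats_in_open_interval[OF le, folded A_def]
    have eq: "e n k t = e n k s" if k: "k \<notin> A" for k
    proof -
      consider "real k \<le> s / h n - 1" | "t / h n \<le> k" using k unfolding A_def by force
      then show ?thesis
      proof cases
        case 1
        then have 2: "Suc k * h n \<le> s" using h(1)[of n] by (simp add: field_simps)
        have 3: "m n k \<le> s" "k * h n \<le> s" using 2 m[where n=n and k=k] by linarith+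
        then show ?thesis using 2 st
          by (simp add: e_def min_absorb1 del: of_nat_Suc)
      next
        case 2
        then have "t \<le> k * h n" using h(1)[of n] by (simp add: field_simps)
        then show ?thesis using st e0[of t k n] e0[of s k n] by simp
      qed
    qed
    have "\<bar>D n t - D n s\<bar> = \<bar>\<Sum>k<3*2^n. e n k t - e n k s\<bar>" by (simp add: D_def sum_subtractf)
    also have "(\<Sum>k<3*2^n. e n k t - e n k s) = (\<Sum>k\<in>{..<3*2^n} \<inter> A. e n k t - e n k s)"
      by (rule sum.mono_neutral_right) (auto simp: eq)
    also have "\<bar>\<dots>\<bar> \<le> (\<Sum>k\<in>{..<3*2^n} \<inter> A. \<bar>e n k t - e n k s\<bar>)" by (rule sum_abs)
    also have "\<dots> \<le> of_nat (card ({..<3*2^n} \<inter> A)) * (2 * C * h n powr \<theta>)"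
    proof (rule sum_bounded_above)
      fix k show "\<bar>e n k t - e n k s\<bar> \<le> 2 * C * h n powr \<theta>"
        using e_bound[of t n k] e_bound[of s n k] st by linarith
    qed
    also have "\<dots> \<le> ((t - s) / h n + 2) * (2 * C * h n powr \<theta>)"
    proof (rule mult_right_mono)
      have "card ({..<3*2^n} \<inter> A) \<le> card A" by (rule card_mono[OF A(1)]) auto
      then show "real (card ({..<3*2^n} \<inter> A)) \<le> (t - s) / h n + 2"
        using A(2) by (simp add: diff_divide_distrib)
    qed (use C in auto)
    finally show ?thesis by (simp add: mult_ac)
  qed
  define r where "r = (2::real) powr (1 - \<theta>)"
  have r: "0 < r" "r < 1" using \<theta> by (auto simp: r_def powr_less_one)
  have h_powr: "h n powr \<theta> / h n = T powr (\<theta> - 1) * r ^ n" for n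
  proof -
    have "h n powr \<theta> / h n = h n powr (\<theta> - 1)" using h(1)[of n] by (simp add: powr_diff)
    also have "\<dots> = T powr (\<theta> - 1) / (2 ^ n) powr (\<theta> - 1)"
      using T by (simp add: h_def powr_divide)
    also have "(2 ^ n :: real) powr (\<theta> - 1) = (2 powr (\<theta> - 1)) ^ n"
      by (simp add: powr_power flip: powr_realpow) (simp add: powr_powr mult.commute)
    also have "T powr (\<theta> - 1) / (2 powr (\<theta> - 1)) ^ n = T powr (\<theta> - 1) * r ^ n"
      unfolding r_def by (simp add: field_simps powr_minus flip: power_mult_distrib powr_add)
    finally show ?thesis .
  qed
  have D_incr': "\<bar>D n t - D n s\<bar> \<le> 10 * C * T powr (\<theta> - 1) * (t - s) * r ^ n"
    if st: "0 \<le> s" "s \<le> t" "t \<le> T" "h n \<le> 2 * (t - s)" for n s t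
  proof -
    have "2 \<le> 4 * ((t - s) / h n)" using st h(1)[of n] by (simp add: field_simps)
    then have "(t - s) / h n + 2 \<le> 5 * ((t - s) / h n)" by linarith
    then have "2 * C * h n powr \<theta> * ((t - s) / h n + 2) \<le> 2 * C * h n powr \<theta> * (5 * ((t - s) / h n))"
      using C by (intro mult_left_mono) auto
    also have "\<dots> = 10 * C * (t - s) * (h n powr \<theta> / h n)" by simp
    also have "\<dots> = 10 * C * T powr (\<theta> - 1) * (t - s) * r ^ n" by (simp add: h_powr)
    finally show ?thesis using D_incr[OF st(1-3), of n] by linarith
  qed
  have D0: "D n 0 = 0" for n
    unfolding D_def using T h(1)[of n] by (intro sum.neutral) (auto intro!: e0)
  have sumD: "summable (\<lambda>n. D n t)" if t: "0 \<le> t" "t \<le> T" for t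
  proof (rule summable_comparison_test')
    show "summable (\<lambda>n. 10 * C * T powr (\<theta> - 1) * T * r ^ n)"
      using r by (intro summable_mult summable_geometric) auto
    fix n :: nat
    have "\<bar>D n t\<bar> \<le> 2 * C * h n powr \<theta> * (t / h n + 2)" using D_incr[of 0 t n] t D0 by simp
    also have "t / h n + 2 \<le> 5 * (T / h n)"
    proof -
      have "t / h n \<le> T / h n" using t h(1)[of n] by (intro divide_right_mono) auto
      moreover have "1 \<le> T / h n" using T by (simp add: h_def)
      ultimately show ?thesis by simp
    qed
    also have "2 * C * h n powr \<theta> * (5 * (T / h n)) = 10 * C * T * (h n powr \<theta> / h n)" by simp
    also have "\<dots> = 10 * C * T powr (\<theta> - 1) * T * r ^ n" by (simp add: h_powr)
    finally show "norm (D n t) \<le> 10 * C * T powr (\<theta> - 1) * T * r ^ n"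
      using C by (simp add: mult_left_mono)
  qed
  define I where "I t = J 0 t - (\<Sum>n. D n t)" for t
  have J_eq: "J n t = J 0 t - (\<Sum>i<n. D i t)" for n t
    by (induction n) (auto simp: J_Suc)
  have I_J: "I t = J n t - (\<Sum>i. D (i + n) t)" if "0 \<le> t" "t \<le> T" for n t
    using suminf_split_initial_segment[OF sumD[OF that], of n] J_eq[of n t] by (simp add: I_def)
  define K where "K = 10 * C * 2 powr (\<theta> - 1) / (1 - r) + 2 * C * 2 powr \<theta>"
  have "\<bar>I t - I s - \<Xi> s t\<bar> \<le> K * (t - s) powr \<theta>" if st: "0 \<le> s" "s \<le> t" "t \<le> T" for s t
  proof (cases "s = t")
    case True
    then show ?thesis using st diag by simp
  next
    case False
    then have lt: "s < t" using st by simp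
    \<comment> \<open>the dyadic scale that is comparable to \<open>t - s\<close>\<close>
    obtain n where n: "t - s \<le> h n" "h n \<le> 2 * (t - s)"
    proof -
      have "\<exists>n. h n < t - s"
      proof -
        obtain n where "T / (t - s) < 2 ^ n" using real_arch_pow[of 2] by auto
        then have "h n < t - s" using lt by (simp add: h_def field_simps)
        then show ?thesis by blast
      qed
      define N where "N = (LEAST n. h n < t - s)"
      have N: "h N < t - s" unfolding N_def using \<open>\<exists>n. h n < t - s\<close> by (rule LeastI_ex)
      have "\<not> h 0 < t - s" using st by (simp add: h_def)
      with N obtain n where n: "N = Suc n" by (cases N) auto
      have "\<not> h n < t - s" by (rule not_less_Least) (use n N_def in auto)
      then show ?thesis using that[of n] N n h(2)[of n] by simp
    qed
    have hm: "h k \<le> 2 * (t - s)" if "n \<le> k" for k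
    proof -
      have "h k \<le> h n" using T that by (auto simp: h_def intro!: divide_left_mono power_increasing)
      then show ?thesis using n by simp
    qed
    have s1: "summable (\<lambda>i. D (i + n) t)" "summable (\<lambda>i. D (i + n) s)"
      using sumD[of t] sumD[of s] st summable_iff_shift[of "\<lambda>n. D n t" n]
        summable_iff_shift[of "\<lambda>n. D n s" n] by auto
    have sg: "summable (\<lambda>i. 10 * C * T powr (\<theta> - 1) * (t - s) * r ^ (i + n))"
      using r by (intro summable_mult) (simp add: power_add summable_mult2 summable_geometric)
    have "\<bar>(\<Sum>i. D (i + n) t) - (\<Sum>i. D (i + n) s)\<bar> = norm (\<Sum>i. D (i + n) t - D (i + n) s)"
      using s1 by (simp add: suminf_diff)
    also have "\<dots> \<le> (\<Sum>i. 10 * C * T powr (\<theta> - 1) * (t - s) * r ^ (i + n))"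
    proof (rule order_trans[OF summable_norm suminf_le])
      show le: "norm (D (i + n) t - D (i + n) s) \<le> 10 * C * T powr (\<theta> - 1) * (t - s) * r ^ (i + n)" for i
        using D_incr' st hm by simp
      show sn: "summable (\<lambda>i. norm (D (i + n) t - D (i + n) s))"
        by (rule summable_comparison_test'[OF sg]) (use le in simp)
      show "summable (\<lambda>i. norm (D (i + n) t - D (i + n) s))" by (rule sn)
    qed (rule sg)
    also have "\<dots> = 10 * C * T powr (\<theta> - 1) * (t - s) * r ^ n * (\<Sum>i. r ^ i)"
      using r by (subst suminf_mult[symmetric]) (auto simp: power_add mult_ac intro: summable_geometric)
    also have "\<dots> = 10 * C * (t - s) / (1 - r) * (T powr (\<theta> - 1) * r ^ n)"
      using r by (simp add: suminf_geometric)
    also have "\<dots> = 10 * C * (t - s) / (1 - r) * h n powr (\<theta> - 1)"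
      unfolding h_powr[symmetric] using h(1)[of n] by (simp add: powr_diff)
    also have "\<dots> \<le> 10 * C * (t - s) / (1 - r) * (2 * (t - s)) powr (\<theta> - 1)"
      using C lt r n h(1)[of n] \<theta> by (intro mult_left_mono powr_mono2) auto
    also have "\<dots> = 10 * C * 2 powr (\<theta> - 1) / (1 - r) * (t - s) powr \<theta>"
    proof -
      have "(t - s) powr \<theta> = (t - s) * (t - s) powr (\<theta> - 1)" using lt by (simp add: powr_diff)
      moreover have "(2 * (t - s)) powr (\<theta> - 1) = 2 powr (\<theta> - 1) * (t - s) powr (\<theta> - 1)"
        using lt by (intro powr_mult)
      ultimately show ?thesis by (simp only: times_divide_eq_left times_divide_eq_right mult_ac)
    qed
    finally have tail: "\<bar>(\<Sum>i. D (i + n) t) - (\<Sum>i. D (i + n) s)\<bar> 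
        \<le> 10 * C * 2 powr (\<theta> - 1) / (1 - r) * (t - s) powr \<theta>" .
    define j where "j = nat \<lfloor>s / h n\<rfloor>"
    have j: "j * h n \<le> s" "s < Suc j * h n"
    proof -
      have "0 \<le> s / h n" using st h(1)[of n] by simp
      then have "real j \<le> s / h n" "s / h n < real j + 1" unfolding j_def by linarith+
      then show "j * h n \<le> s" "s < Suc j * h n" using h(1)[of n] by (auto simp: field_simps)
    qed
    have t2: "t \<le> Suc (Suc j) * h n" using j(2) n(1) by (simp add: algebra_simps)
    have jn: "Suc j < 3 * 2 ^ n"
    proof -
      have "real j * h n \<le> 2 ^ n * h n" using j st by (simp add: h_def)
      then have "real j \<le> 2 ^ n" using h(1)[of n] by simp
      then have "j \<le> 2 ^ n" by (simp flip: of_nat_le_iff)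
      moreover have "(1::nat) \<le> 2 ^ n" by simp
      ultimately show ?thesis by linarith
    qed
    define u where "u = min (Suc j * h n) t"
    have u: "s \<le> u" "u \<le> t" using j lt by (auto simp: u_def)
    define d where "d k = \<Xi> (min (real k * h n) t) (min (Suc k * h n) t) - \<Xi> (min (real k * h n) s) (min (Suc k * h n) s)" for k
    have d0: "d k = 0" if k: "k \<noteq> j" "k \<noteq> Suc j" for k
    proof -
      consider "Suc k \<le> j" | "Suc (Suc j) \<le> k" using k by linarith
      then show ?thesis
      proof cases
        case 1
        then have "real (Suc k) * h n \<le> j * h n" using h(1)[of n] by (intro mult_right_mono) auto
        then have a1: "real (Suc k) * h n \<le> s" using j by linarith
        moreover have a2: "real k * h n \<le> s" using a1 h(1)[of n] by (simp add: algebra_simps)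
        ultimately show ?thesis using st by (simp add: d_def min_absorb1 del: of_nat_Suc)
      next
        case 2
        then have "real (Suc (Suc j)) * h n \<le> k * h n" using h(1)[of n] by (intro mult_right_mono) linarith+
        then have a1: "t \<le> k * h n" using t2 by linarith
        moreover have a2: "t \<le> Suc k * h n" using a1 h(1)[of n] by (simp add: algebra_simps)
        ultimately show ?thesis using st diag by (simp add: d_def min_absorb2 del: of_nat_Suc)
      qed
    qed
    have "J n t - J n s = (\<Sum>k<3*2^n. d k)" by (simp add: J_def d_def sum_subtractf)
    also have "\<dots> = (\<Sum>k\<in>{j, Suc j}. d k)"
      by (rule sum.mono_neutral_right) (use d0 jn in auto)
    also have "\<dots> = d j + d (Suc j)" by simp
    also have "d j = \<Xi> (j * h n) u - \<Xi> (j * h n) s"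
      using j st by (simp add: d_def u_def min_absorb1 min_absorb2 del: of_nat_Suc)
    also have "d (Suc j) = \<Xi> u t"
      using j st t2 diag[of s] by (simp add: d_def u_def min_absorb1 min_absorb2 del: of_nat_Suc)
    finally have "J n t - J n s - \<Xi> s t = (\<Xi> (j * h n) u - \<Xi> (j * h n) s - \<Xi> s u) - (\<Xi> s t - \<Xi> s u - \<Xi> u t)"
      by simp
    moreover have "\<bar>\<Xi> (j * h n) u - \<Xi> (j * h n) s - \<Xi> s u\<bar> \<le> C * h n powr \<theta>"
    proof -
      have "\<bar>\<Xi> (j * h n) u - \<Xi> (j * h n) s - \<Xi> s u\<bar> \<le> C * (u - j * h n) powr \<theta>"
        by (rule defect) (use u j st h(1)[of n] in auto)
      also have "\<dots> \<le> C * h n powr \<theta>"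
      proof (intro mult_left_mono powr_mono2)
        show "u - j * h n \<le> h n" by (simp add: u_def algebra_simps min_def)
      qed (use C \<theta> u j in auto)
      finally show ?thesis .
    qed
    moreover have "\<bar>\<Xi> s t - \<Xi> s u - \<Xi> u t\<bar> \<le> C * h n powr \<theta>"
    proof -
      have "\<bar>\<Xi> s t - \<Xi> s u - \<Xi> u t\<bar> \<le> C * (t - s) powr \<theta>"
        by (rule defect) (use u st in auto)
      also have "\<dots> \<le> C * h n powr \<theta>" using C \<theta> lt n by (intro mult_left_mono powr_mono2) auto
      finally show ?thesis .
    qed
    moreover have "C * h n powr \<theta> \<le> C * 2 powr \<theta> * (t - s) powr \<theta>"
    proof -
      have "h n powr \<theta> \<le> (2 * (t - s)) powr \<theta>" using \<theta> h(1)[of n] n by (intro powr_mono2) auto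
      also have "(2 * (t - s)) powr \<theta> = 2 powr \<theta> * (t - s) powr \<theta>" using lt by (intro powr_mult)
      finally show ?thesis using C mult_left_mono[of _ _ C] by (simp add: mult.assoc)
    qed
    ultimately have "\<bar>J n t - J n s - \<Xi> s t\<bar> \<le> 2 * C * 2 powr \<theta> * (t - s) powr \<theta>" by linarith
    moreover have "I t - I s - \<Xi> s t = (J n t - J n s - \<Xi> s t) - ((\<Sum>i. D (i + n) t) - (\<Sum>i. D (i + n) s))"
      using I_J[of t n] I_J[of s n] st by simp
    moreover have "K * (t - s) powr \<theta> = 10 * C * 2 powr (\<theta> - 1) / (1 - r) * (t - s) powr \<theta>
        + 2 * C * 2 powr \<theta> * (t - s) powr \<theta>"
      by (simp add: K_def distrib_right)
    ultimately show ?thesis using tail by linarith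
  qed
  note bound = this
  have "0 \<le> K" using C r by (simp add: K_def)
  have "I 0 = 0"
    using D0 T h(1)[of 0] diag[of 0] by (simp add: I_def J_def min_absorb2)
  with \<open>0 \<le> K\<close> bound show ?thesis by (intro exI[of _ I] exI[of _ K]) simp
qed

section \<open>Uniform bounds for families of two-parameter functions\<close>


text \<open>
  The parameter \<open>p\<close> will be a test function and \<open>P\<close> a bounded set of test functions.
\<close>

definition unif_bdd :: "real \<Rightarrow> 'p set \<Rightarrow> ('p \<Rightarrow> real \<Rightarrow> 'v::real_normed_vector) \<Rightarrow> bool" where
  "unif_bdd T P X \<longleftrightarrow> (\<exists>C\<ge>0. \<forall>p\<in>P. \<forall>t\<in>{0..T}. norm (X p t) \<le> C)"

text \<open>
  At \<open>s = t\<close> the bound is \<open>0\<close>, also for \<open>\<gamma> = 0\<close>, since \<open>0 powr \<gamma> = 0\<close>; this is the reason for a separate notion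
  of boundedness.
\<close>

definition unif_bigo ::
  "real \<Rightarrow> 'p set \<Rightarrow> real \<Rightarrow> ('p \<Rightarrow> real \<Rightarrow> real \<Rightarrow> 'v::real_normed_vector) \<Rightarrow> bool" where
  "unif_bigo T P \<gamma> R \<longleftrightarrow> (\<exists>C\<ge>0. \<forall>p\<in>P. \<forall>s t. 0 \<le> s \<longrightarrow> s \<le> t \<longrightarrow> t \<le> T \<longrightarrow>
     norm (R p s t) \<le> C * (t - s) powr \<gamma>)"

lemma unif_bddI:
  "(\<And>p t. p \<in> P \<Longrightarrow> 0 \<le> t \<Longrightarrow> t \<le> T \<Longrightarrow> norm (X p t) \<le> C) \<Longrightarrow> unif_bdd T P X"
  unfolding unif_bdd_def by (rule exI[of _ "max 0 C"]) (auto intro: le_max_iff_disj[THEN iffD2])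

lemma unif_bddE:
  assumes "unif_bdd T P X"
  obtains C where "0 \<le> C" "\<And>p t. p \<in> P \<Longrightarrow> 0 \<le> t \<Longrightarrow> t \<le> T \<Longrightarrow> norm (X p t) \<le> C"
  using assms unfolding unif_bdd_def by auto

lemma unif_bigoI:
  assumes "\<And>p s t. p \<in> P \<Longrightarrow> 0 \<le> s \<Longrightarrow> s \<le> t \<Longrightarrow> t \<le> T \<Longrightarrow> norm (R p s t) \<le> C * (t - s) powr \<gamma>"
  shows "unif_bigo T P \<gamma> R"
  unfolding unif_bigo_def
proof (intro exI[of _ "max 0 C"] conjI ballI allI impI)
  fix p s t assume "p \<in> P" "0 \<le> s" "s \<le> t" "t \<le> T"
  then have "norm (R p s t) \<le> C * (t - s) powr \<gamma>" by (rule assms)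
  also have "\<dots> \<le> max 0 C * (t - s) powr \<gamma>" by (intro mult_right_mono) auto
  finally show "norm (R p s t) \<le> max 0 C * (t - s) powr \<gamma>" .
qed simp

lemma unif_bigoE:
  assumes "unif_bigo T P \<gamma> R"
  obtains C where "0 \<le> C"
    "\<And>p s t. p \<in> P \<Longrightarrow> 0 \<le> s \<Longrightarrow> s \<le> t \<Longrightarrow> t \<le> T \<Longrightarrow> norm (R p s t) \<le> C * (t - s) powr \<gamma>"
  using assms unfolding unif_bigo_def by auto

lemma unif_bdd_cong:
  assumes "unif_bdd T P A" "\<And>p t. p \<in> P \<Longrightarrow> 0 \<le> t \<Longrightarrow> t \<le> T \<Longrightarrow> A' p t = A p t"
  shows "unif_bdd T P A'"
  using assms unfolding unif_bdd_def by (metis atLeastAtMost_iff)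

lemma unif_bigo_cong:
  assumes "unif_bigo T P \<gamma> R"
    and "\<And>p s t. p \<in> P \<Longrightarrow> 0 \<le> s \<Longrightarrow> s \<le> t \<Longrightarrow> t \<le> T \<Longrightarrow> R' p s t = R p s t"
  shows "unif_bigo T P \<gamma> R'"
  using assms unfolding unif_bigo_def by metis

lemma unif_bdd_reindex: "unif_bdd T Q X \<Longrightarrow> (\<And>p. p \<in> P \<Longrightarrow> g p \<in> Q) \<Longrightarrow> unif_bdd T P (\<lambda>p. X (g p))"
  unfolding unif_bdd_def by fast

lemma unif_bigo_reindex: "unif_bigo T Q \<gamma> R \<Longrightarrow> (\<And>p. p \<in> P \<Longrightarrow> g p \<in> Q) \<Longrightarrow> unif_bigo T P \<gamma> (\<lambda>p. R (g p))"
  unfolding unif_bigo_def by fast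

lemma unif_bdd_const: "unif_bdd T P (\<lambda>p t. c)"
  by (rule unif_bddI[of _ _ _ "norm c"]) simp

lemma unif_bdd_add:
  assumes "unif_bdd T P A" "unif_bdd T P B"
  shows "unif_bdd T P (\<lambda>p t. A p t + B p t)"
proof -
  obtain C where C: "\<And>p t. p \<in> P \<Longrightarrow> 0 \<le> t \<Longrightarrow> t \<le> T \<Longrightarrow> norm (A p t) \<le> C"
    by (rule unif_bddE[OF assms(1)]) blast
  obtain D where D: "\<And>p t. p \<in> P \<Longrightarrow> 0 \<le> t \<Longrightarrow> t \<le> T \<Longrightarrow> norm (B p t) \<le> D"
    by (rule unif_bddE[OF assms(2)]) blast
  show ?thesis
    by (rule unif_bddI[of _ _ _ "C + D"]) (use C D norm_triangle_mono in blast)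
qed

lemma unif_bdd_minus: "unif_bdd T P X \<Longrightarrow> unif_bdd T P (\<lambda>p t. - X p t)"
  by (simp add: unif_bdd_def)

lemma unif_bdd_diff: "unif_bdd T P A \<Longrightarrow> unif_bdd T P B \<Longrightarrow> unif_bdd T P (\<lambda>p t. A p t - B p t)"
  using unif_bdd_add[OF _ unif_bdd_minus, of T P A B] by simp

lemma unif_bdd_bilinear:
  assumes f: "bounded_bilinear f" and "unif_bdd T P A" "unif_bdd T P B"
  shows "unif_bdd T P (\<lambda>p t. f (A p t) (B p t))"
proof -
  obtain C where C: "0 \<le> C" "\<And>p t. p \<in> P \<Longrightarrow> 0 \<le> t \<Longrightarrow> t \<le> T \<Longrightarrow> norm (A p t) \<le> C"
    by (rule unif_bddE[OF assms(2)]) blast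
  obtain D where D: "0 \<le> D" "\<And>p t. p \<in> P \<Longrightarrow> 0 \<le> t \<Longrightarrow> t \<le> T \<Longrightarrow> norm (B p t) \<le> D"
    by (rule unif_bddE[OF assms(3)]) blast
  obtain K where K: "0 < K" "\<And>a b. norm (f a b) \<le> norm a * norm b * K"
    using bounded_bilinear.pos_bounded[OF f] by blast
  show ?thesis
  proof (rule unif_bddI)
    fix p t assume st: "p \<in> P" "0 \<le> t" "t \<le> T"
    have "norm (f (A p t) (B p t)) \<le> norm (A p t) * norm (B p t) * K" by (rule K)
    also have "\<dots> \<le> C * D * K"
      using C(1) D(1) K(1) C(2)[OF st] D(2)[OF st] by (intro mult_mono mult_right_mono) auto
    finally show "norm (f (A p t) (B p t)) \<le> C * D * K" .
  qed
qed

lemma unif_bigo_add: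
  assumes "unif_bigo T P \<gamma> R" "unif_bigo T P \<gamma> S"
  shows "unif_bigo T P \<gamma> (\<lambda>p s t. R p s t + S p s t)"
proof -
  from assms obtain C D where
    C: "\<And>p s t. p \<in> P \<Longrightarrow> 0 \<le> s \<Longrightarrow> s \<le> t \<Longrightarrow> t \<le> T \<Longrightarrow> norm (R p s t) \<le> C * (t - s) powr \<gamma>"
    and D: "\<And>p s t. p \<in> P \<Longrightarrow> 0 \<le> s \<Longrightarrow> s \<le> t \<Longrightarrow> t \<le> T \<Longrightarrow> norm (S p s t) \<le> D * (t - s) powr \<gamma>"
    by (elim unif_bigoE) blast
  show ?thesis
  proof (rule unif_bigoI)
    fix p s t assume "p \<in> P" "0 \<le> s" "s \<le> t" "t \<le> T"
    note C[OF this] D[OF this]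
    with norm_triangle_ineq[of "R p s t" "S p s t"]
    show "norm (R p s t + S p s t) \<le> (C + D) * (t - s) powr \<gamma>"
      unfolding distrib_right by linarith
  qed
qed

lemma unif_bigo_minus:
  "unif_bigo T P \<gamma> R \<Longrightarrow> unif_bigo T P \<gamma> (\<lambda>p s t. - R p s t)"
  by (simp add: unif_bigo_def)

lemma unif_bigo_diff:
  assumes "unif_bigo T P \<gamma> R" "unif_bigo T P \<gamma> S"
  shows "unif_bigo T P \<gamma> (\<lambda>p s t. R p s t - S p s t)"
  using unif_bigo_add[OF assms(1) unif_bigo_minus[OF assms(2)]] by simp

text \<open>
  On the bounded interval \<open>[0, T]\<close>, a larger exponent is a stronger statement; the constant picks up a power of \<open>T\<close>.
\<close>

lemma unif_bigo_mono:
  assumes "unif_bigo T P \<gamma> R" "\<gamma>' \<le> \<gamma>"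
  shows "unif_bigo T P \<gamma>' R"
proof -
  obtain C where C: "0 \<le> C"
    "\<And>p s t. p \<in> P \<Longrightarrow> 0 \<le> s \<Longrightarrow> s \<le> t \<Longrightarrow> t \<le> T \<Longrightarrow> norm (R p s t) \<le> C * (t - s) powr \<gamma>"
    by (rule unif_bigoE[OF assms(1)]) blast
  show ?thesis
  proof (rule unif_bigoI)
    fix p s t assume st: "p \<in> P" "0 \<le> s" "s \<le> t" "t \<le> T"
    have "(t - s) powr \<gamma> = (t - s) powr (\<gamma> - \<gamma>') * (t - s) powr \<gamma>'" by (simp flip: powr_add)
    also have "\<dots> \<le> T powr (\<gamma> - \<gamma>') * (t - s) powr \<gamma>'"
      using st assms(2) by (intro mult_right_mono powr_mono2) auto
    finally have "C * (t - s) powr \<gamma> \<le> C * (T powr (\<gamma> - \<gamma>') * (t - s) powr \<gamma>')"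
      using C(1) by (rule mult_left_mono)
    then show "norm (R p s t) \<le> (C * T powr (\<gamma> - \<gamma>')) * (t - s) powr \<gamma>'"
      using C(2)[OF st] by (simp add: mult.assoc)
  qed
qed

lemma unif_bigo_le:
  assumes "unif_bigo T P \<gamma> R" "0 \<le> K"
    and le: "\<And>p s t. p \<in> P \<Longrightarrow> 0 \<le> s \<Longrightarrow> s \<le> t \<Longrightarrow> t \<le> T \<Longrightarrow> norm (R' p s t) \<le> K * norm (R p s t)"
  shows "unif_bigo T P \<gamma> R'"
proof -
  obtain C where C: "0 \<le> C"
    "\<And>p s t. p \<in> P \<Longrightarrow> 0 \<le> s \<Longrightarrow> s \<le> t \<Longrightarrow> t \<le> T \<Longrightarrow> norm (R p s t) \<le> C * (t - s) powr \<gamma>"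
    by (rule unif_bigoE[OF assms(1)]) blast
  show ?thesis
  proof (rule unif_bigoI)
    fix p s t assume st: "p \<in> P" "0 \<le> s" "s \<le> t" "t \<le> T"
    show "norm (R' p s t) \<le> (K * C) * (t - s) powr \<gamma>"
      using order_trans[OF le[OF st] mult_left_mono[OF C(2)[OF st] assms(2)]] by (simp add: mult.assoc)
  qed
qed

lemma unif_bigo_bilinear:
  assumes f: "bounded_bilinear f" and "unif_bigo T P \<gamma> R" "unif_bigo T P \<delta> S"
  shows "unif_bigo T P (\<gamma> + \<delta>) (\<lambda>p s t. f (R p s t) (S p s t))"
proof -
  obtain C where C: "0 \<le> C"
    "\<And>p s t. p \<in> P \<Longrightarrow> 0 \<le> s \<Longrightarrow> s \<le> t \<Longrightarrow> t \<le> T \<Longrightarrow> norm (R p s t) \<le> C * (t - s) powr \<gamma>"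
    by (rule unif_bigoE[OF assms(2)]) blast
  obtain D where D: "0 \<le> D"
    "\<And>p s t. p \<in> P \<Longrightarrow> 0 \<le> s \<Longrightarrow> s \<le> t \<Longrightarrow> t \<le> T \<Longrightarrow> norm (S p s t) \<le> D * (t - s) powr \<delta>"
    by (rule unif_bigoE[OF assms(3)]) blast
  obtain K where K: "0 < K" "\<And>a b. norm (f a b) \<le> norm a * norm b * K"
    using bounded_bilinear.pos_bounded[OF f] by blast
  show ?thesis
  proof (rule unif_bigoI)
    fix p s t assume st: "p \<in> P" "0 \<le> s" "s \<le> t" "t \<le> T"
    have "norm (f (R p s t) (S p s t)) \<le> norm (R p s t) * norm (S p s t) * K" by (rule K)
    also have "\<dots> \<le> (C * (t - s) powr \<gamma>) * (D * (t - s) powr \<delta>) * K"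
      using C(1) D(1) K(1) C(2)[OF st] D(2)[OF st] by (intro mult_mono mult_right_mono) auto
    finally show "norm (f (R p s t) (S p s t)) \<le> (C * D * K) * (t - s) powr (\<gamma> + \<delta>)"
      by (simp add: powr_add mult_ac)
  qed
qed

lemma unif_bigo_bdd_bilinear:
  assumes f: "bounded_bilinear f" and "unif_bdd T P A" "unif_bigo T P \<delta> S"
  shows "unif_bigo T P \<delta> (\<lambda>p s t. f (A p s) (S p s t))"
proof -
  obtain C where C: "0 \<le> C" "\<And>p t. p \<in> P \<Longrightarrow> 0 \<le> t \<Longrightarrow> t \<le> T \<Longrightarrow> norm (A p t) \<le> C"
    by (rule unif_bddE[OF assms(2)]) blast
  obtain D where D: "0 \<le> D"
    "\<And>p s t. p \<in> P \<Longrightarrow> 0 \<le> s \<Longrightarrow> s \<le> t \<Longrightarrow> t \<le> T \<Longrightarrow> norm (S p s t) \<le> D * (t - s) powr \<delta>"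
    by (rule unif_bigoE[OF assms(3)]) blast
  obtain K where K: "0 < K" "\<And>a b. norm (f a b) \<le> norm a * norm b * K"
    using bounded_bilinear.pos_bounded[OF f] by blast
  show ?thesis
  proof (rule unif_bigoI)
    fix p s t assume st: "p \<in> P" "0 \<le> s" "s \<le> t" "t \<le> T"
    have "norm (f (A p s) (S p s t)) \<le> norm (A p s) * norm (S p s t) * K" by (rule K)
    also have "\<dots> \<le> C * (D * (t - s) powr \<delta>) * K"
      using C(1) D(1) K(1) C(2)[of p s] D(2)[OF st] st by (intro mult_mono mult_right_mono) auto
    finally show "norm (f (A p s) (S p s t)) \<le> (C * D * K) * (t - s) powr \<delta>"
      by (simp add: mult_ac)
  qed
qed

text \<open>
  Discrete Leibniz rule: the product of the two increments is of higher order.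
\<close>

lemma unif_bigo_incr_bilinear:
  assumes f: "bounded_bilinear f" and A: "unif_bdd T P A" "unif_bigo T P \<gamma> (\<lambda>p s t. A p t - A p s)"
    and B: "unif_bdd T P B" "unif_bigo T P \<gamma> (\<lambda>p s t. B p t - B p s)" and "0 \<le> \<gamma>"
  shows "unif_bigo T P \<gamma> (\<lambda>p s t. f (A p t) (B p t) - f (A p s) (B p s))"
proof -
  interpret bounded_bilinear f by (rule f)
  note 1 = unif_bigo_bdd_bilinear[OF f A(1) B(2)]
  note 2 = unif_bigo_bdd_bilinear[OF flip B(1) A(2)]
  have 3: "unif_bigo T P \<gamma> (\<lambda>p s t. f (A p t - A p s) (B p t - B p s))"
    by (rule unif_bigo_mono[OF unif_bigo_bilinear[OF f A(2) B(2)]]) (use assms in simp)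
  show ?thesis
    by (rule unif_bigo_cong[OF unif_bigo_add[OF unif_bigo_add[OF 1 2] 3]])
      (simp add: diff_left diff_right)
qed

lemma norm_vec_le_sum: "norm (v :: 'v::real_normed_vector^'i::finite) \<le> (\<Sum>i\<in>UNIV. norm (v $ i))"
  unfolding norm_vec_def by (rule L2_set_le_sum) simp

lemma unif_bdd_vecI:
  fixes X :: "'p \<Rightarrow> real \<Rightarrow> 'v::real_normed_vector^'i::finite"
  assumes "\<And>i. unif_bdd T P (\<lambda>p t. X p t $ i)"
  shows "unif_bdd T P X"
proof -
  have "\<forall>i. \<exists>C. \<forall>p\<in>P. \<forall>t\<in>{0..T}. norm (X p t $ i) \<le> C"
    using assms unfolding unif_bdd_def by fast
  then obtain C where C: "\<forall>i. \<forall>p\<in>P. \<forall>t\<in>{0..T}. norm (X p t $ i) \<le> C i" by (elim choice[THEN exE])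
  show ?thesis
  proof (rule unif_bddI)
    fix p t assume "p \<in> P" "0 \<le> t" "t \<le> T"
    then have "norm (X p t $ i) \<le> C i" for i using C by simp
    then have "(\<Sum>i\<in>UNIV. norm (X p t $ i)) \<le> (\<Sum>i\<in>UNIV. C i)" by (intro sum_mono)
    then show "norm (X p t) \<le> (\<Sum>i\<in>UNIV. C i)" by (rule order_trans[OF norm_vec_le_sum])
  qed
qed

lemma unif_bigo_vecI:
  fixes R :: "'p \<Rightarrow> real \<Rightarrow> real \<Rightarrow> 'v::real_normed_vector^'i::finite"
  assumes "\<And>i. unif_bigo T P \<gamma> (\<lambda>p s t. R p s t $ i)"
  shows "unif_bigo T P \<gamma> R"
proof -
  have "\<forall>i. \<exists>C. \<forall>p\<in>P. \<forall>s t. 0 \<le> s \<longrightarrow> s \<le> t \<longrightarrow> t \<le> T \<longrightarrow> norm (R p s t $ i) \<le> C * (t - s) powr \<gamma>"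
    using assms unfolding unif_bigo_def by fast
  then obtain C where C: "\<forall>i. \<forall>p\<in>P. \<forall>s t. 0 \<le> s \<longrightarrow> s \<le> t \<longrightarrow> t \<le> T \<longrightarrow> norm (R p s t $ i) \<le> C i * (t - s) powr \<gamma>"
    by (elim choice[THEN exE])
  show ?thesis
  proof (rule unif_bigoI)
    fix p s t assume "p \<in> P" "0 \<le> s" "s \<le> t" "t \<le> T"
    then have "norm (R p s t $ i) \<le> C i * (t - s) powr \<gamma>" for i using C by simp
    then have "(\<Sum>i\<in>UNIV. norm (R p s t $ i)) \<le> (\<Sum>i\<in>UNIV. C i * (t - s) powr \<gamma>)" by (intro sum_mono)
    then show "norm (R p s t) \<le> (\<Sum>i\<in>UNIV. C i) * (t - s) powr \<gamma>"
      unfolding sum_distrib_right by (rule order_trans[OF norm_vec_le_sum])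
  qed
qed

lemma continuous_on_of_unif_bigo:
  fixes X :: "'p \<Rightarrow> real \<Rightarrow> 'v::real_normed_vector"
  assumes "unif_bigo T P \<gamma> (\<lambda>p s t. X p t - X p s)" "0 < \<gamma>" "p \<in> P"
  shows "continuous_on {0..T} (X p)"
proof -
  obtain C where C: "0 \<le> C"
    "\<And>p s t. p \<in> P \<Longrightarrow> 0 \<le> s \<Longrightarrow> s \<le> t \<Longrightarrow> t \<le> T \<Longrightarrow> norm (X p t - X p s) \<le> C * (t - s) powr \<gamma>"
    by (rule unif_bigoE[OF assms(1)]) blast
  have sym: "norm (X p t - X p s) \<le> C * \<bar>t - s\<bar> powr \<gamma>" if "s \<in> {0..T}" "t \<in> {0..T}" for s t
    using C(2)[of p s t] C(2)[of p t s] that \<open>p \<in> P\<close> by (cases "s \<le> t") (auto simp: norm_minus_commute)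
  show ?thesis
    unfolding continuous_on
  proof
    fix s assume s: "s \<in> {0..T}"
    have "((\<lambda>t. C * \<bar>t - s\<bar> powr \<gamma>) \<longlongrightarrow> C * \<bar>s - s\<bar> powr \<gamma>) (at s within {0..T})"
      using assms(2) by (intro tendsto_intros) auto
    then have "((\<lambda>t. C * \<bar>t - s\<bar> powr \<gamma>) \<longlongrightarrow> 0) (at s within {0..T})" by simp
    then have "((\<lambda>t. X p t - X p s) \<longlongrightarrow> 0) (at s within {0..T})"
      by (rule Lim_null_comparison[rotated])
        (use sym s in \<open>auto simp: eventually_at intro!: exI[of _ 1]\<close>)
    then show "(X p \<longlongrightarrow> X p s) (at s within {0..T})" by (rule LIM_zero_cancel)
  qed
qed

lemma small_o_incr_of_unif_bigo:
  assumes "unif_bigo T P \<gamma> R" "1 < \<gamma>" "p \<in> P"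
  shows "small_o_incr T (R p)"
proof -
  obtain C where C: "0 \<le> C"
    "\<And>p s t. p \<in> P \<Longrightarrow> 0 \<le> s \<Longrightarrow> s \<le> t \<Longrightarrow> t \<le> T \<Longrightarrow> norm (R p s t) \<le> C * (t - s) powr \<gamma>"
    by (rule unif_bigoE[OF assms(1)]) blast
  show ?thesis
    unfolding small_o_incr_def
  proof (intro allI impI)
    fix e :: real assume e: "0 < e"
    define d where "d = (e / (C + 1)) powr (1 / (\<gamma> - 1))"
    have "0 < d" using e C by (simp add: d_def)
    moreover have "\<bar>R p s t\<bar> \<le> e * (t - s)" if "0 \<le> s \<and> s \<le> t \<and> t \<le> T \<and> t - s < d" for s t
    proof -
      have "(t - s) powr (\<gamma> - 1) \<le> d powr (\<gamma> - 1)" using that assms by (intro powr_mono2) auto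
      also have "\<dots> = e / (C + 1)" using e C assms by (simp add: d_def powr_powr)
      finally have "C * (t - s) powr (\<gamma> - 1) \<le> C * (e / (C + 1))" using C(1) by (rule mult_left_mono)
      also have "\<dots> \<le> e" using C e by (simp add: field_simps)
      finally have le: "C * (t - s) powr (\<gamma> - 1) \<le> e" .
      have "\<bar>R p s t\<bar> \<le> C * (t - s) powr \<gamma>" using C(2)[of p s t] that assms by simp
      also have "\<dots> = (C * (t - s) powr (\<gamma> - 1)) * (t - s)"
        using that by (cases "s = t") (auto simp: powr_diff)
      also have "\<dots> \<le> e * (t - s)" using le that by (intro mult_right_mono) auto
      finally show ?thesis .
    qed
    ultimately show "\<exists>d>0. \<forall>s t. 0 \<le> s \<and> s \<le> t \<and> t \<le> T \<and> t - s < d \<longrightarrow> \<bar>R p s t\<bar> \<le> e * (t - s)"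
      by blast
  qed
qed

text \<open>
  The increments are additive, so their defect vanishes and \<open>sewing_bound\<close> applies with \<open>C = 0\<close>.
\<close>

lemma constant_of_unif_bigo_incr:
  fixes X :: "real \<Rightarrow> real"
  assumes "unif_bigo T P \<gamma> (\<lambda>p s t. X t - X s)" "1 < \<gamma>" "P \<noteq> {}" "0 \<le> t" "t \<le> T"
  shows "X t = X 0"
proof -
  obtain p where p: "p \<in> P" using assms(3) by blast
  have "\<bar>X t - X 0\<bar> \<le> 0 / (1 - 2 powr (1 - \<gamma>)) * (t - 0) powr \<gamma>"
    by (rule sewing_bound[where R = "\<lambda>s t. X t - X s" and T = T])
      (use assms small_o_incr_of_unif_bigo[OF assms(1,2) p] in auto)
  then show ?thesis by simp
qed

section \<open>Drift integrals\<close>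


lemma set_integral_bounded:
  fixes g :: "real \<Rightarrow> real"
  assumes "s \<le> t" "\<And>r. s \<le> r \<Longrightarrow> r \<le> t \<Longrightarrow> \<bar>g r\<bar> \<le> M"
  shows "\<bar>LBINT r:{s..t}. g r\<bar> \<le> M * (t - s)"
proof -
  have M: "0 \<le> M" using assms(2)[of s] assms(1) by linarith
  have "\<bar>LBINT r:{s..t}. g r\<bar> \<le> (LBINT r. norm (indicator {s..t} r *\<^sub>R g r))"
    unfolding set_lebesgue_integral_def
    using integral_norm_bound[of lborel "\<lambda>r. indicator {s..t} r *\<^sub>R g r"] by simp
  also have "\<dots> \<le> (LBINT r. indicator {s..t} r *\<^sub>R M)"
    proof (rule integral_mono')
    show "integrable lborel (\<lambda>r. indicator {s..t} r *\<^sub>R M)"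
      by (intro integrable_scaleR_left impI integrable_real_indicator) (auto simp: emeasure_lborel_Icc_eq)
  qed (use assms M in \<open>auto simp: indicator_def\<close>)
  also have "\<dots> = M * (t - s)" using assms by simp
  finally show ?thesis .
qed

lemma set_integral_split:
  fixes g :: "real \<Rightarrow> real"
  assumes "set_integrable lborel {0..T} g" "0 \<le> s" "s \<le> u" "u \<le> t" "t \<le> T"
  shows "(LBINT r:{s..t}. g r) = (LBINT r:{s..u}. g r) + (LBINT r:{u..t}. g r)"
proof -
  have "(LBINT r:{s..u} \<union> {u..t}. g r) = (LBINT r:{s..u}. g r) + (LBINT r:{u..t}. g r)"
  proof (rule set_integral_Un_AE)
    show "AE x in lborel. \<not> (x \<in> {s..u} \<and> x \<in> {u..t})"
      using AE_lborel_singleton[of u] by eventually_elim auto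
    show "set_integrable lborel {s..u} g" "set_integrable lborel {u..t} g"
      using assms by (auto intro: set_integrable_subset)
  qed auto
  moreover have "{s..u} \<union> {u..t} = {s..t}" using assms by auto
  ultimately show ?thesis by simp
qed

lemma set_integrable_mult_continuous:
  fixes g W :: "real \<Rightarrow> real"
  assumes "set_integrable lborel {0..T} g" "continuous_on {0..T} W"
  shows "set_integrable lborel {0..T} (\<lambda>r. W r * g r)"
proof -
  have "bounded (W ` {0..T})"
    by (rule compact_imp_bounded[OF compact_continuous_image[OF assms(2)]]) simp
  then have "\<exists>K. \<forall>r\<in>{0..T}. \<bar>W r\<bar> \<le> K" unfolding bounded_iff by auto
  then obtain K where K: "\<And>r. r \<in> {0..T} \<Longrightarrow> \<bar>W r\<bar> \<le> K" by blast
  have W: "(\<lambda>r. indicator {0..T} r *\<^sub>R W r) \<in> borel_measurable lborel"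
    using borel_measurable_continuous_on_indicator[OF _ assms(2)] by simp
  have g: "integrable lborel (\<lambda>r. indicator {0..T} r *\<^sub>R g r)"
    using assms(1) by (simp add: set_integrable_def)
  have "integrable lborel (\<lambda>r. (indicator {0..T} r *\<^sub>R W r) * (indicator {0..T} r *\<^sub>R g r))"
  proof (rule Bochner_Integration.integrable_bound)
    show "integrable lborel (\<lambda>r. K * (indicator {0..T} r *\<^sub>R g r))" using g by (rule integrable_mult_right)
    show "(\<lambda>r. (indicator {0..T} r *\<^sub>R W r) * (indicator {0..T} r *\<^sub>R g r)) \<in> borel_measurable lborel"
      using W borel_measurable_integrable[OF g] by (rule borel_measurable_times)
    show "AE r in lborel. norm ((indicator {0..T} r *\<^sub>R W r) * (indicator {0..T} r *\<^sub>R g r))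
        \<le> norm (K * (indicator {0..T} r *\<^sub>R g r))"
    proof (rule AE_I2)
      fix r
      show "norm ((indicator {0..T} r *\<^sub>R W r) * (indicator {0..T} r *\<^sub>R g r))
        \<le> norm (K * (indicator {0..T} r *\<^sub>R g r))"
        using mult_right_mono[OF order_trans[OF K abs_ge_self], of r "\<bar>g r\<bar>"]
        by (auto simp: indicator_def abs_mult)
    qed
  qed
  moreover have "(\<lambda>r. (indicator {0..T} r *\<^sub>R W r) * (indicator {0..T} r *\<^sub>R g r))
      = (\<lambda>r. indicator {0..T} r *\<^sub>R (W r * g r))"
    by (auto simp: indicator_def)
  ultimately show ?thesis by (simp add: set_integrable_def)
qed

text \<open>
  Freezing a Hoelder continuous factor at the left end point costs a factor \<open>|t - s|\<^sup>\<gamma>\<close> on top of the length of the interval.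
\<close>

lemma drift_frozen:
  fixes Z a :: "'p \<Rightarrow> real \<Rightarrow> real"
  assumes Z: "unif_bigo T P \<gamma> (\<lambda>p s t. Z p t - Z p s)" and "0 < \<gamma>"
    and a: "unif_bdd T P a" "\<And>p. p \<in> P \<Longrightarrow> set_integrable lborel {0..T} (a p)"
  shows "unif_bigo T P (1 + \<gamma>) (\<lambda>p s t. (LBINT r:{s..t}. Z p r * a p r) - Z p s * (LBINT r:{s..t}. a p r))"
proof -
  obtain C where C: "0 \<le> C"
    "\<And>p s t. p \<in> P \<Longrightarrow> 0 \<le> s \<Longrightarrow> s \<le> t \<Longrightarrow> t \<le> T \<Longrightarrow> norm (Z p t - Z p s) \<le> C * (t - s) powr \<gamma>"
    by (rule unif_bigoE[OF Z]) blast
  obtain K where K: "0 \<le> K" "\<And>p t. p \<in> P \<Longrightarrow> 0 \<le> t \<Longrightarrow> t \<le> T \<Longrightarrow> norm (a p t) \<le> K"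
    by (rule unif_bddE[OF a(1)]) blast
  show ?thesis
  proof (rule unif_bigoI)
    fix p s t assume st: "p \<in> P" "0 \<le> s" "s \<le> t" "t \<le> T"
    have Za: "set_integrable lborel {0..T} (\<lambda>r. Z p r * a p r)"
      by (rule set_integrable_mult_continuous[OF a(2) continuous_on_of_unif_bigo[OF Z]]) (use st assms in auto)
    have i: "set_integrable lborel {s..t} (\<lambda>r. Z p r * a p r)" "set_integrable lborel {s..t} (a p)"
      using st by (auto intro!: set_integrable_subset[OF Za] set_integrable_subset[OF a(2)])
    have "(LBINT r:{s..t}. Z p r * a p r) - Z p s * (LBINT r:{s..t}. a p r)
        = (LBINT r:{s..t}. Z p r * a p r) - (LBINT r:{s..t}. Z p s * a p r)" by simp
    also have "\<dots> = (LBINT r:{s..t}. Z p r * a p r - Z p s * a p r)"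
      using i by (subst set_integral_diff) auto
    finally have eq: "(LBINT r:{s..t}. Z p r * a p r) - Z p s * (LBINT r:{s..t}. a p r)
        = (LBINT r:{s..t}. Z p r * a p r - Z p s * a p r)" .
    have "\<bar>LBINT r:{s..t}. Z p r * a p r - Z p s * a p r\<bar> \<le> (C * (t - s) powr \<gamma> * K) * (t - s)"
    proof (rule set_integral_bounded[OF st(3)])
      fix r assume r: "s \<le> r" "r \<le> t"
      have "\<bar>Z p r * a p r - Z p s * a p r\<bar> = \<bar>Z p r - Z p s\<bar> * \<bar>a p r\<bar>"
        by (simp add: left_diff_distrib flip: abs_mult)
      also have "\<dots> \<le> (C * (t - s) powr \<gamma>) * K"
      proof (rule mult_mono)
        have "\<bar>Z p r - Z p s\<bar> \<le> C * (r - s) powr \<gamma>" using C(2)[of p s r] st r by simp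
        also have "\<dots> \<le> C * (t - s) powr \<gamma>"
          using C(1) r assms by (intro mult_left_mono powr_mono2) auto
        finally show "\<bar>Z p r - Z p s\<bar> \<le> C * (t - s) powr \<gamma>" .
        show "\<bar>a p r\<bar> \<le> K" using K(2)[of p r] st r by simp
      qed (use C K in auto)
      finally show "\<bar>Z p r * a p r - Z p s * a p r\<bar> \<le> C * (t - s) powr \<gamma> * K" .
    qed
    also have "\<dots> = (C * K) * (t - s) powr (1 + \<gamma>)"
      using st by (cases "s = t") (auto simp: powr_add)
    finally show "norm ((LBINT r:{s..t}. Z p r * a p r) - Z p s * (LBINT r:{s..t}. a p r))
        \<le> C * K * (t - s) powr (1 + \<gamma>)"
      unfolding eq by simp
  qed
qed

section \<open>Tensors\<close>


lemma bounded_bilinear_outer: "bounded_bilinear (outer :: real^'y::finite \<Rightarrow> real^'y \<Rightarrow> real^'y^'y)"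
proof -
  have "bilinear (outer :: real^'y \<Rightarrow> real^'y \<Rightarrow> real^'y^'y)"
    unfolding bilinear_def outer_def
    by (auto intro!: linearI simp: vec_eq_iff algebra_simps)
  then show ?thesis by (simp add: bilinear_conv_bounded_bilinear)
qed

lemma outer_scaleR_left: "outer (r *\<^sub>R u) v = r *\<^sub>R outer u v"
  and outer_scaleR_right: "outer u (r *\<^sub>R v) = r *\<^sub>R outer u v"
  and outer_minus_left: "outer (- u) v = - outer u v"
  and outer_minus_right: "outer u (- v) = - outer u v"
  and outer_add_left: "outer (u + w) v = outer u v + outer w v"
  and outer_add_right: "outer u (v + w) = outer u v + outer u w"
  for u v w :: "real^'y::finite"
  by (rule bounded_bilinear.scaleR_left[OF bounded_bilinear_outer] bounded_bilinear.scaleR_right[OF bounded_bilinear_outer]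
    bounded_bilinear.minus_left[OF bounded_bilinear_outer] bounded_bilinear.minus_right[OF bounded_bilinear_outer]
    bounded_bilinear.add_left[OF bounded_bilinear_outer] bounded_bilinear.add_right[OF bounded_bilinear_outer])+

lemma bounded_bilinear_vector_matrix:
  "bounded_bilinear (\<lambda>v (M::real^'y^'y). v v* M :: real^'y::finite)"
proof -
  have "bilinear (\<lambda>v (M::real^'y^'y). v v* M)"
    unfolding bilinear_def vector_matrix_mult_def
    by (auto intro!: linearI simp: vec_eq_iff algebra_simps sum.distrib sum_distrib_left)
  then show ?thesis by (simp add: bilinear_conv_bounded_bilinear)
qed

lemma outer_inner_outer: "outer u v \<bullet> outer a b = (u \<bullet> a) * (v \<bullet> b)"
  by (simp add: inner_vec_def outer_def sum_product mult_ac)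

lemma outer_inner_transpose: "outer u v \<bullet> transpose M = outer v u \<bullet> M"
  unfolding inner_vec_def outer_def transpose_def
  by (subst (2) sum.swap) (simp add: mult_ac inner_real_def)

text \<open>
  This is how the second order coefficient enters Chen's relation: paired with \<open>\<delta>Y\<^bsub>s,u\<^esub> \<otimes> \<delta>Y\<^bsub>u,t\<^esub>\<close>, it acts on the
  second increment through the vector \<open>\<delta>Y\<^bsub>s,u\<^esub> v* M\<close>.
\<close>

lemma inner_outer: "M \<bullet> outer a b = (a v* M) \<bullet> b"
proof -
  have "M \<bullet> outer a b = (\<Sum>i\<in>UNIV. \<Sum>j\<in>UNIV. M $ i $ j * a $ i * b $ j)"
    by (simp add: inner_vec_def outer_def mult_ac)
  also have "\<dots> = (\<Sum>j\<in>UNIV. \<Sum>i\<in>UNIV. M $ i $ j * a $ i * b $ j)" by (rule sum.swap)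
  finally show ?thesis by (simp add: inner_vec_def vector_matrix_mult_def sum_distrib_left mult_ac)
qed

lemma vector_matrix_outer: "a v* outer u v = (a \<bullet> u) *\<^sub>R v"
  by (simp add: inner_vec_def outer_def vector_matrix_mult_def vec_eq_iff sum_distrib_left mult_ac)

section \<open>Functions with three bounded derivatives\<close>


text \<open>
  \<open>D i\<close> is the \<open>i\<close>-th derivative of \<open>D 0\<close> on \<open>S\<close>, for \<open>i \<le> 3\<close>.
\<close>

definition C3_on :: "real set \<Rightarrow> (nat \<Rightarrow> real \<Rightarrow> real) \<Rightarrow> real \<Rightarrow> bool" where
  "C3_on S D K \<longleftrightarrow> convex S \<and> 0 \<le> K \<and>
     (\<forall>i\<le>2. \<forall>x\<in>S. (D i has_field_derivative D (Suc i) x) (at x within S)) \<and>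
     (\<forall>i\<le>3. \<forall>x\<in>S. \<bar>D i x\<bar> \<le> K)"

lemma C3_on_taylor:
  assumes "C3_on S D K" "x \<in> S" "y \<in> S"
  shows "i \<le> 2 \<Longrightarrow> \<bar>D i y - D i x\<bar> \<le> K * \<bar>y - x\<bar>"
    and "i \<le> 1 \<Longrightarrow> \<bar>D i y - D i x - D (Suc i) x * (y - x)\<bar> \<le> K * (y - x)\<^sup>2"
    and "\<bar>D 0 y - D 0 x - D 1 x * (y - x) - D 2 x * (y - x)\<^sup>2 / 2\<bar> \<le> K / 2 * \<bar>(y - x) ^ 3\<bar>"
proof -
  have S: "convex S" and D: "\<And>i x. x \<in> S \<Longrightarrow> i \<le> 2 \<Longrightarrow> (D i has_field_derivative D (Suc i) x) (at x within S)"
    and K: "\<And>i x. x \<in> S \<Longrightarrow> i \<le> 3 \<Longrightarrow> norm (D i x) \<le> K"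
    using assms by (auto simp: C3_on_def)
  show "\<bar>D i y - D i x\<bar> \<le> K * \<bar>y - x\<bar>" if "i \<le> 2"
    using field_Taylor[of S 0 "\<lambda>j. D (i + j)" K x y, OF S _ _ assms(2,3)] D K that by simp
  show "\<bar>D i y - D i x - D (Suc i) x * (y - x)\<bar> \<le> K * (y - x)\<^sup>2" if "i \<le> 1"
    using field_Taylor[of S 1 "\<lambda>j. D (i + j)" K x y, OF S _ _ assms(2,3)] D K that
    by (simp add: diff_diff_eq power2_eq_square)
  show "\<bar>D 0 y - D 0 x - D 1 x * (y - x) - D 2 x * (y - x)\<^sup>2 / 2\<bar> \<le> K / 2 * \<bar>(y - x) ^ 3\<bar>"
    using field_Taylor[of S 2 D K x y, OF S _ _ assms(2,3)] D K
    by (simp add: diff_diff_eq numeral_2_eq_2 numeral_3_eq_3 abs_mult add.assoc)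
qed

lemma C3_on_exp:
  assumes "\<bar>k\<bar> = 1" "0 \<le> u"
  shows "C3_on {-u..u} (\<lambda>i x. k ^ i * exp (k * x)) (exp u)"
  unfolding C3_on_def
proof (intro conjI allI impI ballI)
  fix i x assume x: "x \<in> {-u..u}"
  show "((\<lambda>x. k ^ i * exp (k * x)) has_field_derivative k ^ Suc i * exp (k * x)) (at x within {- u..u})"
    by (auto intro!: derivative_eq_intros)
  have "k * x \<le> \<bar>k * x\<bar>" by simp
  also have "\<dots> \<le> u" using x assms by (auto simp: abs_mult abs_le_iff)
  finally show "\<bar>k ^ i * exp (k * x)\<bar> \<le> exp u" using assms by (simp add: abs_mult power_abs)
qed auto

definition ln_derivs :: "nat \<Rightarrow> real \<Rightarrow> real" where
  "ln_derivs i x = (if i = 0 then ln x else (- 1) ^ (i - 1) * fact (i - 1) / x ^ i)"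

lemma C3_on_ln:
  assumes l: "0 < l"
  obtains K where "C3_on {l..u} ln_derivs K"
proof -
  have der: "(ln_derivs i has_field_derivative ln_derivs (Suc i) x) (at x within {l..u})"
    if "i \<le> 2" "x \<in> {l..u}" for i x
  proof -
    have x: "0 < x" using that l by simp
    have "(ln has_field_derivative 1 / x) (at x within {l..u})"
      using x by (auto intro!: derivative_eq_intros)
    moreover have "((\<lambda>x. 1 / x) has_field_derivative - 1 / x\<^sup>2) (at x within {l..u})"
      using x by (auto intro!: derivative_eq_intros simp: power2_eq_square)
    moreover have "((\<lambda>x. - 1 / x\<^sup>2) has_field_derivative 2 / x ^ 3) (at x within {l..u})"
      using x by (auto intro!: derivative_eq_intros simp: field_simps power2_eq_square power3_eq_cube)
    moreover have "i = 0 \<or> i = 1 \<or> i = 2" using that by auto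
    ultimately show ?thesis by (elim disjE) (simp_all add: ln_derivs_def[abs_def] numeral_2_eq_2 numeral_3_eq_3)
  qed
  have cont: "continuous_on {l..u} (ln_derivs i)" for i
  proof (cases "i = 0")
    case True
    then show ?thesis using l by (auto simp: ln_derivs_def[abs_def] intro!: continuous_intros)
  next
    case False
    then show ?thesis using l by (auto simp: ln_derivs_def[abs_def] intro!: continuous_intros)
  qed
  have "\<exists>K\<ge>0. \<forall>x\<in>{l..u}. \<bar>ln_derivs i x\<bar> \<le> K" for i
  proof -
    have "bounded (ln_derivs i ` {l..u})" by (intro compact_imp_bounded compact_continuous_image cont) auto
    then obtain K where "\<forall>x\<in>ln_derivs i ` {l..u}. norm x \<le> K" unfolding bounded_iff by (elim exE)
    then show ?thesis by (intro exI[of _ "max 0 K"]) (auto simp: le_max_iff_disj)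
  qed
  then have "\<forall>i. \<exists>K\<ge>0. \<forall>x\<in>{l..u}. \<bar>ln_derivs i x\<bar> \<le> K" by (rule allI)
  then obtain K where K: "\<forall>i. 0 \<le> K i \<and> (\<forall>x\<in>{l..u}. \<bar>ln_derivs i x\<bar> \<le> K i)" by (elim choice[THEN exE])
  have "C3_on {l..u} ln_derivs (\<Sum>i\<le>3. K i)"
    unfolding C3_on_def
  proof (intro conjI allI impI ballI der)
    show "0 \<le> (\<Sum>i\<le>3. K i)" using K by (intro sum_nonneg) auto
    fix i :: nat and x assume i: "i \<le> 3" and x: "x \<in> {l..u}"
    have "\<bar>ln_derivs i x\<bar> \<le> K i" using K x by blast
    also have "K i \<le> (\<Sum>i\<le>3. K i)" by (rule member_le_sum) (use K i in auto)
    finally show "\<bar>ln_derivs i x\<bar> \<le> (\<Sum>i\<le>3. K i)" .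
  qed auto
  then show ?thesis by (rule that)
qed

section \<open>Processes driven by a rough path with differentiable bracket\<close>


text \<open>
  The bracket enters only through its density \<open>B\<close>; all correction terms of the calculus are drifts.
\<close>

locale bracketed_rough_path =
  fixes T \<alpha> :: real and Y :: "'y::finite rough_path"
  assumes T_pos: "0 < T" and alpha_gt: "1 / 3 < \<alpha>" and alpha_le: "\<alpha> \<le> 1 / 2"
    and Y_in: "Y \<in> rough_paths_0_1 T \<alpha>"

begin


abbreviation dY where "dY \<equiv> incr (fst Y)"

abbreviation YY where "YY \<equiv> snd Y"

abbreviation B where "B \<equiv> bracket_dot T Y"

lemma chen: "0 \<le> s \<Longrightarrow> s \<le> u \<Longrightarrow> u \<le> t \<Longrightarrow> t \<le> T \<Longrightarrow> YY s t = YY s u + YY u t + outer (dY s u) (dY u t)"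
  using Y_in by (simp add: rough_paths_0_1_def rough_path_def chen_def)

lemma dY_add: "dY s t = dY s u + dY u t"
  by (simp add: incr_def)

lemma YY_diag: "0 \<le> t \<Longrightarrow> t \<le> T \<Longrightarrow> YY t t = 0"
  using chen[of t t t] by (simp add: incr_def outer_def vec_eq_iff)

lemma unif_bigo_of_holder_seminorm:
  assumes "holder_seminorm T \<gamma> \<Xi> < \<infinity>" and diag: "\<And>t. 0 \<le> t \<Longrightarrow> t \<le> T \<Longrightarrow> \<Xi> t t = 0"
  shows "unif_bigo T P \<gamma> (\<lambda>p. \<Xi>)"
proof -
  obtain K where K: "holder_seminorm T \<gamma> \<Xi> = ennreal K" "0 \<le> K"
    using assms(1) by (cases "holder_seminorm T \<gamma> \<Xi>" rule: ennreal_cases) auto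
  show ?thesis
  proof (rule unif_bigoI)
    fix p s t assume st: "0 \<le> s" "s \<le> t" "t \<le> T"
    show "norm (\<Xi> s t) \<le> K * (t - s) powr \<gamma>"
    proof (cases "s = t")
      case False
      then have lt: "s < t" using st by simp
      have "ennreal (norm (\<Xi> s t) / (t - s) powr \<gamma>) \<le> holder_seminorm T \<gamma> \<Xi>"
        unfolding holder_seminorm_def by (rule SUP_upper2[of "(s, t)"]) (use st lt in auto)
      then have "norm (\<Xi> s t) / (t - s) powr \<gamma> \<le> K" using K by simp
      then show ?thesis using lt by (simp add: pos_divide_le_eq)
    qed (use diag st in simp)
  qed
qed

lemma dY_bigo: "unif_bigo T P \<alpha> (\<lambda>p. dY)"
proof (rule unif_bigo_of_holder_seminorm)
  show "holder_seminorm T \<alpha> dY < \<infinity>"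
    using Y_in by (simp add: rough_paths_0_1_def rough_path_def less_top)
qed (simp add: incr_def)

lemma YY_bigo: "unif_bigo T P (2 * \<alpha>) (\<lambda>p. YY)"
proof (rule unif_bigo_of_holder_seminorm)
  show "holder_seminorm T (2 * \<alpha>) YY < \<infinity>"
    using Y_in by (simp add: rough_paths_0_1_def rough_path_def less_top)
qed (simp add: YY_diag)

text \<open>
  By Chen's relation the bracket is a path, although it is defined from a two-parameter function.
\<close>

lemma bracket_incr_eq:
  assumes "0 \<le> s" "s \<le> t" "t \<le> T"
  shows "bracket_incr Y s t = bracket_incr Y 0 t - bracket_incr Y 0 s"
  unfolding bracket_incr_def using chen[of 0 s t] assms dY_add[of 0 t s]
  by (simp add: vec_eq_iff outer_def transpose_def algebra_simps)

lemma B_cont: "continuous_on {0..T} B"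
  using Y_in by (simp add: rough_paths_0_1_def)

lemma B_bdd: "unif_bdd T P (\<lambda>p. B)"
proof -
  have "bounded (B ` {0..T})"
    by (rule compact_imp_bounded[OF compact_continuous_image[OF B_cont]]) simp
  then obtain K where "\<forall>x\<in>B ` {0..T}. norm x \<le> K" unfolding bounded_iff by blast
  then show ?thesis by (intro unif_bddI[of _ _ _ K]) auto
qed

lemma inner_bracket_incr:
  assumes st: "0 \<le> s" "s \<le> t" "t \<le> T"
  shows "W \<bullet> bracket_incr Y s t = (LBINT r:{s..t}. W \<bullet> B r)"
proof -
  have "(LBINT r:{s..t}. W \<bullet> B r) = W \<bullet> bracket_incr Y 0 t - W \<bullet> bracket_incr Y 0 s"
    unfolding set_lebesgue_integral_def
  proof (rule integral_FTC_atLeastAtMost[OF st(2)])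
    show "continuous_on {s..t} (\<lambda>r. W \<bullet> B r)"
      by (intro continuous_intros continuous_on_subset[OF B_cont]) (use st in auto)
    fix r assume r: "s \<le> r" "r \<le> t"
    have "bracket_incr Y 0 differentiable_on {0..T}" using Y_in by (simp add: rough_paths_0_1_def)
    then have "bracket_incr Y 0 differentiable (at r within {0..T})"
      using r st by (auto simp: differentiable_on_def)
    then have "(bracket_incr Y 0 has_vector_derivative B r) (at r within {0..T})"
      unfolding bracket_dot_def by (simp add: vector_derivative_works)
    then have "(bracket_incr Y 0 has_vector_derivative B r) (at r within {s..t})"
      by (rule has_vector_derivative_within_subset) (use st in auto)
    then show "((\<lambda>r. W \<bullet> bracket_incr Y 0 r) has_vector_derivative W \<bullet> B r) (at r within {s..t})"
      by (rule bounded_linear.has_vector_derivative[OF bounded_linear_inner_right])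
  qed
  then show ?thesis using bracket_incr_eq[OF st] by (simp add: inner_diff_right)
qed

text \<open>
  A product of two first order terms is of second order: half of it is in the iterated integrals, and the
  bracket accounts for the failure of the usual integration by parts.
\<close>

lemma outer_inner_square:
  "(u \<bullet> dY s t) * (v \<bullet> dY s t)
    = (outer u v + outer v u) \<bullet> YY s t + outer u v \<bullet> bracket_incr Y s t"
  by (simp add: bracket_incr_def inner_diff_right inner_add_left outer_inner_outer outer_inner_transpose)

lemma drift_bigo:
  assumes "unif_bdd T P a"
  shows "unif_bigo T P 1 (\<lambda>p s t. LBINT r:{s..t}. a p r :: real)"
proof -
  obtain K where K: "0 \<le> K" "\<And>p t. p \<in> P \<Longrightarrow> 0 \<le> t \<Longrightarrow> t \<le> T \<Longrightarrow> norm (a p t) \<le> K"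
    by (rule unif_bddE[OF assms]) blast
  show ?thesis
  proof (rule unif_bigoI)
    fix p s t assume st: "p \<in> P" "0 \<le> s" "s \<le> t" "t \<le> T"
    have "\<bar>LBINT r:{s..t}. a p r\<bar> \<le> K * (t - s)"
      by (rule set_integral_bounded) (use st K in auto)
    then show "norm (LBINT r:{s..t}. a p r) \<le> K * (t - s) powr 1" using st by simp
  qed
qed

text \<open>
  The bracket terms \<open>W\<^sub>s : \<delta>[Y]\<^bsub>s,t\<^esub>\<close> of the expansions are absorbed in a drift. The error
  \<open>|t-s|\<^bsup>1+\<alpha>\<^esup>\<close> is admissible since \<open>3 \<alpha> \<le> 1 + \<alpha>\<close> for \<open>\<alpha> \<le> 1/2\<close>.
\<close>

lemma bracket_drift_frozen:
  assumes W: "unif_bigo T P \<alpha> (\<lambda>p s t. W p t - W p s)"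
  shows "unif_bigo T P (3 * \<alpha>) (\<lambda>p s t. (LBINT r:{s..t}. W p r \<bullet> B r) - W p s \<bullet> bracket_incr Y s t)"
proof -
  obtain C where C: "0 \<le> C"
    "\<And>p s t. p \<in> P \<Longrightarrow> 0 \<le> s \<Longrightarrow> s \<le> t \<Longrightarrow> t \<le> T \<Longrightarrow> norm (W p t - W p s) \<le> C * (t - s) powr \<alpha>"
    by (rule unif_bigoE[OF W]) blast
  obtain K where K: "0 \<le> K" "\<And>t. 0 \<le> t \<Longrightarrow> t \<le> T \<Longrightarrow> norm (B t) \<le> K"
    by (rule unif_bddE[OF B_bdd[of "{()}"]]) auto
  have "unif_bigo T P (1 + \<alpha>) (\<lambda>p s t. (LBINT r:{s..t}. W p r \<bullet> B r) - W p s \<bullet> bracket_incr Y s t)"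
  proof (rule unif_bigoI)
    fix p s t assume st: "p \<in> P" "0 \<le> s" "s \<le> t" "t \<le> T"
    have Wc: "continuous_on {0..T} (W p)"
      by (rule continuous_on_of_unif_bigo[OF W]) (use st alpha_gt in auto)
    have i: "set_integrable lborel {s..t} (\<lambda>r. V r \<bullet> B r)" if "continuous_on {0..T} V" for V
      by (rule borel_integrable_atLeastAtMost')
        (intro continuous_intros continuous_on_subset[OF B_cont] continuous_on_subset[OF that]; use st in auto)
    have eq: "(LBINT r:{s..t}. W p r \<bullet> B r) - W p s \<bullet> bracket_incr Y s t
        = (LBINT r:{s..t}. W p r \<bullet> B r - W p s \<bullet> B r)"
      unfolding inner_bracket_incr[OF st(2-4)]
      by (rule set_integral_diff(2)[symmetric]; rule i) (rule Wc continuous_on_const)+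
    have "\<bar>LBINT r:{s..t}. W p r \<bullet> B r - W p s \<bullet> B r\<bar> \<le> (C * (t - s) powr \<alpha> * K) * (t - s)"
    proof (rule set_integral_bounded[OF st(3)])
      fix r assume r: "s \<le> r" "r \<le> t"
      have "\<bar>W p r \<bullet> B r - W p s \<bullet> B r\<bar> \<le> norm (W p r - W p s) * norm (B r)"
        using Cauchy_Schwarz_ineq2[of "W p r - W p s" "B r"] by (simp add: inner_diff_left)
      also have "\<dots> \<le> (C * (t - s) powr \<alpha>) * K"
      proof (rule mult_mono)
        have "norm (W p r - W p s) \<le> C * (r - s) powr \<alpha>" using C(2)[of p s r] st r by simp
        also have "\<dots> \<le> C * (t - s) powr \<alpha>"
          using C(1) r alpha_gt by (intro mult_left_mono powr_mono2) auto
        finally show "norm (W p r - W p s) \<le> C * (t - s) powr \<alpha>" .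
        show "norm (B r) \<le> K" using K(2)[of r] st r by simp
      qed (use C K in auto)
      finally show "\<bar>W p r \<bullet> B r - W p s \<bullet> B r\<bar> \<le> C * (t - s) powr \<alpha> * K" .
    qed
    also have "\<dots> = (C * K) * (t - s) powr (1 + \<alpha>)"
      using st by (cases "s = t") (auto simp: powr_add)
    finally show "norm ((LBINT r:{s..t}. W p r \<bullet> B r) - W p s \<bullet> bracket_incr Y s t)
        \<le> C * K * (t - s) powr (1 + \<alpha>)"
      unfolding eq by simp
  qed
  then show ?thesis by (rule unif_bigo_mono) (use alpha_le in simp)
qed

text \<open>
  \<open>X2 $ \<eta> $ \<kappa>\<close> is the derivative of \<open>X1 $ \<kappa>\<close> in the direction \<open>\<eta>\<close>, so that it multiplies the iterated integral
  \<open>\<integral> \<delta>Y\<^sup>\<eta> dY\<^sup>\<kappa>\<close>, the entry \<open>(\<eta>, \<kappa>)\<close> of the second level of the rough path.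
\<close>

definition controlled :: "'p set \<Rightarrow> ('p \<Rightarrow> real \<Rightarrow> real^'y) \<Rightarrow> ('p \<Rightarrow> real \<Rightarrow> real^'y^'y) \<Rightarrow> bool" where
  "controlled P X1 X2 \<longleftrightarrow> unif_bdd T P X1 \<and> unif_bdd T P X2 \<and>
     unif_bigo T P \<alpha> (\<lambda>p s t. X2 p t - X2 p s) \<and>
     unif_bigo T P (2 * \<alpha>) (\<lambda>p s t. X1 p t - X1 p s - dY s t v* X2 p s)"

lemma controlledD:
  assumes "controlled P X1 X2"
  shows "unif_bdd T P X1" "unif_bdd T P X2" "unif_bigo T P \<alpha> (\<lambda>p s t. X2 p t - X2 p s)"
    "unif_bigo T P (2 * \<alpha>) (\<lambda>p s t. X1 p t - X1 p s - dY s t v* X2 p s)"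
  using assms by (auto simp: controlled_def)

lemma controlled_incr:
  assumes "controlled P X1 X2"
  shows "unif_bigo T P \<alpha> (\<lambda>p s t. X1 p t - X1 p s)"
proof -
  have 1: "unif_bigo T P \<alpha> (\<lambda>p s t. X1 p t - X1 p s - dY s t v* X2 p s)"
    by (rule unif_bigo_mono[of _ _ "2 * \<alpha>"]) (use assms alpha_gt in \<open>auto simp: controlled_def\<close>)
  have 2: "unif_bigo T P \<alpha> (\<lambda>p s t. dY s t v* X2 p s)"
    by (rule unif_bigo_bdd_bilinear[OF bounded_bilinear.flip[OF bounded_bilinear_vector_matrix] _ dY_bigo])
      (use assms in \<open>auto simp: controlled_def\<close>)
  show ?thesis by (rule unif_bigo_cong[OF unif_bigo_add[OF 1 2]]) simp
qed

text \<open>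
  The same notion for a scalar path \<open>Z\<close> with derivative \<open>Z1\<close>.
\<close>

definition scalar_controlled :: "'p set \<Rightarrow> ('p \<Rightarrow> real \<Rightarrow> real) \<Rightarrow> ('p \<Rightarrow> real \<Rightarrow> real^'y) \<Rightarrow> bool" where
  "scalar_controlled P Z Z1 \<longleftrightarrow> unif_bdd T P Z \<and> unif_bdd T P Z1 \<and>
     unif_bigo T P \<alpha> (\<lambda>p s t. Z1 p t - Z1 p s) \<and>
     unif_bigo T P (2 * \<alpha>) (\<lambda>p s t. Z p t - Z p s - Z1 p s \<bullet> dY s t)"

lemma scalar_controlledD:
  assumes "scalar_controlled P Z Z1"
  shows "unif_bdd T P Z" "unif_bdd T P Z1" "unif_bigo T P \<alpha> (\<lambda>p s t. Z1 p t - Z1 p s)"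
    "unif_bigo T P (2 * \<alpha>) (\<lambda>p s t. Z p t - Z p s - Z1 p s \<bullet> dY s t)"
  using assms by (auto simp: scalar_controlled_def)

lemma scalar_controlled_incr:
  assumes "scalar_controlled P Z Z1"
  shows "unif_bigo T P \<alpha> (\<lambda>p s t. Z p t - Z p s)"
proof -
  note Z = scalar_controlledD[OF assms]
  have 1: "unif_bigo T P \<alpha> (\<lambda>p s t. Z p t - Z p s - Z1 p s \<bullet> dY s t)"
    by (rule unif_bigo_mono[OF Z(4)]) (use alpha_gt in simp)
  have 2: "unif_bigo T P \<alpha> (\<lambda>p s t. Z1 p s \<bullet> dY s t)"
    by (rule unif_bigo_bdd_bilinear[OF bounded_bilinear_inner Z(2) dY_bigo])
  show ?thesis by (rule unif_bigo_cong[OF unif_bigo_add[OF 1 2]]) simp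
qed

lemma controlled_add:
  assumes X: "controlled P X1 X2" and Z: "controlled P Z1 Z2"
  shows "controlled P (\<lambda>p t. X1 p t + Z1 p t) (\<lambda>p t. X2 p t + Z2 p t)"
proof -
  note X = controlledD[OF X] and Z = controlledD[OF Z]
  interpret vm: bounded_bilinear "\<lambda>v (M::real^'y^'y). v v* M :: real^'y" by (rule bounded_bilinear_vector_matrix)
  have "unif_bigo T P \<alpha> (\<lambda>p s t. X2 p t + Z2 p t - (X2 p s + Z2 p s))"
    by (rule unif_bigo_cong[OF unif_bigo_add[OF X(3) Z(3)]]) simp
  moreover have "unif_bigo T P (2 * \<alpha>) (\<lambda>p s t. X1 p t + Z1 p t - (X1 p s + Z1 p s) - dY s t v* (X2 p s + Z2 p s))"
    by (rule unif_bigo_cong[OF unif_bigo_add[OF X(4) Z(4)]]) (simp add: vm.add_right)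
  ultimately show ?thesis
    using unif_bdd_add[OF X(1) Z(1)] unif_bdd_add[OF X(2) Z(2)] by (simp add: controlled_def)
qed

text \<open>
  Leibniz rule for the derivatives with respect to \<open>Y\<close>.
\<close>

lemma controlled_scaleR:
  assumes Z: "scalar_controlled P Z Z1" and X: "controlled P X1 X2"
  shows "controlled P (\<lambda>p t. Z p t *\<^sub>R X1 p t) (\<lambda>p t. Z p t *\<^sub>R X2 p t + outer (Z1 p t) (X1 p t))"
proof -
  note Z' = scalar_controlledD[OF Z] scalar_controlled_incr[OF Z]
    and X' = controlledD[OF X] controlled_incr[OF X]
  interpret vm: bounded_bilinear "\<lambda>v (M::real^'y^'y). v v* M :: real^'y" by (rule bounded_bilinear_vector_matrix)
  have \<alpha>: "0 \<le> \<alpha>" using alpha_gt by simp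
  have b1: "unif_bdd T P (\<lambda>p t. Z p t *\<^sub>R X1 p t)"
    by (rule unif_bdd_bilinear[OF bounded_bilinear_scaleR Z'(1) X'(1)])
  have b2: "unif_bdd T P (\<lambda>p t. Z p t *\<^sub>R X2 p t + outer (Z1 p t) (X1 p t))"
    by (rule unif_bdd_add[OF unif_bdd_bilinear[OF bounded_bilinear_scaleR Z'(1) X'(2)]
      unif_bdd_bilinear[OF bounded_bilinear_outer Z'(2) X'(1)]])
  have "unif_bigo T P \<alpha> (\<lambda>p s t. Z p t *\<^sub>R X2 p t - Z p s *\<^sub>R X2 p s)"
    by (rule unif_bigo_incr_bilinear[OF bounded_bilinear_scaleR Z'(1,5) X'(2,3) \<alpha>])
  moreover have "unif_bigo T P \<alpha> (\<lambda>p s t. outer (Z1 p t) (X1 p t) - outer (Z1 p s) (X1 p s))"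
    by (rule unif_bigo_incr_bilinear[OF bounded_bilinear_outer Z'(2,3) X'(1,5) \<alpha>])
  ultimately have i2: "unif_bigo T P \<alpha> (\<lambda>p s t. Z p t *\<^sub>R X2 p t + outer (Z1 p t) (X1 p t)
      - (Z p s *\<^sub>R X2 p s + outer (Z1 p s) (X1 p s)))"
    by (rule unif_bigo_cong[OF unif_bigo_add]) simp
  have 1: "unif_bigo T P (2 * \<alpha>) (\<lambda>p s t. Z p s *\<^sub>R (X1 p t - X1 p s - dY s t v* X2 p s))"
    by (rule unif_bigo_bdd_bilinear[OF bounded_bilinear_scaleR Z'(1) X'(4)])
  have 2: "unif_bigo T P (2 * \<alpha>) (\<lambda>p s t. (Z p t - Z p s - Z1 p s \<bullet> dY s t) *\<^sub>R X1 p s)"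
    by (rule unif_bigo_bdd_bilinear[OF bounded_bilinear.flip[OF bounded_bilinear_scaleR] X'(1) Z'(4)])
  have 3: "unif_bigo T P (2 * \<alpha>) (\<lambda>p s t. (Z p t - Z p s) *\<^sub>R (X1 p t - X1 p s))"
    using unif_bigo_bilinear[OF bounded_bilinear_scaleR Z'(5) X'(5)] by simp
  have "unif_bigo T P (2 * \<alpha>) (\<lambda>p s t. Z p t *\<^sub>R X1 p t - Z p s *\<^sub>R X1 p s
      - dY s t v* (Z p s *\<^sub>R X2 p s + outer (Z1 p s) (X1 p s)))"
    by (rule unif_bigo_cong[OF unif_bigo_add[OF unif_bigo_add[OF 1 2] 3]])
      (simp add: vm.add_right vm.scaleR_right vector_matrix_outer scaleR_diff_left scaleR_diff_right inner_commute)
  with b1 b2 i2 show ?thesis by (simp add: controlled_def)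
qed

definition integrable_drift :: "'p set \<Rightarrow> ('p \<Rightarrow> real \<Rightarrow> real) \<Rightarrow> bool" where
  "integrable_drift P a \<longleftrightarrow> unif_bdd T P a \<and> (\<forall>p\<in>P. set_integrable lborel {0..T} (a p))"

lemma integrable_driftD:
  assumes "integrable_drift P a"
  shows "unif_bdd T P a" "p \<in> P \<Longrightarrow> set_integrable lborel {0..T} (a p)"
    "p \<in> P \<Longrightarrow> 0 \<le> s \<Longrightarrow> t \<le> T \<Longrightarrow> set_integrable lborel {s..t} (a p)"
  using assms by (auto simp: integrable_drift_def intro: set_integrable_subset)

lemma integrable_drift_add:
  assumes "integrable_drift P a" "integrable_drift P b"
  shows "integrable_drift P (\<lambda>p t. a p t + b p t)"
  using assms by (auto simp: integrable_drift_def intro!: unif_bdd_add set_integral_add)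

lemma integrable_drift_mult:
  assumes Z: "unif_bdd T P Z" "unif_bigo T P \<alpha> (\<lambda>p s t. Z p t - Z p s)" and a: "integrable_drift P a"
  shows "integrable_drift P (\<lambda>p t. Z p t * a p t)"
  unfolding integrable_drift_def
proof (intro conjI ballI)
  show "unif_bdd T P (\<lambda>p t. Z p t * a p t)"
    using a by (intro unif_bdd_bilinear[OF bounded_bilinear_mult Z(1)]) (simp add: integrable_drift_def)
  fix p assume p: "p \<in> P"
  show "set_integrable lborel {0..T} (\<lambda>t. Z p t * a p t)"
    by (rule set_integrable_mult_continuous[OF _ continuous_on_of_unif_bigo[OF Z(2) _ p]])
      (use a p alpha_gt in \<open>auto simp: integrable_drift_def\<close>)
qed

lemma integrable_drift_bracket:
  assumes W: "unif_bdd T P W" "unif_bigo T P \<alpha> (\<lambda>p s t. W p t - W p s)"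
  shows "integrable_drift P (\<lambda>p t. W p t \<bullet> B t)"
  unfolding integrable_drift_def
proof (intro conjI ballI)
  show "unif_bdd T P (\<lambda>p t. W p t \<bullet> B t)"
    by (rule unif_bdd_bilinear[OF bounded_bilinear_inner W(1) B_bdd])
  fix p assume p: "p \<in> P"
  have "continuous_on {0..T} (W p)"
    by (rule continuous_on_of_unif_bigo[OF W(2) _ p]) (use alpha_gt in simp)
  then show "set_integrable lborel {0..T} (\<lambda>t. W p t \<bullet> B t)"
    by (intro borel_integrable_atLeastAtMost' continuous_on_inner B_cont)
qed

lemma drift_frozen_3\<alpha>:
  assumes Z: "unif_bigo T P \<alpha> (\<lambda>p s t. Z p t - Z p s)" and a: "integrable_drift P a"
  shows "unif_bigo T P (3 * \<alpha>) (\<lambda>p s t. (LBINT r:{s..t}. Z p r * a p r) - Z p s * (LBINT r:{s..t}. a p r))"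
  by (rule unif_bigo_mono[OF drift_frozen[OF Z _ integrable_driftD(1,2)[OF a]]]) (use alpha_gt alpha_le in auto)

text \<open>
  The local approximation of an increment. The drift is integrated, not frozen, because \<open>a\<close> is only measurable.
\<close>

definition germ ::
  "('p \<Rightarrow> real \<Rightarrow> real) \<Rightarrow> ('p \<Rightarrow> real \<Rightarrow> real^'y) \<Rightarrow> ('p \<Rightarrow> real \<Rightarrow> real^'y^'y) \<Rightarrow>
   'p \<Rightarrow> real \<Rightarrow> real \<Rightarrow> real" where
  "germ a X1 X2 p s t = (LBINT r:{s..t}. a p r) + X1 p s \<bullet> dY s t + X2 p s \<bullet> YY s t"

lemma germ_cong:
  assumes "\<And>r. 0 \<le> r \<Longrightarrow> r \<le> T \<Longrightarrow> a p r = a' p r" "\<And>r. 0 \<le> r \<Longrightarrow> r \<le> T \<Longrightarrow> X1 p r = X1' p r"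
    "\<And>r. 0 \<le> r \<Longrightarrow> r \<le> T \<Longrightarrow> X2 p r = X2' p r" and "0 \<le> s" "s \<le> t" "t \<le> T"
  shows "germ a X1 X2 p s t = germ a' X1' X2' p s t"
proof -
  have "(LBINT r:{s..t}. a p r) = (LBINT r:{s..t}. a' p r)"
    by (rule set_lebesgue_integral_cong) (use assms in auto)
  then show ?thesis using assms by (simp add: germ_def)
qed

text \<open>
  By Chen's relation the defect of the germ is
  \<open>- (X1\<^sub>u - X1\<^sub>s - \<delta>Y\<^bsub>s,u\<^esub> v* X2\<^sub>s) \<cdot> \<delta>Y\<^bsub>u,t\<^esub> - (X2\<^sub>u - X2\<^sub>s) : YY\<^bsub>u,t\<^esub>\<close>, of order
  \<open>2 \<alpha> + \<alpha>\<close> and \<open>\<alpha> + 2 \<alpha>\<close> respectively.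
\<close>

lemma germ_defect:
  assumes "integrable_drift P a" "controlled P X1 X2"
  obtains C where "0 \<le> C" "\<And>p s u t. p \<in> P \<Longrightarrow> 0 \<le> s \<Longrightarrow> s \<le> u \<Longrightarrow> u \<le> t \<Longrightarrow> t \<le> T \<Longrightarrow>
    \<bar>germ a X1 X2 p s t - germ a X1 X2 p s u - germ a X1 X2 p u t\<bar> \<le> C * (t - s) powr (3 * \<alpha>)"
proof -
  obtain C1 where C1: "0 \<le> C1" "\<And>p s t. p \<in> P \<Longrightarrow> 0 \<le> s \<Longrightarrow> s \<le> t \<Longrightarrow> t \<le> T \<Longrightarrow>
      norm (X1 p t - X1 p s - dY s t v* X2 p s) \<le> C1 * (t - s) powr (2 * \<alpha>)"
    by (rule unif_bigoE[OF controlledD(4)[OF assms(2)]]) blast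
  obtain C2 where C2: "0 \<le> C2" "\<And>p s t. p \<in> P \<Longrightarrow> 0 \<le> s \<Longrightarrow> s \<le> t \<Longrightarrow> t \<le> T \<Longrightarrow>
      norm (X2 p t - X2 p s) \<le> C2 * (t - s) powr \<alpha>"
    by (rule unif_bigoE[OF controlledD(3)[OF assms(2)]]) blast
  obtain D1 where D1: "0 \<le> D1" "\<And>s t. 0 \<le> s \<Longrightarrow> s \<le> t \<Longrightarrow> t \<le> T \<Longrightarrow> norm (dY s t) \<le> D1 * (t - s) powr \<alpha>"
    by (rule unif_bigoE[OF dY_bigo[of "{()}"]]) auto
  obtain D2 where D2: "0 \<le> D2" "\<And>s t. 0 \<le> s \<Longrightarrow> s \<le> t \<Longrightarrow> t \<le> T \<Longrightarrow> norm (YY s t) \<le> D2 * (t - s) powr (2 * \<alpha>)"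
    by (rule unif_bigoE[OF YY_bigo[of "{()}"]]) auto
  have "\<bar>germ a X1 X2 p s t - germ a X1 X2 p s u - germ a X1 X2 p u t\<bar>
      \<le> (C1 * D1 + C2 * D2) * (t - s) powr (3 * \<alpha>)"
    if st: "p \<in> P" "0 \<le> s" "s \<le> u" "u \<le> t" "t \<le> T" for p s u t
  proof -
    have split: "(LBINT r:{s..t}. a p r) = (LBINT r:{s..u}. a p r) + (LBINT r:{u..t}. a p r)"
      by (rule set_integral_split) (use assms st in \<open>auto simp: integrable_drift_def\<close>)
    have eq: "germ a X1 X2 p s t - germ a X1 X2 p s u - germ a X1 X2 p u t
      = - ((X1 p u - X1 p s - dY s u v* X2 p s) \<bullet> dY u t) - (X2 p u - X2 p s) \<bullet> YY u t"
      unfolding germ_def split chen[OF st(2-5)] dY_add[of s t u]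
      by (simp add: inner_add_right inner_diff_left inner_outer)
    have "\<bar>(X1 p u - X1 p s - dY s u v* X2 p s) \<bullet> dY u t\<bar>
        \<le> norm (X1 p u - X1 p s - dY s u v* X2 p s) * norm (dY u t)" by (rule Cauchy_Schwarz_ineq2)
    also have "\<dots> \<le> (C1 * (t - s) powr (2 * \<alpha>)) * (D1 * (t - s) powr \<alpha>)"
    proof (rule mult_mono)
      have "norm (X1 p u - X1 p s - dY s u v* X2 p s) \<le> C1 * (u - s) powr (2 * \<alpha>)"
        using C1 st by simp
      also have "\<dots> \<le> C1 * (t - s) powr (2 * \<alpha>)"
        using C1 st alpha_gt by (intro mult_left_mono powr_mono2) auto
      finally show "norm (X1 p u - X1 p s - dY s u v* X2 p s) \<le> C1 * (t - s) powr (2 * \<alpha>)" .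
      have "norm (dY u t) \<le> D1 * (t - u) powr \<alpha>" using D1 st by simp
      also have "\<dots> \<le> D1 * (t - s) powr \<alpha>"
        using D1 st alpha_gt by (intro mult_left_mono powr_mono2) auto
      finally show "norm (dY u t) \<le> D1 * (t - s) powr \<alpha>" .
    qed (use C1 in auto)
    also have "\<dots> = C1 * D1 * ((t - s) powr (2 * \<alpha>) * (t - s) powr \<alpha>)" by simp
    also have "(t - s) powr (2 * \<alpha>) * (t - s) powr \<alpha> = (t - s) powr (3 * \<alpha>)" by (simp flip: powr_add)
    finally have 1: "\<bar>(X1 p u - X1 p s - dY s u v* X2 p s) \<bullet> dY u t\<bar> \<le> C1 * D1 * (t - s) powr (3 * \<alpha>)" .
    have "\<bar>(X2 p u - X2 p s) \<bullet> YY u t\<bar> \<le> norm (X2 p u - X2 p s) * norm (YY u t)"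
      by (rule Cauchy_Schwarz_ineq2)
    also have "\<dots> \<le> (C2 * (t - s) powr \<alpha>) * (D2 * (t - s) powr (2 * \<alpha>))"
    proof (rule mult_mono)
      have "norm (X2 p u - X2 p s) \<le> C2 * (u - s) powr \<alpha>" using C2 st by simp
      also have "\<dots> \<le> C2 * (t - s) powr \<alpha>"
        using C2 st alpha_gt by (intro mult_left_mono powr_mono2) auto
      finally show "norm (X2 p u - X2 p s) \<le> C2 * (t - s) powr \<alpha>" .
      have "norm (YY u t) \<le> D2 * (t - u) powr (2 * \<alpha>)" using D2 st by simp
      also have "\<dots> \<le> D2 * (t - s) powr (2 * \<alpha>)"
        using D2 st alpha_gt by (intro mult_left_mono powr_mono2) auto
      finally show "norm (YY u t) \<le> D2 * (t - s) powr (2 * \<alpha>)" .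
    qed (use C2 in auto)
    also have "\<dots> = C2 * D2 * ((t - s) powr \<alpha> * (t - s) powr (2 * \<alpha>))" by simp
    also have "(t - s) powr \<alpha> * (t - s) powr (2 * \<alpha>) = (t - s) powr (3 * \<alpha>)" by (simp flip: powr_add)
    finally have 2: "\<bar>(X2 p u - X2 p s) \<bullet> YY u t\<bar> \<le> C2 * D2 * (t - s) powr (3 * \<alpha>)" .
    show ?thesis unfolding eq distrib_right using 1 2 by linarith
  qed
  moreover have "0 \<le> C1 * D1 + C2 * D2" using C1(1) C2(1) D1(1) D2(1) by simp
  ultimately show ?thesis using that by blast
qed

text \<open>
  The exponent \<open>3 \<alpha> > 1\<close> makes \<open>X\<close> unique up to its initial value.
\<close>

definition rough_ito where
  "rough_ito P X a X1 X2 \<longleftrightarrow> unif_bdd T P X \<and> integrable_drift P a \<and> controlled P X1 X2 \<and>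
     unif_bigo T P (3 * \<alpha>) (\<lambda>p s t. X p t - X p s - germ a X1 X2 p s t)"

lemma rough_ito_first_order:
  assumes "rough_ito P X a X1 X2"
  shows "unif_bigo T P (2 * \<alpha>) (\<lambda>p s t. X p t - X p s - X1 p s \<bullet> dY s t)"
proof -
  have 1: "unif_bigo T P (2 * \<alpha>) (\<lambda>p s t. X p t - X p s - germ a X1 X2 p s t)"
    by (rule unif_bigo_mono[of _ _ "3 * \<alpha>"]) (use assms alpha_gt in \<open>auto simp: rough_ito_def\<close>)
  have 2: "unif_bigo T P (2 * \<alpha>) (\<lambda>p s t. LBINT r:{s..t}. a p r)"
    by (rule unif_bigo_mono[OF drift_bigo]) (use assms alpha_le in \<open>auto simp: rough_ito_def integrable_drift_def\<close>)
  have 3: "unif_bigo T P (2 * \<alpha>) (\<lambda>p s t. X2 p s \<bullet> YY s t)"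
    by (rule unif_bigo_bdd_bilinear[OF bounded_bilinear_inner _ YY_bigo])
      (use assms in \<open>auto simp: rough_ito_def controlled_def\<close>)
  show ?thesis by (rule unif_bigo_cong[OF unif_bigo_add[OF 1 unif_bigo_add[OF 2 3]]]) (simp add: germ_def)
qed

lemma rough_ito_incr:
  assumes "rough_ito P X a X1 X2"
  shows "unif_bigo T P \<alpha> (\<lambda>p s t. X p t - X p s)"
proof -
  have 1: "unif_bigo T P \<alpha> (\<lambda>p s t. X p t - X p s - X1 p s \<bullet> dY s t)"
    by (rule unif_bigo_mono[OF rough_ito_first_order[OF assms]]) (use alpha_gt in simp)
  have 2: "unif_bigo T P \<alpha> (\<lambda>p s t. X1 p s \<bullet> dY s t)"
    by (rule unif_bigo_bdd_bilinear[OF bounded_bilinear_inner _ dY_bigo])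
      (use assms in \<open>auto simp: rough_ito_def controlled_def\<close>)
  show ?thesis by (rule unif_bigo_cong[OF unif_bigo_add[OF 1 2]]) simp
qed

lemma rough_itoD:
  assumes "rough_ito P X a X1 X2"
  shows "unif_bdd T P X" "integrable_drift P a" "controlled P X1 X2"
    "unif_bigo T P (3 * \<alpha>) (\<lambda>p s t. X p t - X p s - germ a X1 X2 p s t)"
    "scalar_controlled P X X1" "unif_bigo T P \<alpha> (\<lambda>p s t. X p t - X p s)"
  using assms rough_ito_first_order[OF assms] controlledD(1)[of P X1 X2] controlled_incr[of P X1 X2]
    rough_ito_incr[OF assms]
  by (auto simp: rough_ito_def scalar_controlled_def)

text \<open>
  A remainder that is \<open>o(|t-s|)\<close> for each parameter separately is of order \<open>3 \<alpha>\<close> uniformly, as its defect is that of the germ.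
\<close>

lemma rough_ito_of_small_o:
  assumes "unif_bdd T P X" "integrable_drift P a" "controlled P X1 X2"
    and "\<And>p. p \<in> P \<Longrightarrow> small_o_incr T (\<lambda>s t. X p t - X p s - germ a X1 X2 p s t)"
  shows "rough_ito P X a X1 X2"
proof -
  obtain C where C: "0 \<le> C" "\<And>p s u t. p \<in> P \<Longrightarrow> 0 \<le> s \<Longrightarrow> s \<le> u \<Longrightarrow> u \<le> t \<Longrightarrow> t \<le> T \<Longrightarrow>
    \<bar>germ a X1 X2 p s t - germ a X1 X2 p s u - germ a X1 X2 p u t\<bar> \<le> C * (t - s) powr (3 * \<alpha>)"
    by (rule germ_defect[OF assms(2,3)]) blast
  have "unif_bigo T P (3 * \<alpha>) (\<lambda>p s t. X p t - X p s - germ a X1 X2 p s t)"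
  proof (rule unif_bigoI)
    fix p s t assume st: "p \<in> P" "0 \<le> s" "s \<le> t" "t \<le> T"
    have "\<bar>X p t - X p s - germ a X1 X2 p s t\<bar> \<le> C / (1 - 2 powr (1 - 3 * \<alpha>)) * (t - s) powr (3 * \<alpha>)"
    proof (rule sewing_bound[where T = T, OF C(1) _ assms(4)[OF st(1)]])
      fix s u t assume u: "0 \<le> s" "s \<le> u" "u \<le> t" "t \<le> T"
      show "\<bar>X p t - X p s - germ a X1 X2 p s t - (X p u - X p s - germ a X1 X2 p s u) -
          (X p t - X p u - germ a X1 X2 p u t)\<bar> \<le> C * (t - s) powr (3 * \<alpha>)"
        using C(2)[OF st(1) u] by linarith
    qed (use st alpha_gt in auto)
    then show "norm (X p t - X p s - germ a X1 X2 p s t)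
        \<le> C / (1 - 2 powr (1 - 3 * \<alpha>)) * (t - s) powr (3 * \<alpha>)" by simp
  qed
  with assms show ?thesis by (simp add: rough_ito_def)
qed

lemma rough_integral_exists:
  assumes "integrable_drift {p} a" "controlled {p} X1 X2"
  obtains I where "I 0 = 0" "rough_ito {p} (\<lambda>_. I) a X1 X2"
proof -
  obtain C where C: "0 \<le> C" "\<And>s u t. 0 \<le> s \<Longrightarrow> s \<le> u \<Longrightarrow> u \<le> t \<Longrightarrow> t \<le> T \<Longrightarrow>
    \<bar>germ a X1 X2 p s t - germ a X1 X2 p s u - germ a X1 X2 p u t\<bar> \<le> C * (t - s) powr (3 * \<alpha>)"
    by (rule germ_defect[OF assms]) blast
  have "1 < 3 * \<alpha>" using alpha_gt by simp
  have "\<exists>I K. 0 \<le> K \<and> I 0 = 0 \<and> (\<forall>s t. 0 \<le> s \<longrightarrow> s \<le> t \<longrightarrow> t \<le> T \<longrightarrow>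
      \<bar>I t - I s - germ a X1 X2 p s t\<bar> \<le> K * (t - s) powr (3 * \<alpha>))"
    by (rule sewing[OF T_pos C(1) \<open>1 < 3 * \<alpha>\<close>]) (rule C(2))
  then obtain I K where "0 \<le> K \<and> I 0 = 0 \<and> (\<forall>s t. 0 \<le> s \<longrightarrow> s \<le> t \<longrightarrow> t \<le> T \<longrightarrow>
      \<bar>I t - I s - germ a X1 X2 p s t\<bar> \<le> K * (t - s) powr (3 * \<alpha>))"
    by (elim exE)
  then have I: "0 \<le> K" "I 0 = 0" "\<And>s t. 0 \<le> s \<Longrightarrow> s \<le> t \<Longrightarrow> t \<le> T \<Longrightarrow>
      \<bar>I t - I s - germ a X1 X2 p s t\<bar> \<le> K * (t - s) powr (3 * \<alpha>)"
    by auto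
  have big: "unif_bigo T {p} (3 * \<alpha>) (\<lambda>_ s t. I t - I s - germ a X1 X2 p s t)"
    by (rule unif_bigoI[of _ _ _ K]) (use I in auto)
  have g: "unif_bigo T {p} \<alpha> (germ a X1 X2)"
    unfolding germ_def
  proof (intro unif_bigo_add)
    show "unif_bigo T {p} \<alpha> (\<lambda>p s t. LBINT r:{s..t}. a p r)"
      by (rule unif_bigo_mono[OF drift_bigo]) (use assms alpha_le in \<open>auto simp: integrable_drift_def\<close>)
    show "unif_bigo T {p} \<alpha> (\<lambda>p s t. X1 p s \<bullet> dY s t)"
      by (rule unif_bigo_bdd_bilinear[OF bounded_bilinear_inner _ dY_bigo])
        (use assms in \<open>auto simp: controlled_def\<close>)
    show "unif_bigo T {p} \<alpha> (\<lambda>p s t. X2 p s \<bullet> YY s t)"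
      by (rule unif_bigo_mono[OF unif_bigo_bdd_bilinear[OF bounded_bilinear_inner _ YY_bigo]])
        (use assms alpha_gt in \<open>auto simp: controlled_def\<close>)
  qed
  have inc: "unif_bigo T {p} \<alpha> (\<lambda>_ s t. I t - I s)"
    by (rule unif_bigo_cong[OF unif_bigo_add[OF unif_bigo_mono[OF big] g]]) (use alpha_gt in auto)
  have "continuous_on {0..T} I"
    by (rule continuous_on_of_unif_bigo[OF inc]) (use alpha_gt in auto)
  then have "bounded (I ` {0..T})" by (intro compact_imp_bounded compact_continuous_image) auto
  then obtain M where "\<forall>x\<in>I ` {0..T}. norm x \<le> M" unfolding bounded_iff by blast
  then have "unif_bdd T {p} (\<lambda>_. I)" by (intro unif_bddI[of _ _ _ M]) auto
  moreover have "unif_bigo T {p} (3 * \<alpha>) (\<lambda>q s t. I t - I s - germ a X1 X2 q s t)"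
    by (rule unif_bigo_cong[OF big]) auto
  ultimately have "rough_ito {p} (\<lambda>_. I) a X1 X2" using assms by (simp add: rough_ito_def)
  with I(2) show ?thesis by (rule that[of I])
qed

lemma rough_ito_cong:
  assumes "rough_ito P X a X1 X2"
    and X: "\<And>p t. p \<in> P \<Longrightarrow> 0 \<le> t \<Longrightarrow> t \<le> T \<Longrightarrow> X' p t = X p t"
    and a: "\<And>p t. p \<in> P \<Longrightarrow> 0 \<le> t \<Longrightarrow> t \<le> T \<Longrightarrow> a' p t = a p t"
    and X1: "\<And>p t. p \<in> P \<Longrightarrow> 0 \<le> t \<Longrightarrow> t \<le> T \<Longrightarrow> X1' p t = X1 p t"
    and X2: "\<And>p t. p \<in> P \<Longrightarrow> 0 \<le> t \<Longrightarrow> t \<le> T \<Longrightarrow> X2' p t = X2 p t"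
  shows "rough_ito P X' a' X1' X2'"
proof -
  note A = rough_itoD[OF assms(1)]
  note C = controlledD[OF A(3)] and D = integrable_driftD[OF A(2)]
  have "unif_bdd T P X'" by (rule unif_bdd_cong[OF A(1) X])
  moreover have "integrable_drift P a'"
    unfolding integrable_drift_def
  proof (intro conjI ballI)
    show "unif_bdd T P a'" by (rule unif_bdd_cong[OF D(1) a])
    fix p assume p: "p \<in> P"
    have "set_integrable lborel {0..T} (a' p) = set_integrable lborel {0..T} (a p)"
      by (rule set_integrable_cong) (use a p in auto)
    then show "set_integrable lborel {0..T} (a' p)" using D(2)[OF p] by simp
  qed
  moreover have "controlled P X1' X2'"
    unfolding controlled_def
  proof (intro conjI)
    show "unif_bdd T P X1'" by (rule unif_bdd_cong[OF C(1) X1])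
    show "unif_bdd T P X2'" by (rule unif_bdd_cong[OF C(2) X2])
    show "unif_bigo T P \<alpha> (\<lambda>p s t. X2' p t - X2' p s)" by (rule unif_bigo_cong[OF C(3)]) (simp add: X2)
    show "unif_bigo T P (2 * \<alpha>) (\<lambda>p s t. X1' p t - X1' p s - dY s t v* X2' p s)"
      by (rule unif_bigo_cong[OF C(4)]) (simp add: X1 X2)
  qed
  moreover have "unif_bigo T P (3 * \<alpha>) (\<lambda>p s t. X' p t - X' p s - germ a' X1' X2' p s t)"
  proof (rule unif_bigo_cong[OF A(4)])
    fix p s t assume st: "p \<in> P" "0 \<le> s" "s \<le> t" "t \<le> T"
    have "germ a' X1' X2' p s t = germ a X1 X2 p s t"
      by (rule germ_cong) (use st a X1 X2 in auto)
    then show "X' p t - X' p s - germ a' X1' X2' p s t = X p t - X p s - germ a X1 X2 p s t"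
      using st by (simp add: X)
  qed
  ultimately show ?thesis by (simp add: rough_ito_def)
qed

lemma rough_ito_reindex:
  assumes "rough_ito Q X a X1 X2" and g: "\<And>p. p \<in> P \<Longrightarrow> g p \<in> Q"
  shows "rough_ito P (\<lambda>p. X (g p)) (\<lambda>p. a (g p)) (\<lambda>p. X1 (g p)) (\<lambda>p. X2 (g p))"
proof -
  note A = rough_itoD[OF assms(1)]
  note C = controlledD[OF A(3)] and D = integrable_driftD[OF A(2)]
  have "integrable_drift P (\<lambda>p. a (g p))"
    using unif_bdd_reindex[OF D(1) g] D(2) g by (simp add: integrable_drift_def)
  moreover have "controlled P (\<lambda>p. X1 (g p)) (\<lambda>p. X2 (g p))"
    unfolding controlled_def
    by (intro conjI unif_bdd_reindex[OF C(1)] unif_bdd_reindex[OF C(2)] unif_bigo_reindex[OF C(3)]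
      unif_bigo_reindex[OF C(4)] g)
  moreover have "unif_bigo T P (3 * \<alpha>) (\<lambda>p s t. X (g p) t - X (g p) s
      - germ (\<lambda>p. a (g p)) (\<lambda>p. X1 (g p)) (\<lambda>p. X2 (g p)) p s t)"
    by (rule unif_bigo_cong[OF unif_bigo_reindex[OF A(4) g]]) (simp_all add: germ_def)
  ultimately show ?thesis using unif_bdd_reindex[OF A(1) g] by (simp add: rough_ito_def)
qed

text \<open>
  The difference of the two processes has increments of order \<open>3 \<alpha> > 1\<close>.
\<close>

lemma rough_ito_unique:
  assumes "rough_ito {p} (\<lambda>_. X) a X1 X2" "rough_ito {p} (\<lambda>_. X') a X1 X2" "X 0 = X' 0" "0 \<le> t" "t \<le> T"
  shows "X t = X' t"
proof -
  have "unif_bigo T {p} (3 * \<alpha>) (\<lambda>_ s t. (X t - X' t) - (X s - X' s))"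
    by (rule unif_bigo_cong[OF unif_bigo_diff[OF rough_itoD(4)[OF assms(1)] rough_itoD(4)[OF assms(2)]]]) simp
  then have "X t - X' t = X 0 - X' 0"
    by (rule constant_of_unif_bigo_incr) (use assms alpha_gt in auto)
  then show ?thesis using assms(3) by simp
qed

subsection \<open>The product rule and the change of variables formula\<close>


text \<open>
  Expand \<open>\<delta>(Z X) = Z\<^sub>s \<delta>X + X\<^sub>s \<delta>Z + \<delta>Z \<delta>X\<close>. Up to order \<open>3 \<alpha>\<close> the last term is
  \<open>(Z1\<^sub>s \<cdot> \<delta>Y) (X1\<^sub>s \<cdot> \<delta>Y)\<close>, which splits into second order terms and the bracket correction of the drift.
\<close>

lemma rough_ito_prod:
  assumes Z: "rough_ito P Z b Z1 Z2" and X: "rough_ito P X a X1 X2"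
  shows "rough_ito P (\<lambda>p t. Z p t * X p t)
    (\<lambda>p t. Z p t * a p t + X p t * b p t + outer (Z1 p t) (X1 p t) \<bullet> B t)
    (\<lambda>p t. Z p t *\<^sub>R X1 p t + X p t *\<^sub>R Z1 p t)
    (\<lambda>p t. (Z p t *\<^sub>R X2 p t + outer (Z1 p t) (X1 p t)) + (X p t *\<^sub>R Z2 p t + outer (X1 p t) (Z1 p t)))"
    (is "rough_ito P ?ZX ?c ?ZX1 ?ZX2")
proof -
  note Z' = rough_itoD[OF Z] and X' = rough_itoD[OF X]
  have \<alpha>: "0 \<le> \<alpha>" using alpha_gt by simp
  have W: "unif_bdd T P (\<lambda>p t. outer (Z1 p t) (X1 p t))"
    "unif_bigo T P \<alpha> (\<lambda>p s t. outer (Z1 p t) (X1 p t) - outer (Z1 p s) (X1 p s))"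
    by (rule unif_bdd_bilinear[OF bounded_bilinear_outer controlledD(1)[OF Z'(3)] controlledD(1)[OF X'(3)]])
      (rule unif_bigo_incr_bilinear[OF bounded_bilinear_outer controlledD(1)[OF Z'(3)] controlled_incr[OF Z'(3)]
        controlledD(1)[OF X'(3)] controlled_incr[OF X'(3)] \<alpha>])
  have i: "integrable_drift P (\<lambda>p t. Z p t * a p t)" "integrable_drift P (\<lambda>p t. X p t * b p t)"
    "integrable_drift P (\<lambda>p t. outer (Z1 p t) (X1 p t) \<bullet> B t)"
    by (rule integrable_drift_mult[OF Z'(1,6) X'(2)] integrable_drift_mult[OF X'(1,6) Z'(2)]
      integrable_drift_bracket[OF W])+
  have "unif_bdd T P ?ZX" by (rule unif_bdd_bilinear[OF bounded_bilinear_mult Z'(1) X'(1)])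
  moreover have "integrable_drift P ?c" by (intro integrable_drift_add i)
  moreover have "controlled P ?ZX1 ?ZX2"
    by (intro controlled_add controlled_scaleR Z' X')
  moreover have "unif_bigo T P (3 * \<alpha>) (\<lambda>p s t. ?ZX p t - ?ZX p s - germ ?c ?ZX1 ?ZX2 p s t)"
  proof -
    \<comment> \<open>The remainder is a sum of seven errors: the remainders of the two factors, those of
      \<open>\<delta>Z \<delta>X - (Z1\<^sub>s \<cdot> \<delta>Y) (X1\<^sub>s \<cdot> \<delta>Y)\<close>, split into two products, and three for freezing a drift.\<close>
    have 1: "unif_bigo T P (3 * \<alpha>) (\<lambda>p s t. Z p s * (X p t - X p s - germ a X1 X2 p s t))"
      by (rule unif_bigo_bdd_bilinear[OF bounded_bilinear_mult Z'(1) X'(4)])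
    have 2: "unif_bigo T P (3 * \<alpha>) (\<lambda>p s t. X p s * (Z p t - Z p s - germ b Z1 Z2 p s t))"
      by (rule unif_bigo_bdd_bilinear[OF bounded_bilinear_mult X'(1) Z'(4)])
    have 3: "unif_bigo T P (3 * \<alpha>) (\<lambda>p s t. (Z p t - Z p s - Z1 p s \<bullet> dY s t) * (X p t - X p s))"
      using unif_bigo_bilinear[OF bounded_bilinear_mult scalar_controlledD(4)[OF Z'(5)] X'(6)] by simp
    have Z1dY: "unif_bigo T P \<alpha> (\<lambda>p s t. Z1 p s \<bullet> dY s t)"
      by (rule unif_bigo_bdd_bilinear[OF bounded_bilinear_inner controlledD(1)[OF Z'(3)] dY_bigo])
    have 4: "unif_bigo T P (3 * \<alpha>) (\<lambda>p s t. (Z1 p s \<bullet> dY s t) * (X p t - X p s - X1 p s \<bullet> dY s t))"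
      using unif_bigo_bilinear[OF bounded_bilinear_mult Z1dY scalar_controlledD(4)[OF X'(5)]] by simp
    note 5 = drift_frozen_3\<alpha>[OF Z'(6) X'(2)] and 6 = drift_frozen_3\<alpha>[OF X'(6) Z'(2)]
      and 7 = bracket_drift_frozen[OF W(2)]
    note all = unif_bigo_diff[OF unif_bigo_diff[OF unif_bigo_diff[OF
      unif_bigo_add[OF unif_bigo_add[OF unif_bigo_add[OF 1 2] 3] 4] 5] 6] 7]
    show ?thesis
    proof (rule unif_bigo_cong[OF all], goal_cases)
      case st: (1 p s t)
      have int: "(LBINT r:{s..t}. ?c p r) = (LBINT r:{s..t}. Z p r * a p r) + (LBINT r:{s..t}. X p r * b p r)
          + (LBINT r:{s..t}. outer (Z1 p r) (X1 p r) \<bullet> B r)"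
        using st by (subst set_integral_add; (subst set_integral_add)?)
          (auto intro!: set_integral_add integrable_driftD(3)[OF i(1)] integrable_driftD(3)[OF i(2)]
            integrable_driftD(3)[OF i(3)])
      have sq: "(Z1 p s \<bullet> dY s t) * (X1 p s \<bullet> dY s t) = (outer (Z1 p s) (X1 p s) + outer (X1 p s) (Z1 p s)) \<bullet> YY s t
          + outer (Z1 p s) (X1 p s) \<bullet> bracket_incr Y s t"
        by (rule outer_inner_square)
      show ?case
        unfolding germ_def int using sq by (simp add: inner_add_left) algebra
    qed
  qed
  ultimately show ?thesis by (simp add: rough_ito_def)
qed

lemma scalar_controlled_comp:
  assumes X: "scalar_controlled P X X1" and D: "C3_on S D K" and i: "i \<le> 1"
    and S: "\<And>p t. p \<in> P \<Longrightarrow> 0 \<le> t \<Longrightarrow> t \<le> T \<Longrightarrow> X p t \<in> S"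
  shows "scalar_controlled P (\<lambda>p t. D i (X p t)) (\<lambda>p t. D (Suc i) (X p t) *\<^sub>R X1 p t)"
proof -
  note X' = scalar_controlledD[OF X] scalar_controlled_incr[OF X]
  have K: "0 \<le> K" using D by (simp add: C3_on_def)
  have bd: "unif_bdd T P (\<lambda>p t. D j (X p t))" if "j \<le> 2" for j
    by (rule unif_bddI[of _ _ _ K]) (use D S that in \<open>auto simp: C3_on_def\<close>)
  have inc: "unif_bigo T P \<alpha> (\<lambda>p s t. D j (X p t) - D j (X p s))" if "j \<le> 2" for j
    by (rule unif_bigo_le[OF X'(5) K]) (use C3_on_taylor(1)[OF D S S] that in auto)
  have 1: "unif_bigo T P (2 * \<alpha>) (\<lambda>p s t. (X p t - X p s) * (X p t - X p s))"
    using unif_bigo_bilinear[OF bounded_bilinear_mult X'(5) X'(5)] by simp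
  have 2: "unif_bigo T P (2 * \<alpha>) (\<lambda>p s t. D i (X p t) - D i (X p s) - D (Suc i) (X p s) * (X p t - X p s))"
    by (rule unif_bigo_le[OF 1 K]) (use C3_on_taylor(2)[OF D S S i] in \<open>auto simp: power2_eq_square abs_mult\<close>)
  have 3: "unif_bigo T P (2 * \<alpha>) (\<lambda>p s t. D (Suc i) (X p s) * (X p t - X p s - X1 p s \<bullet> dY s t))"
    by (rule unif_bigo_bdd_bilinear[OF bounded_bilinear_mult bd X'(4)]) (use i in simp)
  have "unif_bigo T P (2 * \<alpha>) (\<lambda>p s t. D i (X p t) - D i (X p s) - (D (Suc i) (X p s) *\<^sub>R X1 p s) \<bullet> dY s t)"
    by (rule unif_bigo_cong[OF unif_bigo_add[OF 2 3]]) (simp add: algebra_simps)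
  moreover have "unif_bdd T P (\<lambda>p t. D (Suc i) (X p t) *\<^sub>R X1 p t)"
    by (rule unif_bdd_bilinear[OF bounded_bilinear_scaleR bd X'(2)]) (use i in simp)
  moreover have "unif_bigo T P \<alpha> (\<lambda>p s t. D (Suc i) (X p t) *\<^sub>R X1 p t - D (Suc i) (X p s) *\<^sub>R X1 p s)"
    by (rule unif_bigo_incr_bilinear[OF bounded_bilinear_scaleR bd inc X'(2,3)]) (use i alpha_gt in auto)
  ultimately show ?thesis using bd[of i] i by (simp add: scalar_controlled_def)
qed

text \<open>
  Ito formula: the second order Taylor term produces \<open>D 2 (X) / 2\<close> times the square of \<open>X1\<^sub>s \<cdot> \<delta>Y\<close>, and the
  third order one is \<open>O(|t - s|\<^bsup>3\<alpha>\<^esup>)\<close>.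
\<close>

lemma rough_ito_comp:
  assumes X: "rough_ito P X a X1 X2" and D: "C3_on S D K"
    and S: "\<And>p t. p \<in> P \<Longrightarrow> 0 \<le> t \<Longrightarrow> t \<le> T \<Longrightarrow> X p t \<in> S"
  shows "rough_ito P (\<lambda>p t. D 0 (X p t))
    (\<lambda>p t. D 1 (X p t) * a p t + ((D 2 (X p t) / 2) *\<^sub>R outer (X1 p t) (X1 p t)) \<bullet> B t)
    (\<lambda>p t. D 1 (X p t) *\<^sub>R X1 p t)
    (\<lambda>p t. D 1 (X p t) *\<^sub>R X2 p t + outer (D 2 (X p t) *\<^sub>R X1 p t) (X1 p t))"
    (is "rough_ito P ?F ?c ?F1 ?F2")
proof -
  note X' = rough_itoD[OF X]
  have \<alpha>: "0 \<le> \<alpha>" using alpha_gt by simp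
  have K: "0 \<le> K" using D by (simp add: C3_on_def)
  have D1: "scalar_controlled P (\<lambda>p t. D 1 (X p t)) (\<lambda>p t. D 2 (X p t) *\<^sub>R X1 p t)"
    using scalar_controlled_comp[OF X'(5) D, of 1] S by (simp add: numeral_2_eq_2)
  have bd: "unif_bdd T P (\<lambda>p t. D j (X p t))" if "j \<le> 2" for j
    by (rule unif_bddI[of _ _ _ K]) (use D S that in \<open>auto simp: C3_on_def\<close>)
  have inc: "unif_bigo T P \<alpha> (\<lambda>p s t. D j (X p t) - D j (X p s))" if "j \<le> 2" for j
    by (rule unif_bigo_le[OF X'(6) K]) (use C3_on_taylor(1)[OF D S S] that in auto)
  have half: "unif_bdd T P (\<lambda>p t. D 2 (X p t) / 2)"
    "unif_bigo T P \<alpha> (\<lambda>p s t. D 2 (X p t) / 2 - D 2 (X p s) / 2)"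
    using unif_bdd_bilinear[OF bounded_bilinear_mult bd[of 2] unif_bdd_const[of T P "1/2"]]
      unif_bigo_le[OF inc[of 2], of 1 "\<lambda>p s t. D 2 (X p t) / 2 - D 2 (X p s) / 2"] by (auto simp: diff_divide_distrib[symmetric])
  have Wo: "unif_bdd T P (\<lambda>p t. outer (X1 p t) (X1 p t))"
    "unif_bigo T P \<alpha> (\<lambda>p s t. outer (X1 p t) (X1 p t) - outer (X1 p s) (X1 p s))"
    by (rule unif_bdd_bilinear[OF bounded_bilinear_outer controlledD(1)[OF X'(3)] controlledD(1)[OF X'(3)]])
      (rule unif_bigo_incr_bilinear[OF bounded_bilinear_outer controlledD(1)[OF X'(3)] controlled_incr[OF X'(3)]
        controlledD(1)[OF X'(3)] controlled_incr[OF X'(3)] \<alpha>])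
  have W: "unif_bdd T P (\<lambda>p t. (D 2 (X p t) / 2) *\<^sub>R outer (X1 p t) (X1 p t))"
    "unif_bigo T P \<alpha> (\<lambda>p s t. (D 2 (X p t) / 2) *\<^sub>R outer (X1 p t) (X1 p t) - (D 2 (X p s) / 2) *\<^sub>R outer (X1 p s) (X1 p s))"
    by (rule unif_bdd_bilinear[OF bounded_bilinear_scaleR half(1) Wo(1)])
      (rule unif_bigo_incr_bilinear[OF bounded_bilinear_scaleR half Wo \<alpha>])
  have i: "integrable_drift P (\<lambda>p t. D 1 (X p t) * a p t)"
    "integrable_drift P (\<lambda>p t. ((D 2 (X p t) / 2) *\<^sub>R outer (X1 p t) (X1 p t)) \<bullet> B t)"
    by (rule integrable_drift_mult[OF bd inc X'(2)]; simp) (rule integrable_drift_bracket[OF W])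
  have "unif_bdd T P ?F" by (rule bd) simp
  moreover have "integrable_drift P ?c" by (intro integrable_drift_add i)
  moreover have "controlled P ?F1 ?F2" by (rule controlled_scaleR[OF D1 X'(3)])
  moreover have "unif_bigo T P (3 * \<alpha>) (\<lambda>p s t. ?F p t - ?F p s - germ ?c ?F1 ?F2 p s t)"
  proof -
    have bd1: "unif_bdd T P (\<lambda>p t. D 1 (X p t))" by (rule bd) simp
    have inc1: "unif_bigo T P \<alpha> (\<lambda>p s t. D 1 (X p t) - D 1 (X p s))" by (rule inc) simp
    have 1: "unif_bigo T P (3 * \<alpha>) (\<lambda>p s t. D 1 (X p s) * (X p t - X p s - germ a X1 X2 p s t))"
      by (rule unif_bigo_bdd_bilinear[OF bounded_bilinear_mult bd1 X'(4)])
    have X1dY: "unif_bigo T P \<alpha> (\<lambda>p s t. X1 p s \<bullet> dY s t)"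
      by (rule unif_bigo_bdd_bilinear[OF bounded_bilinear_inner controlledD(1)[OF X'(3)] dY_bigo])
    \<comment> \<open>\<open>(\<delta>X)\<^sup>2 - (X1\<^sub>s \<cdot> \<delta>Y)\<^sup>2\<close>, written as a product of sum and difference\<close>
    have "unif_bigo T P (\<alpha> + 2 * \<alpha>) (\<lambda>p s t. (X p t - X p s + X1 p s \<bullet> dY s t) * (X p t - X p s - X1 p s \<bullet> dY s t))"
      by (rule unif_bigo_bilinear[OF bounded_bilinear_mult unif_bigo_add[OF X'(6) X1dY] scalar_controlledD(4)[OF X'(5)]])
    then have 2: "unif_bigo T P (3 * \<alpha>) (\<lambda>p s t. (D 2 (X p s) / 2) *
        ((X p t - X p s + X1 p s \<bullet> dY s t) * (X p t - X p s - X1 p s \<bullet> dY s t)))"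
      by (intro unif_bigo_bdd_bilinear[OF bounded_bilinear_mult half(1)]) simp
    have "unif_bigo T P (\<alpha> + (\<alpha> + \<alpha>)) (\<lambda>p s t. (X p t - X p s) * ((X p t - X p s) * (X p t - X p s)))"
      by (intro unif_bigo_bilinear[OF bounded_bilinear_mult] X'(6))
    then have cube: "unif_bigo T P (3 * \<alpha>) (\<lambda>p s t. (X p t - X p s) ^ 3)"
      by (simp add: power3_eq_cube mult.assoc)
    have 3: "unif_bigo T P (3 * \<alpha>) (\<lambda>p s t. D 0 (X p t) - D 0 (X p s) - D 1 (X p s) * (X p t - X p s)
        - D 2 (X p s) * (X p t - X p s)\<^sup>2 / 2)"
      by (rule unif_bigo_le[OF cube, of "K / 2"]) (use C3_on_taylor(3)[OF D S S] K in auto)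
    note 4 = drift_frozen_3\<alpha>[OF inc1 X'(2)] and 5 = bracket_drift_frozen[OF W(2)]
    note all = unif_bigo_diff[OF unif_bigo_diff[OF unif_bigo_add[OF unif_bigo_add[OF 1 2] 3] 4] 5]
    show ?thesis
    proof (rule unif_bigo_cong[OF all], goal_cases)
      case st: (1 p s t)
      have int: "(LBINT r:{s..t}. ?c p r) = (LBINT r:{s..t}. D 1 (X p r) * a p r)
          + (LBINT r:{s..t}. ((D 2 (X p r) / 2) *\<^sub>R outer (X1 p r) (X1 p r)) \<bullet> B r)"
        using st by (intro set_integral_add integrable_driftD(3)[OF i(1)] integrable_driftD(3)[OF i(2)])
      have sq: "(X1 p s \<bullet> dY s t) * (X1 p s \<bullet> dY s t) = 2 * (outer (X1 p s) (X1 p s) \<bullet> YY s t)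
          + outer (X1 p s) (X1 p s) \<bullet> bracket_incr Y s t"
        using outer_inner_square[of "X1 p s" s t "X1 p s"] unfolding inner_add_left by simp
      have o: "outer (D 2 (X p s) *\<^sub>R X1 p s) (X1 p s) \<bullet> YY s t = D 2 (X p s) * (outer (X1 p s) (X1 p s) \<bullet> YY s t)"
        by (simp add: bounded_bilinear.scaleR_left[OF bounded_bilinear_outer])
      show ?case
        unfolding germ_def int unfolding inner_add_left o inner_scaleR_left using sq by algebra
    qed
  qed
  ultimately show ?thesis by (simp add: rough_ito_def)
qed

text \<open>
  Only \<open>k = 1\<close> and \<open>k = -1\<close> occur: \<open>exp L\<close> is the total mass and \<open>exp (- L)\<close> the normalising factor.
\<close>

lemma rough_ito_exp:
  assumes L: "rough_ito P L a L1 L2" and k: "\<bar>k\<bar> = 1"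
  shows "rough_ito P (\<lambda>p t. exp (k * L p t))
    (\<lambda>p t. k * exp (k * L p t) * a p t + ((exp (k * L p t) / 2) *\<^sub>R outer (L1 p t) (L1 p t)) \<bullet> B t)
    (\<lambda>p t. (k * exp (k * L p t)) *\<^sub>R L1 p t)
    (\<lambda>p t. (k * exp (k * L p t)) *\<^sub>R L2 p t + exp (k * L p t) *\<^sub>R outer (L1 p t) (L1 p t))"
proof -
  obtain u where u: "0 \<le> u" "\<And>p t. p \<in> P \<Longrightarrow> 0 \<le> t \<Longrightarrow> t \<le> T \<Longrightarrow> norm (L p t) \<le> u"
    by (rule unif_bddE[OF rough_itoD(1)[OF L]]) blast
  have k2: "k\<^sup>2 = 1" using k by (metis one_power2 power2_abs)
  have "L p t \<in> {-u..u}" if "p \<in> P" "0 \<le> t" "t \<le> T" for p t using u(2)[OF that] by auto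
  from rough_ito_comp[OF L C3_on_exp[OF k u(1)] this]
  show ?thesis
    by (simp add: k2 bounded_bilinear.scaleR_left[OF bounded_bilinear_outer])
qed

lemma rough_ito_ln:
  assumes X: "rough_ito {p} (\<lambda>_. X) a X1 X2" and pos: "\<And>t. 0 \<le> t \<Longrightarrow> t \<le> T \<Longrightarrow> 0 < X t"
  shows "rough_ito {p} (\<lambda>_ t. ln (X t))
    (\<lambda>q t. 1 / X t * a q t + ((- 1 / (X t)\<^sup>2 / 2) *\<^sub>R outer (X1 q t) (X1 q t)) \<bullet> B t)
    (\<lambda>q t. (1 / X t) *\<^sub>R X1 q t)
    (\<lambda>q t. (1 / X t) *\<^sub>R X2 q t + outer ((- 1 / (X t)\<^sup>2) *\<^sub>R X1 q t) (X1 q t))"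
proof -
  have c: "continuous_on {0..T} X"
    by (rule continuous_on_of_unif_bigo[OF rough_itoD(6)[OF X]]) (use alpha_gt in auto)
  have ne: "{0..T} \<noteq> {}" using T_pos by simp
  obtain t0 where t0: "t0 \<in> {0..T}" "\<forall>t\<in>{0..T}. X t0 \<le> X t"
    using continuous_attains_inf[OF compact_Icc ne c] by blast
  obtain t1 where t1: "t1 \<in> {0..T}" "\<forall>t\<in>{0..T}. X t \<le> X t1"
    using continuous_attains_sup[OF compact_Icc ne c] by blast
  have "0 < X t0" using pos t0 by simp
  then obtain K where K: "C3_on {X t0..X t1} ln_derivs K" by (rule C3_on_ln)
  have "(\<lambda>_. X) p t \<in> {X t0..X t1}" if "0 \<le> t" "t \<le> T" for p t using t0 t1 that by simp
  from rough_ito_comp[OF X K this]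
  show ?thesis by (simp add: ln_derivs_def)
qed

end


section \<open>Curves of measures\<close>


text \<open>
  If \<open>f\<close> is not integrable, both sides are \<open>0\<close> by convention.
\<close>

lemma integral_scale_measure:
  fixes f :: "'a \<Rightarrow> real"
  assumes r: "0 < r"
  shows "integral\<^sup>L (scale_measure (ennreal r) M) f = r * integral\<^sup>L M f"
proof (cases "f \<in> borel_measurable M")
  case True
  have "scale_measure (ennreal r) M = density M (\<lambda>_. ennreal r)"
    by (rule measure_eqI) (simp_all add: emeasure_density_const)
  then have "integral\<^sup>L (scale_measure (ennreal r) M) f = integral\<^sup>L M (\<lambda>x. r *\<^sub>R f x)"
    using r True by (simp add: integral_density)
  then show ?thesis by simp
next
  case False
  then have "\<not> integrable M f" "\<not> integrable (scale_measure (ennreal r) M) f"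
    using borel_measurable_integrable[of M f] borel_measurable_integrable[of "scale_measure (ennreal r) M" f]
    by (auto simp: measurable_def space_scale_measure)
  then show ?thesis by (simp add: not_integrable_integral_eq)
qed

lemma scale_measure_exp_inverse:
  "scale_measure (ennreal (exp (- l))) (scale_measure (ennreal (exp l)) M) = M"
  by (simp add: ennreal_mult'[symmetric] flip: exp_add)

lemma abs_integral_le:
  fixes f :: "'a \<Rightarrow> real"
  assumes "finite_measure M" "\<And>x. \<bar>f x\<bar> \<le> K"
  shows "\<bar>integral\<^sup>L M f\<bar> \<le> K * measure M (space M)"
proof -
  interpret finite_measure M by (rule assms)
  have "\<bar>integral\<^sup>L M f\<bar> \<le> (\<integral>x. norm (f x) \<partial>M)" using integral_norm_bound[of M f] by simp
  also have "\<dots> \<le> (\<integral>x. K \<partial>M)" by (rule integral_mono') (use assms(2) order_trans[OF abs_ge_zero assms(2)] in auto)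
  finally show ?thesis by (simp add: mult.commute)
qed

lemma mass_continuous:
  "weakly_continuous T \<mu> \<Longrightarrow> continuous_on {0..T} (\<lambda>t. integral\<^sup>L (\<mu> t) (\<lambda>_. 1 :: real))"
  unfolding weakly_continuous_def by (elim conjE allE[of _ "\<lambda>_. 1"] mp) (simp add: image_constant_conv)

text \<open>
  Weak continuity bounds the total mass on the compact interval.
\<close>

lemma unif_bdd_integral:
  fixes g :: "'p \<Rightarrow> real \<Rightarrow> real^'x::finite \<Rightarrow> real"
  assumes \<mu>: "weakly_continuous T \<mu>"
    and g: "\<And>p t x. p \<in> P \<Longrightarrow> 0 \<le> t \<Longrightarrow> t \<le> T \<Longrightarrow> \<bar>g p t x\<bar> \<le> K"
  shows "unif_bdd T P (\<lambda>p t. integral\<^sup>L (\<mu> t) (g p t))"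
proof -
  have "bounded ((\<lambda>t. integral\<^sup>L (\<mu> t) (\<lambda>_. 1 :: real)) ` {0..T})"
    by (rule compact_imp_bounded[OF compact_continuous_image[OF mass_continuous[OF \<mu>]]]) simp
  then obtain m where "\<forall>x\<in>(\<lambda>t. integral\<^sup>L (\<mu> t) (\<lambda>_. 1 :: real)) ` {0..T}. norm x \<le> m"
    unfolding bounded_iff by (elim exE)
  then have m: "measure (\<mu> t) (space (\<mu> t)) \<le> m" if "0 \<le> t" "t \<le> T" for t using that by simp
  show ?thesis
  proof (rule unif_bddI)
    fix p t assume pt: "p \<in> P" "0 \<le> t" "t \<le> T"
    have fin: "finite_measure (\<mu> t)" using \<mu> pt by (simp add: weakly_continuous_def)
    have K: "0 \<le> K" using g[OF pt, of undefined] by linarith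
    have "\<bar>integral\<^sup>L (\<mu> t) (g p t)\<bar> \<le> K * measure (\<mu> t) (space (\<mu> t))"
      by (rule abs_integral_le[OF fin g[OF pt]])
    also have "\<dots> \<le> K * m" by (rule mult_left_mono[OF m[OF pt(2,3)] K])
    finally show "norm (integral\<^sup>L (\<mu> t) (g p t)) \<le> K * m" by simp
  qed
qed

lemma weakly_continuous_scale:
  assumes \<nu>: "weakly_continuous T \<nu>" and w: "continuous_on {0..T} w" "\<And>t. t \<in> {0..T} \<Longrightarrow> 0 < w t"
    and \<mu>: "\<And>t. t \<in> {0..T} \<Longrightarrow> \<mu> t = scale_measure (ennreal (w t)) (\<nu> t)"
  shows "weakly_continuous T \<mu>"
  unfolding weakly_continuous_def
proof (intro conjI ballI allI impI)
  fix t assume t: "t \<in> {0..T}"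
  have fin: "finite_measure (\<nu> t)" and s: "sets (\<nu> t) = sets borel" using \<nu> t by (simp_all add: weakly_continuous_def)
  show "finite_measure (\<mu> t)"
    using finite_measure.emeasure_finite[OF fin]
    by (intro finite_measureI) (simp add: \<mu>[OF t] space_scale_measure ennreal_mult_eq_top_iff)
  show "sets (\<mu> t) = sets borel" using s by (simp add: \<mu>[OF t])
next
  fix \<phi> :: "real^'a \<Rightarrow> real" assume "continuous_on UNIV \<phi> \<and> bounded (range \<phi>)"
  then have "continuous_on {0..T} (\<lambda>t. integral\<^sup>L (\<nu> t) \<phi>)" using \<nu> by (simp add: weakly_continuous_def)
  then have "continuous_on {0..T} (\<lambda>t. w t * integral\<^sup>L (\<nu> t) \<phi>)" by (intro continuous_intros w)
  then show "continuous_on {0..T} (\<lambda>t. integral\<^sup>L (\<mu> t) \<phi>)"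
    by (rule continuous_on_eq) (simp add: \<mu> w integral_scale_measure)
qed

section \<open>Bounds for the operators\<close>


lemma abs_sum_UNIV_le:
  fixes g :: "'i::finite \<Rightarrow> real"
  assumes "\<And>i. \<bar>g i\<bar> \<le> K"
  shows "\<bar>\<Sum>i\<in>UNIV. g i\<bar> \<le> real CARD('i) * K"
  using order_trans[OF sum_abs sum_bounded_above[of UNIV "\<lambda>i. \<bar>g i\<bar>" K]] assms by simp

lemma finite_dirs: "finite (dirs j :: 'e::euclidean_space list set)"
  unfolding dirs_def using finite_lists_length_eq[of "Basis :: 'e set" j] by (simp add: conj_commute)

lemma norm_iter_pd_le_Cb_norm:
  assumes "Cb_norm \<beta> g \<le> ennreal R" "0 \<le> R" "vs \<in> dirs j" "j \<le> int_order \<beta>"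
  shows "norm (iter_pd vs g x) \<le> R"
proof -
  have "ennreal (norm (iter_pd vs g x)) \<le> (SUP x. ennreal (norm (iter_pd vs g x)))"
    by (rule SUP_upper) simp
  also have "\<dots> \<le> (\<Sum>vs\<in>dirs j. SUP x. ennreal (norm (iter_pd vs g x)))"
    by (rule member_le_sum[OF assms(3)]) (use finite_dirs in auto)
  also have "\<dots> \<le> (\<Sum>j\<le>int_order \<beta>. \<Sum>vs\<in>dirs j. SUP x. ennreal (norm (iter_pd vs g x)))"
    by (rule member_le_sum[of j]) (use assms(4) in auto)
  also have "\<dots> \<le> Cb_norm \<beta> g" unfolding Cb_norm_def by simp
  also have "\<dots> \<le> ennreal R" by (rule assms)
  finally show ?thesis using assms(2) by simp
qed

lemma iter_pd_differentiable:
  assumes "g \<in> Cb \<beta>" "vs \<in> dirs j" "j < int_order \<beta>"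
  shows "iter_pd vs g differentiable (at x)"
  using assms unfolding Cb_def cont_diff_def differentiable_on_def by auto

lemma int_order_simps: "int_order 3 = 2" "int_order 2 = 1" "int_order (2 - 1) = 0"
  by (simp_all add: int_order_def)

lemma int_order_ge_2: "2 < \<beta> \<Longrightarrow> 2 \<le> int_order \<beta>" "2 < \<beta> \<Longrightarrow> 1 \<le> int_order (\<beta> - 1)"
  unfolding int_order_def by linarith+

lemma dirs_simps: "[] \<in> dirs 0" "u \<in> Basis \<Longrightarrow> [u] \<in> dirs 1" "u \<in> Basis \<Longrightarrow> v \<in> Basis \<Longrightarrow> [u, v] \<in> dirs 2"
  by (auto simp: dirs_def)

lemma axis_in_Basis [simp]: "axis i 1 \<in> (Basis :: (real^'x::finite) set)"
  by (simp add: axis_in_Basis_iff)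

text \<open>
  The constant \<open>1\<close> is an admissible test function; it detects the total mass.
\<close>

lemma const_in_Cb: "(\<lambda>_::'e::euclidean_space. a) \<in> Cb \<beta>"
proof -
  have pd: "iter_pd vs (\<lambda>_::'e. a) = (if vs = [] then (\<lambda>_. a) else (\<lambda>_. 0))" for vs
    by (induction vs) auto
  have "cont_diff (int_order \<beta>) (\<lambda>_::'e. a)"
    by (auto simp: cont_diff_def pd)
  moreover have "Cb_norm \<beta> (\<lambda>_::'e. a) < \<infinity>"
  proof -
    have 1: "(SUP x. ennreal (norm (iter_pd vs (\<lambda>_::'e. a) x))) < \<infinity>" for vs
      by (auto simp: pd)
    have 2: "(SUP (x, y)\<in>{(x, y). x \<noteq> y}. ennreal (norm (iter_pd vs (\<lambda>_::'e. a) x - iter_pd vs (\<lambda>_::'e. a) y) / norm (x - y) powr frac_order \<beta>)) < \<infinity>" for vs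
    proof -
      have "(SUP (x, y)\<in>{(x, y). x \<noteq> y}. ennreal (norm (iter_pd vs (\<lambda>_::'e. a) x - iter_pd vs (\<lambda>_::'e. a) y) / norm (x - y) powr frac_order \<beta>)) \<le> 0"
        by (rule SUP_least) (auto simp: pd)
      then show ?thesis by (rule le_less_trans) simp
    qed
    show ?thesis unfolding Cb_norm_def using 1 2 by (simp add: less_top[symmetric] finite_dirs)
  qed
  ultimately show ?thesis by (simp add: Cb_def)
qed

lemma norm_comp1_le: "norm (comp1 L \<kappa>) \<le> norm L"
  using norm_blinfun[of L "axis \<kappa> 1"] by (simp add: comp1_def)

lemma norm_comp2_le: "norm (comp2 L \<kappa> \<iota>) \<le> norm L"
  unfolding comp2_def by (rule order_trans[OF norm_comp1_le norm_comp1_le])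

lemma bounded_linear_comp1: "bounded_linear (\<lambda>L. comp1 L \<kappa>)"
  unfolding comp1_def by (rule blinfun.bounded_linear_left)

text \<open>
  Membership in \<open>Cb \<beta>\<close> comes from measurability into the Borel space on \<open>Cb \<beta>\<close>.
\<close>

lemma controlled_vf_bounds:
  fixes g :: "real \<Rightarrow> 'e::euclidean_space \<Rightarrow> ((real^'y::finite) \<Rightarrow>\<^sub>L 'v::real_normed_vector)"
  assumes "controlled_vf T \<alpha> \<beta> Y g g'"
  obtains R where "0 \<le> R" "\<And>t. 0 \<le> t \<Longrightarrow> t \<le> T \<Longrightarrow> g t \<in> Cb \<beta>"
    "\<And>t. 0 \<le> t \<Longrightarrow> t \<le> T \<Longrightarrow> Cb_norm \<beta> (g t) \<le> ennreal R"
    "\<And>t. 0 \<le> t \<Longrightarrow> t \<le> T \<Longrightarrow> Cb_norm (\<beta> - 1) (g' t) \<le> ennreal R"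
proof -
  have sp: "space (Cb_borel \<beta> :: ('e \<Rightarrow> (real^'y) \<Rightarrow>\<^sub>L 'v) measure) = Cb \<beta>"
    unfolding Cb_borel_def by (rule space_measure_of) auto
  have "g \<in> measurable (restrict_space borel {0..T}) (Cb_borel \<beta>)"
    using assms by (simp add: controlled_vf_def)
  from this have mem: "g t \<in> Cb \<beta>" if "0 \<le> t" "t \<le> T" for t
    using measurable_space[OF \<open>g \<in> _\<close>, of t] that unfolding sp by (simp add: space_restrict_space)
  have fin: "(SUP t\<in>{0..T}. Cb_norm \<beta> (g t)) + (SUP t\<in>{0..T}. Cb_norm (\<beta> - 1) (g' t)) < \<infinity>"
    using assms by (simp add: controlled_vf_def)
  define R where "R = enn2real ((SUP t\<in>{0..T}. Cb_norm \<beta> (g t)) + (SUP t\<in>{0..T}. Cb_norm (\<beta> - 1) (g' t)))"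
  have R: "ennreal R = (SUP t\<in>{0..T}. Cb_norm \<beta> (g t)) + (SUP t\<in>{0..T}. Cb_norm (\<beta> - 1) (g' t))"
    unfolding R_def using fin by simp
  show ?thesis
  proof (rule that[of R])
    show "0 \<le> R" by (simp add: R_def)
    fix t assume t: "0 \<le> t" "t \<le> T"
    show "g t \<in> Cb \<beta>" by (rule mem[OF t])
    have "Cb_norm \<beta> (g t) \<le> (SUP t\<in>{0..T}. Cb_norm \<beta> (g t))" using t by (intro SUP_upper) auto
    also have "\<dots> \<le> ennreal R" unfolding R by simp
    finally show "Cb_norm \<beta> (g t) \<le> ennreal R" .
    have "Cb_norm (\<beta> - 1) (g' t) \<le> (SUP t\<in>{0..T}. Cb_norm (\<beta> - 1) (g' t))" using t by (intro SUP_upper) auto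
    also have "\<dots> \<le> ennreal R" unfolding R by simp
    finally show "Cb_norm (\<beta> - 1) (g' t) \<le> ennreal R" .
  qed
qed

text \<open>
  A ball of test functions; for negative \<open>R\<close> it is the ball of radius \<open>0\<close>, because \<open>ennreal R = 0\<close>.
\<close>

definition tests :: "real \<Rightarrow> (real^'x::finite \<Rightarrow> real) set" where
  "tests R = {\<phi> \<in> Cb 3. Cb_norm 3 \<phi> \<le> ennreal R}"

lemma tests_cover: "\<phi> \<in> Cb 3 \<Longrightarrow> \<exists>R. \<phi> \<in> tests R"
  unfolding tests_def by (rule exI[of _ "enn2real (Cb_norm 3 \<phi>)"]) (simp add: Cb_def)

lemma tests_bounds:
  fixes \<phi> :: "real^'x::finite \<Rightarrow> real"
  assumes "\<phi> \<in> tests R"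
  shows "\<bar>\<phi> x\<bar> \<le> max 0 R" "\<bar>pd i \<phi> x\<bar> \<le> max 0 R" "\<bar>pd2 i j \<phi> x\<bar> \<le> max 0 R"
    "\<phi> differentiable (at x)" "pd i \<phi> differentiable (at x)"
proof -
  have n: "Cb_norm 3 \<phi> \<le> ennreal (max 0 R)" and C: "\<phi> \<in> Cb 3"
    using assms by (auto simp: tests_def max_def ennreal_neg)
  show "\<bar>\<phi> x\<bar> \<le> max 0 R"
    using norm_iter_pd_le_Cb_norm[OF n _ dirs_simps(1)] by simp
  show "\<bar>pd i \<phi> x\<bar> \<le> max 0 R"
    using norm_iter_pd_le_Cb_norm[OF n _ dirs_simps(2)[OF axis_in_Basis]]
    by (simp add: pd_def int_order_simps)
  show "\<bar>pd2 i j \<phi> x\<bar> \<le> max 0 R"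
    using norm_iter_pd_le_Cb_norm[OF n _ dirs_simps(3)[OF axis_in_Basis axis_in_Basis]]
    by (simp add: pd2_def int_order_simps)
  show "\<phi> differentiable (at x)"
    using iter_pd_differentiable[OF C dirs_simps(1)] by (simp add: int_order_simps)
  show "pd i \<phi> differentiable (at x)"
    using iter_pd_differentiable[OF C dirs_simps(2)[OF axis_in_Basis]] by (simp add: pd_def int_order_simps)
qed

lemma pd_pd: "pd j (pd i \<phi>) = pd2 j i \<phi>"
  by (simp add: pd_def pd2_def)

lemma Gam_1: "Gam c t \<kappa> (\<lambda>_. 1) = h_comp c t \<kappa>"
  by (simp add: Gam_def h_comp_def pd_def fun_eq_iff)

lemma Gam2_1: "Gam2 c t \<iota> \<kappa> (\<lambda>_. 1) = (\<lambda>x. Gam c t \<iota> (h_comp c t \<kappa>) x + comp2 (co_h' c t x) \<kappa> \<iota>)"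
  by (simp add: Gam2_def Gam_1 Gam'_def pd_def fun_eq_iff)

lemma A_op_1: "A_op T Y c t (\<lambda>_. 1) = (\<lambda>_. 0)"
  by (simp add: A_op_def pd_def pd2_def fun_eq_iff)

text \<open>
  Regularity of the coefficients for a fixed driving path.
\<close>

locale rough_filtering = bracketed_rough_path T \<alpha> Y
  for T \<alpha> :: real and Y :: "'y::finite rough_path" +
  fixes c :: "('x::finite, 'y, 'b::finite) coeffs"
  assumes b_bdd: "bounded_lipschitz T (co_b c)" and \<sigma>_bdd: "bounded_lipschitz T (co_\<sigma> c)"
    and f_vf: "\<exists>\<beta>. 1 / \<alpha> < \<beta> \<and> \<beta> \<le> 3 \<and> controlled_vf T \<alpha> \<beta> (fst Y) (co_f c) (co_f' c)"
    and h_vf: "controlled_vf T \<alpha> 2 (fst Y) (co_h c) (co_h' c)"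

begin


text \<open>
  As \<open>1 / \<alpha> \<ge> 2\<close>, the field \<open>f\<close> has order \<open>\<beta> > 2\<close> and is continuously differentiable, like \<open>h\<close>; so \<open>\<Gamma>\<^sub>\<kappa> \<Gamma>\<^sub>\<iota> \<phi>\<close>
  involves only bounded derivatives of the coefficients.
\<close>

lemma coefficient_bounds:
  "\<exists>K\<ge>0. \<forall>t\<in>{0..T}. \<forall>x. (norm (co_b c t x) \<le> K \<and> norm (co_\<sigma> c t x) \<le> K \<and>
      norm (co_f c t x) \<le> K \<and> norm (co_f' c t x) \<le> K \<and> norm (co_h c t x) \<le> K \<and> norm (co_h' c t x) \<le> K \<and>
      (\<forall>j. norm (iter_pd [axis j 1] (co_f c t) x) \<le> K) \<and> (\<forall>j. norm (iter_pd [axis j 1] (co_h c t) x) \<le> K)) \<and>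
      co_f c t differentiable (at x) \<and> co_h c t differentiable (at x)"
  (is "\<exists>K\<ge>0. \<forall>t\<in>{0..T}. \<forall>x. ?bounds K t x \<and> ?diff t x")
proof -
  obtain Kb where "\<forall>t\<in>{0..T}. (\<forall>x. norm (co_b c t x) \<le> Kb) \<and> Kb-lipschitz_on UNIV (co_b c t)"
    using b_bdd unfolding bounded_lipschitz_def by (elim exE)
  then have Kb: "norm (co_b c t x) \<le> Kb" if "0 \<le> t" "t \<le> T" for t x using that by simp
  obtain Ks where "\<forall>t\<in>{0..T}. (\<forall>x. norm (co_\<sigma> c t x) \<le> Ks) \<and> Ks-lipschitz_on UNIV (co_\<sigma> c t)"
    using \<sigma>_bdd unfolding bounded_lipschitz_def by (elim exE)
  then have Ks: "norm (co_\<sigma> c t x) \<le> Ks" if "0 \<le> t" "t \<le> T" for t x using that by simp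
  obtain \<beta> where \<beta>: "1 / \<alpha> < \<beta>" "controlled_vf T \<alpha> \<beta> (fst Y) (co_f c) (co_f' c)" using f_vf by blast
  have "2 \<le> 1 / \<alpha>" using alpha_gt alpha_le by (simp add: field_simps)
  then have "2 < \<beta>" using \<beta> by simp
  note o = int_order_ge_2[OF this]
  obtain Kf where Kf: "0 \<le> Kf" "\<And>t. 0 \<le> t \<Longrightarrow> t \<le> T \<Longrightarrow> co_f c t \<in> Cb \<beta>"
    "\<And>t. 0 \<le> t \<Longrightarrow> t \<le> T \<Longrightarrow> Cb_norm \<beta> (co_f c t) \<le> ennreal Kf"
    "\<And>t. 0 \<le> t \<Longrightarrow> t \<le> T \<Longrightarrow> Cb_norm (\<beta> - 1) (co_f' c t) \<le> ennreal Kf"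
    by (rule controlled_vf_bounds[OF \<beta>(2)]) blast
  obtain Kh where Kh: "0 \<le> Kh" "\<And>t. 0 \<le> t \<Longrightarrow> t \<le> T \<Longrightarrow> co_h c t \<in> Cb 2"
    "\<And>t. 0 \<le> t \<Longrightarrow> t \<le> T \<Longrightarrow> Cb_norm 2 (co_h c t) \<le> ennreal Kh"
    "\<And>t. 0 \<le> t \<Longrightarrow> t \<le> T \<Longrightarrow> Cb_norm (2 - 1) (co_h' c t) \<le> ennreal Kh"
    by (rule controlled_vf_bounds[OF h_vf]) blast
  define K where "K = \<bar>Kb\<bar> + \<bar>Ks\<bar> + Kf + Kh"
  show ?thesis
  proof (intro exI[of _ K] conjI[of "0 \<le> K"] ballI allI)
    show "0 \<le> K" using Kf(1) Kh(1) by (simp add: K_def)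
    fix t x assume "t \<in> {0..T}"
    then have t: "0 \<le> t" "t \<le> T" by auto
    have 1: "norm (co_f c t x) \<le> Kf"
      using norm_iter_pd_le_Cb_norm[OF Kf(3)[OF t] Kf(1) dirs_simps(1)] by simp
    have 2: "norm (co_f' c t x) \<le> Kf"
      using norm_iter_pd_le_Cb_norm[OF Kf(4)[OF t] Kf(1) dirs_simps(1)] by simp
    have 3: "norm (iter_pd [axis j 1] (co_f c t) x) \<le> Kf" for j
      by (rule norm_iter_pd_le_Cb_norm[OF Kf(3)[OF t] Kf(1) dirs_simps(2)[OF axis_in_Basis]]) (use o in simp)
    have 4: "norm (co_h c t x) \<le> Kh"
      using norm_iter_pd_le_Cb_norm[OF Kh(3)[OF t] Kh(1) dirs_simps(1)] by simp
    have 5: "norm (co_h' c t x) \<le> Kh"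
      using norm_iter_pd_le_Cb_norm[OF Kh(4)[OF t] Kh(1) dirs_simps(1)] by simp
    have 6: "norm (iter_pd [axis j 1] (co_h c t) x) \<le> Kh" for j
      by (rule norm_iter_pd_le_Cb_norm[OF Kh(3)[OF t] Kh(1) dirs_simps(2)[OF axis_in_Basis]])
        (simp add: int_order_simps)
    have le: "Kf \<le> K" "Kh \<le> K" "Kb \<le> K" "Ks \<le> K" using Kf(1) Kh(1) by (auto simp: K_def)
    have 7: "?bounds K t x"
      by (intro conjI allI order_trans[OF Kb[OF t] le(3)] order_trans[OF Ks[OF t] le(4)]
        order_trans[OF 1 le(1)] order_trans[OF 2 le(1)] order_trans[OF 3 le(1)]
        order_trans[OF 4 le(2)] order_trans[OF 5 le(2)] order_trans[OF 6 le(2)])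
    have 8: "co_f c t differentiable (at x) \<and> co_h c t differentiable (at x)"
      using iter_pd_differentiable[OF Kf(2)[OF t] dirs_simps(1)] iter_pd_differentiable[OF Kh(2)[OF t] dirs_simps(1)] o
      by (simp add: int_order_simps)
    from 7 8 show "?bounds K t x \<and> ?diff t x" by (rule conjI)
  qed
qed

text \<open>
  Product rule, needed because \<open>\<Gamma>\<^sub>\<kappa> \<Gamma>\<^sub>\<iota> \<phi>\<close> differentiates the coefficients of \<open>\<Gamma>\<^sub>\<iota>\<close>.
\<close>

lemma pd_Gam:
  assumes \<phi>: "\<phi> \<in> tests R" and fd: "co_f c t differentiable (at x)" and hd: "co_h c t differentiable (at x)"
  shows "pd j (Gam c t \<kappa> \<phi>) x =
    (\<Sum>i\<in>UNIV. comp1 (co_f c t x) \<kappa> $ i * pd2 j i \<phi> x + comp1 (iter_pd [axis j 1] (co_f c t) x) \<kappa> $ i * pd i \<phi> x)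
    + (comp1 (co_h c t x) \<kappa> * pd j \<phi> x + comp1 (iter_pd [axis j 1] (co_h c t) x) \<kappa> * \<phi> x)"
proof -
  note \<phi>d = tests_bounds(4,5)[OF \<phi>, THEN frechet_derivative_works[THEN iffD1]]
  have nth: "bounded_linear (\<lambda>L. comp1 L \<kappa> $ i)" for i
    by (rule bounded_linear_compose[OF bounded_linear_vec_nth bounded_linear_comp1])
  have f': "((\<lambda>x. comp1 (co_f c t x) \<kappa> $ i) has_derivative (\<lambda>v. comp1 (frechet_derivative (co_f c t) (at x) v) \<kappa> $ i)) (at x)" for i
    by (rule bounded_linear.has_derivative[OF nth]) (use fd in \<open>simp add: frechet_derivative_works\<close>)
  have h': "((\<lambda>x. comp1 (co_h c t x) \<kappa>) has_derivative (\<lambda>v. comp1 (frechet_derivative (co_h c t) (at x) v) \<kappa>)) (at x)"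
    by (rule bounded_linear.has_derivative[OF bounded_linear_comp1]) (use hd in \<open>simp add: frechet_derivative_works\<close>)
  have "(Gam c t \<kappa> \<phi> has_derivative (\<lambda>v.
      (\<Sum>i\<in>UNIV. comp1 (co_f c t x) \<kappa> $ i * frechet_derivative (pd i \<phi>) (at x) v
        + comp1 (frechet_derivative (co_f c t) (at x) v) \<kappa> $ i * pd i \<phi> x)
      + (comp1 (co_h c t x) \<kappa> * frechet_derivative \<phi> (at x) v
        + comp1 (frechet_derivative (co_h c t) (at x) v) \<kappa> * \<phi> x))) (at x)"
    unfolding Gam_def[abs_def]
    by (intro has_derivative_add has_derivative_sum has_derivative_mult f' h' \<phi>d)
  from frechet_derivative_at[OF this, symmetric] show ?thesis
    unfolding pd_pd[symmetric] pd_def by simp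
qed

text \<open>
  The bounds depend on \<open>\<phi>\<close> only through a bound for its norm, as the calculus needs them uniformly over a ball of test functions.
\<close>

lemma operator_bounds:
  obtains K where "0 \<le> K"
    "\<And>\<phi> t x \<kappa>. \<phi> \<in> tests R \<Longrightarrow> 0 \<le> t \<Longrightarrow> t \<le> T \<Longrightarrow> \<bar>Gam c t \<kappa> \<phi> x\<bar> \<le> K"
    "\<And>\<phi> t x \<kappa> \<iota>. \<phi> \<in> tests R \<Longrightarrow> 0 \<le> t \<Longrightarrow> t \<le> T \<Longrightarrow> \<bar>Gam2 c t \<kappa> \<iota> \<phi> x\<bar> \<le> K"
    "\<And>\<phi> t x. \<phi> \<in> tests R \<Longrightarrow> 0 \<le> t \<Longrightarrow> t \<le> T \<Longrightarrow> \<bar>A_op T Y c t \<phi> x\<bar> \<le> K"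
proof -
  obtain K where K: "0 \<le> K" "\<And>t x. 0 \<le> t \<Longrightarrow> t \<le> T \<Longrightarrow> norm (co_b c t x) \<le> K \<and> norm (co_\<sigma> c t x) \<le> K \<and>
      norm (co_f c t x) \<le> K \<and> norm (co_f' c t x) \<le> K \<and> norm (co_h c t x) \<le> K \<and> norm (co_h' c t x) \<le> K \<and>
      (\<forall>j. norm (iter_pd [axis j 1] (co_f c t) x) \<le> K) \<and> (\<forall>j. norm (iter_pd [axis j 1] (co_h c t) x) \<le> K)"
    and d: "\<And>t x. 0 \<le> t \<Longrightarrow> t \<le> T \<Longrightarrow> co_f c t differentiable (at x) \<and> co_h c t differentiable (at x)"
    using coefficient_bounds by (elim exE conjE) auto
  obtain KB where KB: "0 \<le> KB" "\<And>t. 0 \<le> t \<Longrightarrow> t \<le> T \<Longrightarrow> norm (B t) \<le> KB"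
    by (rule unif_bddE[OF B_bdd[of "{()}"]]) auto
  define r where "r = max 0 R"
  have r: "0 \<le> r" by (simp add: r_def)
  note tb = tests_bounds(1-3)[of _ R, folded r_def]
  define n where "n = real CARD('x)"
  define K1 where "K1 = n * (K * r) + K * r"
  have n: "0 \<le> n" by (simp add: n_def)
  have K1: "0 \<le> K1" using K(1) r n by (simp add: K1_def)
  have c1: "\<bar>comp1 L \<kappa> $ i\<bar> \<le> norm L" for L :: "(real^'a::finite) \<Rightarrow>\<^sub>L (real^'x)" and \<kappa> i
    using component_le_norm_cart[of "comp1 L \<kappa>" i] norm_comp1_le[of L \<kappa>] by linarith
  have c2: "\<bar>comp2 L \<kappa> \<iota> $ i\<bar> \<le> norm L" for L :: "(real^'y) \<Rightarrow>\<^sub>L ((real^'y) \<Rightarrow>\<^sub>L (real^'x))" and \<kappa> \<iota> i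
    using component_le_norm_cart[of "comp2 L \<kappa> \<iota>" i] norm_comp2_le[of L \<kappa> \<iota>] by linarith
  have prod: "\<bar>a * b\<bar> \<le> p * q" if "\<bar>a\<bar> \<le> p" "\<bar>b\<bar> \<le> q" for a b p q :: real
    unfolding abs_mult using that by (intro mult_mono) auto
  have G: "\<bar>Gam c t \<kappa> \<phi> x\<bar> \<le> K1" if "\<phi> \<in> tests R" "0 \<le> t" "t \<le> T" for \<phi> t x \<kappa>
  proof -
    note k = K(2)[OF that(2,3), of x]
    have "\<bar>\<Sum>i\<in>UNIV. comp1 (co_f c t x) \<kappa> $ i * pd i \<phi> x\<bar> \<le> n * (K * r)"
      unfolding n_def by (rule abs_sum_UNIV_le, rule prod[OF order_trans[OF c1] tb(2)]) (use k that in auto)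
    moreover have "\<bar>comp1 (co_h c t x) \<kappa> * \<phi> x\<bar> \<le> K * r"
      by (rule prod) (use k norm_comp1_le[of "co_h c t x" \<kappa>] tb that in auto)
    ultimately show ?thesis unfolding Gam_def K1_def by linarith
  qed
  have G': "\<bar>Gam' c t \<kappa> \<iota> \<phi> x\<bar> \<le> K1" if "\<phi> \<in> tests R" "0 \<le> t" "t \<le> T" for \<phi> t x \<kappa> \<iota>
  proof -
    note k = K(2)[OF that(2,3), of x]
    have "\<bar>\<Sum>i\<in>UNIV. comp2 (co_f' c t x) \<kappa> \<iota> $ i * pd i \<phi> x\<bar> \<le> n * (K * r)"
      unfolding n_def by (rule abs_sum_UNIV_le, rule prod[OF order_trans[OF c2] tb(2)]) (use k that in auto)
    moreover have "\<bar>comp2 (co_h' c t x) \<kappa> \<iota> * \<phi> x\<bar> \<le> K * r"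
      by (rule prod) (use k norm_comp2_le[of "co_h' c t x" \<kappa> \<iota>] tb that in auto)
    ultimately show ?thesis unfolding Gam'_def K1_def by linarith
  qed
  have pG: "\<bar>pd j (Gam c t \<kappa> \<phi>) x\<bar> \<le> 2 * K1" if "\<phi> \<in> tests R" "0 \<le> t" "t \<le> T" for \<phi> t x \<kappa> j
  proof -
    note k = K(2)[OF that(2,3), of x]
    have e: "pd j (Gam c t \<kappa> \<phi>) x =
      ((\<Sum>i\<in>UNIV. comp1 (co_f c t x) \<kappa> $ i * pd2 j i \<phi> x)
        + (\<Sum>i\<in>UNIV. comp1 (iter_pd [axis j 1] (co_f c t) x) \<kappa> $ i * pd i \<phi> x))
      + (comp1 (co_h c t x) \<kappa> * pd j \<phi> x + comp1 (iter_pd [axis j 1] (co_h c t) x) \<kappa> * \<phi> x)"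
      using pd_Gam[OF that(1), of t x j \<kappa>] d[OF that(2,3), of x] by (simp add: sum.distrib)
    have k': "norm (iter_pd [axis j 1] (co_f c t) x) \<le> K" "norm (iter_pd [axis j 1] (co_h c t) x) \<le> K"
      using k by blast+
    have "\<bar>\<Sum>i\<in>UNIV. comp1 (co_f c t x) \<kappa> $ i * pd2 j i \<phi> x\<bar> \<le> n * (K * r)"
      unfolding n_def by (rule abs_sum_UNIV_le, rule prod[OF order_trans[OF c1] tb(3)]) (use k that in auto)
    moreover have "\<bar>\<Sum>i\<in>UNIV. comp1 (iter_pd [axis j 1] (co_f c t) x) \<kappa> $ i * pd i \<phi> x\<bar> \<le> n * (K * r)"
      unfolding n_def by (rule abs_sum_UNIV_le, rule prod[OF order_trans[OF c1 k'(1)] tb(2)]) (use that in auto)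
    moreover have "\<bar>comp1 (co_h c t x) \<kappa> * pd j \<phi> x\<bar> \<le> K * r"
      by (rule prod) (use k norm_comp1_le[of "co_h c t x" \<kappa>] tb that in auto)
    moreover have "\<bar>comp1 (iter_pd [axis j 1] (co_h c t) x) \<kappa> * \<phi> x\<bar> \<le> K * r"
      by (rule prod) (use order_trans[OF norm_comp1_le k'(2), of \<kappa>] tb that in auto)
    moreover have "2 * K1 = n * (K * r) + n * (K * r) + (K * r + K * r)" by (simp add: K1_def)
    ultimately show ?thesis unfolding e by linarith
  qed
  have GG: "\<bar>Gam c t \<kappa> (Gam c t \<iota> \<phi>) x\<bar> \<le> n * (K * (2 * K1)) + K * K1"
    if "\<phi> \<in> tests R" "0 \<le> t" "t \<le> T" for \<phi> t x \<kappa> \<iota>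
  proof -
    note k = K(2)[OF that(2,3), of x]
    have "\<bar>\<Sum>i\<in>UNIV. comp1 (co_f c t x) \<kappa> $ i * pd i (Gam c t \<iota> \<phi>) x\<bar> \<le> n * (K * (2 * K1))"
      unfolding n_def by (rule abs_sum_UNIV_le, rule prod[OF order_trans[OF c1] pG]) (use k that in auto)
    moreover have "\<bar>comp1 (co_h c t x) \<kappa> * Gam c t \<iota> \<phi> x\<bar> \<le> K * K1"
      by (rule prod) (use k norm_comp1_le[of "co_h c t x" \<kappa>] G that in auto)
    ultimately show ?thesis unfolding Gam_def[of c t \<kappa> "Gam c t \<iota> \<phi>"] by linarith
  qed
  define ny where "ny = real CARD('y)"
  define nb where "nb = real CARD('b)"
  define KA where "KA = n * ((K + ny * (ny * (K * KB * K))) * r) + 1/2 * (n * (n * ((nb * (K * K) + ny * (ny * (K * KB * K))) * r)))"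
  have A: "\<bar>A_op T Y c t \<phi> x\<bar> \<le> KA" if "\<phi> \<in> tests R" "0 \<le> t" "t \<le> T" for \<phi> t x
  proof -
    note k = K(2)[OF that(2,3), of x]
    have f: "\<bar>comp1 (co_f c t x) \<kappa> $ i\<bar> \<le> K" for \<kappa> i by (rule order_trans[OF c1]) (use k in blast)
    have s: "\<bar>comp1 (co_\<sigma> c t x) \<kappa> $ i\<bar> \<le> K" for \<kappa> i by (rule order_trans[OF c1]) (use k in blast)
    have h: "\<bar>comp1 (co_h c t x) \<kappa>\<bar> \<le> K" for \<kappa> using k norm_comp1_le[of "co_h c t x" \<kappa>] by simp
    have b: "\<bar>co_b c t x $ i\<bar> \<le> K" for i using k component_le_norm_cart[of "co_b c t x" i] by linarith
    have Bb: "\<bar>B t $ \<kappa> $ \<iota>\<bar> \<le> KB" for \<kappa> \<iota>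
      using component_le_norm_cart[of "B t $ \<kappa>" \<iota>] Finite_Cartesian_Product.norm_nth_le[of "B t" \<kappa>] KB(2)[OF that(2,3)] by linarith
    have fBg: "\<bar>\<Sum>\<kappa>\<in>UNIV. \<Sum>\<iota>\<in>UNIV. comp1 (co_f c t x) \<kappa> $ i * B t $ \<kappa> $ \<iota> * g \<iota>\<bar> \<le> ny * (ny * (K * KB * K))"
      if "\<And>\<iota>. \<bar>g \<iota>\<bar> \<le> K" for i and g :: "'y \<Rightarrow> real"
      unfolding ny_def by (intro abs_sum_UNIV_le prod f Bb that)
    define u where "u i = co_b c t x $ i + (\<Sum>\<kappa>\<in>UNIV. \<Sum>\<iota>\<in>UNIV.
      comp1 (co_f c t x) \<kappa> $ i * B t $ \<kappa> $ \<iota> * comp1 (co_h c t x) \<iota>)" for i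
    define w where "w i j = (\<Sum>\<theta>\<in>UNIV. comp1 (co_\<sigma> c t x) \<theta> $ i * comp1 (co_\<sigma> c t x) \<theta> $ j) +
      (\<Sum>\<kappa>\<in>UNIV. \<Sum>\<iota>\<in>UNIV.
        comp1 (co_f c t x) \<kappa> $ i * B t $ \<kappa> $ \<iota> * comp1 (co_f c t x) \<iota> $ j)" for i j
    have u: "\<bar>u i\<bar> \<le> K + ny * (ny * (K * KB * K))" for i
      unfolding u_def by (rule order_trans[OF abs_triangle_ineq add_mono[OF b fBg]]) (rule h)
    have "\<bar>\<Sum>\<theta>\<in>UNIV. comp1 (co_\<sigma> c t x) \<theta> $ i * comp1 (co_\<sigma> c t x) \<theta> $ j\<bar> \<le> nb * (K * K)" for i j
      unfolding nb_def by (intro abs_sum_UNIV_le prod s)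
    then have w: "\<bar>w i j\<bar> \<le> nb * (K * K) + ny * (ny * (K * KB * K))" for i j
      unfolding w_def by (rule order_trans[OF abs_triangle_ineq add_mono[OF _ fBg]]) (rule f)
    have 1: "\<bar>\<Sum>i\<in>UNIV. u i * pd i \<phi> x\<bar> \<le> n * ((K + ny * (ny * (K * KB * K))) * r)"
      unfolding n_def by (intro abs_sum_UNIV_le prod u tb(2) that(1))
    have 2: "\<bar>\<Sum>i\<in>UNIV. \<Sum>j\<in>UNIV. w i j * pd2 i j \<phi> x\<bar>
        \<le> n * (n * ((nb * (K * K) + ny * (ny * (K * KB * K))) * r))"
      unfolding n_def by (intro abs_sum_UNIV_le prod w tb(3) that(1))
    have eq: "A_op T Y c t \<phi> x = (\<Sum>i\<in>UNIV. u i * pd i \<phi> x) + 1 / 2 * (\<Sum>i\<in>UNIV. \<Sum>j\<in>UNIV. w i j * pd2 i j \<phi> x)"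
      unfolding A_op_def u_def w_def ..
    show ?thesis unfolding eq KA_def using 1 2 by linarith
  qed
  define K2 where "K2 = n * (K * (2 * K1)) + K * K1 + K1"
  have K2: "0 \<le> K2" using K(1) K1 n by (simp add: K2_def)
  have G2: "\<bar>Gam2 c t \<kappa> \<iota> \<phi> x\<bar> \<le> K2" if "\<phi> \<in> tests R" "0 \<le> t" "t \<le> T" for \<phi> t x \<kappa> \<iota>
    using GG[OF that, of \<kappa> \<iota> x] G'[OF that, of \<iota> \<kappa> x] unfolding Gam2_def K2_def by linarith
  show ?thesis
  proof (rule that[of "K1 + K2 + \<bar>KA\<bar>"])
    show "0 \<le> K1 + K2 + \<bar>KA\<bar>" using K1 K2 by simp
    fix \<phi> :: "real^'x \<Rightarrow> real" and t x \<kappa> \<iota> assume *: "\<phi> \<in> tests R" "0 \<le> t" "t \<le> T"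
    show "\<bar>Gam c t \<kappa> \<phi> x\<bar> \<le> K1 + K2 + \<bar>KA\<bar>" using G[OF *, of \<kappa> x] K2 by linarith
    show "\<bar>Gam2 c t \<kappa> \<iota> \<phi> x\<bar> \<le> K1 + K2 + \<bar>KA\<bar>" using G2[OF *, of \<kappa> \<iota> x] K1 by linarith
    show "\<bar>A_op T Y c t \<phi> x\<bar> \<le> K1 + K2 + \<bar>KA\<bar>" using A[OF *, of x] K1 K2 by linarith
  qed
qed

subsection \<open>The two equations as expansions of families of processes\<close>



text \<open>
  The regularity conditions that both solution concepts impose on the coefficients, with one constant for the ball of radius \<open>R\<close>.
\<close>

definition estimates ::
  "real \<Rightarrow> real \<Rightarrow> ((real^'x \<Rightarrow> real) \<Rightarrow> real \<Rightarrow> 'y \<Rightarrow> real) \<Rightarrow>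
   ((real^'x \<Rightarrow> real) \<Rightarrow> real \<Rightarrow> 'y \<Rightarrow> 'y \<Rightarrow> real) \<Rightarrow> bool" where
  "estimates R C G1 G2 \<longleftrightarrow> (\<forall>\<phi>\<in>Cb 3. Cb_norm 3 \<phi> \<le> ennreal R \<longrightarrow>
        (\<forall>s t. 0 \<le> s \<and> s \<le> t \<and> t \<le> T \<longrightarrow>
          (\<forall>\<kappa> \<iota>. \<bar>G2 \<phi> t \<kappa> \<iota> - G2 \<phi> s \<kappa> \<iota>\<bar> \<le> C * \<bar>t - s\<bar> powr \<alpha>) \<and>
          (\<forall>\<kappa>. \<bar>G1 \<phi> t \<kappa> - G1 \<phi> s \<kappa> - (\<Sum>\<eta>\<in>UNIV. G2 \<phi> s \<eta> \<kappa> * dY s t $ \<eta>)\<bar>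
             \<le> C * \<bar>t - s\<bar> powr (2 * \<alpha>))))"

text \<open>
  The common shape of the two solution concepts: \<open>X\<close> are the observables \<open>t \<mapsto> \<mu>\<^sub>t(\<phi>)\<close>, \<open>a\<close> their drifts,
  \<open>G1\<close> and \<open>G2\<close> their first and second order coefficients.
\<close>

definition solves ::
  "((real^'x \<Rightarrow> real) \<Rightarrow> real \<Rightarrow> real) \<Rightarrow> ((real^'x \<Rightarrow> real) \<Rightarrow> real \<Rightarrow> real) \<Rightarrow>
   ((real^'x \<Rightarrow> real) \<Rightarrow> real \<Rightarrow> 'y \<Rightarrow> real) \<Rightarrow> ((real^'x \<Rightarrow> real) \<Rightarrow> real \<Rightarrow> 'y \<Rightarrow> 'y \<Rightarrow> real) \<Rightarrow> bool" where
  "solves X a G1 G2 \<longleftrightarrow>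
     (\<forall>R. \<exists>C>0. estimates R C G1 G2) \<and>
     (\<forall>\<phi>\<in>Cb 3. small_o_incr T (\<lambda>s t. X \<phi> t - X \<phi> s
        - ((LBINT r:{s..t}. a \<phi> r) + (\<Sum>\<kappa>\<in>UNIV. G1 \<phi> s \<kappa> * dY s t $ \<kappa>)
           + (\<Sum>\<kappa>\<in>UNIV. \<Sum>\<iota>\<in>UNIV. G2 \<phi> s \<kappa> \<iota> * YY s t $ \<kappa> $ \<iota>))))"

abbreviation vec1 :: "('p \<Rightarrow> real \<Rightarrow> 'y \<Rightarrow> real) \<Rightarrow> 'p \<Rightarrow> real \<Rightarrow> real^'y" where
  "vec1 G p t \<equiv> (\<chi> \<kappa>. G p t \<kappa>)"

abbreviation vec2 :: "('p \<Rightarrow> real \<Rightarrow> 'y \<Rightarrow> 'y \<Rightarrow> real) \<Rightarrow> 'p \<Rightarrow> real \<Rightarrow> real^'y^'y" where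
  "vec2 G p t \<equiv> (\<chi> \<kappa> \<iota>. G p t \<kappa> \<iota>)"

lemma germ_vec:
  "germ a (vec1 G1) (vec2 G2) p s t = (LBINT r:{s..t}. a p r) + (\<Sum>\<kappa>\<in>UNIV. G1 p s \<kappa> * dY s t $ \<kappa>)
     + (\<Sum>\<kappa>\<in>UNIV. \<Sum>\<iota>\<in>UNIV. G2 p s \<kappa> \<iota> * YY s t $ \<kappa> $ \<iota>)"
  by (simp add: germ_def inner_vec_def)

lemma controlled_component:
  "(vec1 G1 p t - vec1 G1 p s - dY s t v* vec2 G2 p s) $ \<kappa>
     = G1 p t \<kappa> - G1 p s \<kappa> - (\<Sum>\<eta>\<in>UNIV. G2 p s \<eta> \<kappa> * dY s t $ \<eta>)"
  by (simp add: vector_matrix_mult_def mult.commute)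

lemma tests_subset: "\<phi> \<in> tests R \<Longrightarrow> \<phi> \<in> Cb 3"
  by (simp add: tests_def)

lemma rough_ito_of_solves:
  assumes s: "solves X a G1 G2" and X: "unif_bdd T (tests R) X" and a: "integrable_drift (tests R) a"
    and b: "unif_bdd T (tests R) (vec1 G1)" "unif_bdd T (tests R) (vec2 G2)"
  shows "rough_ito (tests R) X a (vec1 G1) (vec2 G2)"
proof (rule rough_ito_of_small_o[OF X a])
  from s have "\<exists>C>0. estimates R C G1 G2"
    unfolding solves_def by (elim conjE allE)
  then obtain C where C: "0 < C" "estimates R C G1 G2" by (elim exE conjE)
  have i2: "unif_bigo T (tests R) \<alpha> (\<lambda>p s t. vec2 G2 p t - vec2 G2 p s)"
  proof (intro unif_bigo_vecI)
    fix \<kappa> \<iota>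
    show "unif_bigo T (tests R) \<alpha> (\<lambda>p s t. (vec2 G2 p t - vec2 G2 p s) $ \<kappa> $ \<iota>)"
      by (rule unif_bigoI[of _ _ _ C]) (use C(2) in \<open>simp add: tests_def estimates_def\<close>)
  qed
  have i1: "unif_bigo T (tests R) (2 * \<alpha>) (\<lambda>p s t. vec1 G1 p t - vec1 G1 p s - dY s t v* vec2 G2 p s)"
  proof (intro unif_bigo_vecI)
    fix \<kappa>
    show "unif_bigo T (tests R) (2 * \<alpha>) (\<lambda>p s t. (vec1 G1 p t - vec1 G1 p s - dY s t v* vec2 G2 p s) $ \<kappa>)"
      unfolding controlled_component
      by (rule unif_bigoI[of _ _ _ C]) (use C(2) in \<open>simp add: tests_def estimates_def\<close>)
  qed
  show "controlled (tests R) (vec1 G1) (vec2 G2)" using b i1 i2 by (simp add: controlled_def)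
  fix \<phi> :: "real^'x \<Rightarrow> real" assume "\<phi> \<in> tests R"
  then show "small_o_incr T (\<lambda>s t. X \<phi> t - X \<phi> s - germ a (vec1 G1) (vec2 G2) \<phi> s t)"
    using s unfolding solves_def germ_vec by (simp add: tests_subset)
qed

lemma solves_of_rough_ito:
  assumes r: "\<And>R. rough_ito (tests R) X a (vec1 G1) (vec2 G2)"
  shows "solves X a G1 G2"
  unfolding solves_def
proof (intro conjI allI ballI)
  fix R
  note c = controlledD[OF rough_itoD(3)[OF r[of R]]]
  obtain C1 where C1: "0 \<le> C1" "\<And>p s t. p \<in> tests R \<Longrightarrow> 0 \<le> s \<Longrightarrow> s \<le> t \<Longrightarrow> t \<le> T \<Longrightarrow>
      norm (vec1 G1 p t - vec1 G1 p s - dY s t v* vec2 G2 p s) \<le> C1 * (t - s) powr (2 * \<alpha>)"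
    by (rule unif_bigoE[OF c(4)]) blast
  obtain C2 where C2: "0 \<le> C2" "\<And>p s t. p \<in> tests R \<Longrightarrow> 0 \<le> s \<Longrightarrow> s \<le> t \<Longrightarrow> t \<le> T \<Longrightarrow>
      norm (vec2 G2 p t - vec2 G2 p s) \<le> C2 * (t - s) powr \<alpha>"
    by (rule unif_bigoE[OF c(3)]) blast
  define C where "C = C1 + C2 + 1"
  have C: "0 < C" "C1 \<le> C" "C2 \<le> C" using C1(1) C2(1) by (auto simp: C_def)
  have "\<bar>G2 \<phi> t \<kappa> \<iota> - G2 \<phi> s \<kappa> \<iota>\<bar> \<le> C * \<bar>t - s\<bar> powr \<alpha>"
    if "\<phi> \<in> tests R" "0 \<le> s" "s \<le> t" "t \<le> T" for \<phi> s t \<kappa> \<iota>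
  proof -
    let ?d = "vec2 G2 \<phi> t - vec2 G2 \<phi> s"
    have "\<bar>G2 \<phi> t \<kappa> \<iota> - G2 \<phi> s \<kappa> \<iota>\<bar> \<le> norm (?d $ \<kappa>)"
      using component_le_norm_cart[of "?d $ \<kappa>" \<iota>] by simp
    also have "\<dots> \<le> norm ?d" by (rule Finite_Cartesian_Product.norm_nth_le)
    also have "\<dots> \<le> C2 * (t - s) powr \<alpha>" by (rule C2(2)[OF that])
    also have "\<dots> \<le> C * (t - s) powr \<alpha>" by (rule mult_right_mono[OF C(3)]) simp
    finally show ?thesis using that by simp
  qed
  moreover have "\<bar>G1 \<phi> t \<kappa> - G1 \<phi> s \<kappa> - (\<Sum>\<eta>\<in>UNIV. G2 \<phi> s \<eta> \<kappa> * dY s t $ \<eta>)\<bar> \<le> C * \<bar>t - s\<bar> powr (2 * \<alpha>)"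
    if "\<phi> \<in> tests R" "0 \<le> s" "s \<le> t" "t \<le> T" for \<phi> s t \<kappa>
  proof -
    let ?d = "vec1 G1 \<phi> t - vec1 G1 \<phi> s - dY s t v* vec2 G2 \<phi> s"
    have "\<bar>G1 \<phi> t \<kappa> - G1 \<phi> s \<kappa> - (\<Sum>\<eta>\<in>UNIV. G2 \<phi> s \<eta> \<kappa> * dY s t $ \<eta>)\<bar> \<le> norm ?d"
      using component_le_norm_cart[of ?d \<kappa>] unfolding controlled_component .
    also have "\<dots> \<le> C1 * (t - s) powr (2 * \<alpha>)" by (rule C1(2)[OF that])
    also have "\<dots> \<le> C * (t - s) powr (2 * \<alpha>)" by (rule mult_right_mono[OF C(2)]) simp
    finally show ?thesis using that by simp
  qed
  ultimately show "\<exists>C>0. estimates R C G1 G2"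
    using C(1) unfolding estimates_def by (intro exI[of _ C] conjI ballI impI allI) (auto simp: tests_def)
next
  fix \<phi> :: "real^'x \<Rightarrow> real" assume "\<phi> \<in> Cb 3"
  then obtain R where R: "\<phi> \<in> tests R" using tests_cover by (elim exE[OF tests_cover])
  have "1 < 3 * \<alpha>" using alpha_gt by simp
  from small_o_incr_of_unif_bigo[OF rough_itoD(4)[OF r[of R]] this R]
  show "small_o_incr T (\<lambda>s t. X \<phi> t - X \<phi> s
        - ((LBINT r:{s..t}. a \<phi> r) + (\<Sum>\<kappa>\<in>UNIV. G1 \<phi> s \<kappa> * dY s t $ \<kappa>)
           + (\<Sum>\<kappa>\<in>UNIV. \<Sum>\<iota>\<in>UNIV. G2 \<phi> s \<kappa> \<iota> * YY s t $ \<kappa> $ \<iota>)))"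
    unfolding germ_vec .
qed

abbreviation ev :: "(real \<Rightarrow> (real^'x) measure) \<Rightarrow> (real^'x \<Rightarrow> real) \<Rightarrow> real \<Rightarrow> real" where
  "ev \<mu> \<phi> t \<equiv> integral\<^sup>L (\<mu> t) \<phi>"

abbreviation evA :: "(real \<Rightarrow> (real^'x) measure) \<Rightarrow> (real^'x \<Rightarrow> real) \<Rightarrow> real \<Rightarrow> real" where
  "evA \<mu> \<phi> t \<equiv> integral\<^sup>L (\<mu> t) (A_op T Y c t \<phi>)"

definition zakai1 :: "(real \<Rightarrow> (real^'x) measure) \<Rightarrow> (real^'x \<Rightarrow> real) \<Rightarrow> real \<Rightarrow> real^'y" where
  "zakai1 \<mu> \<phi> t = (\<chi> \<kappa>. integral\<^sup>L (\<mu> t) (Gam c t \<kappa> \<phi>))"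

definition zakai2 :: "(real \<Rightarrow> (real^'x) measure) \<Rightarrow> (real^'x \<Rightarrow> real) \<Rightarrow> real \<Rightarrow> real^'y^'y" where
  "zakai2 \<mu> \<phi> t = (\<chi> \<kappa> \<iota>. integral\<^sup>L (\<mu> t) (Gam2 c t \<kappa> \<iota> \<phi>))"

definition kushner1 :: "(real \<Rightarrow> (real^'x) measure) \<Rightarrow> (real^'x \<Rightarrow> real) \<Rightarrow> real \<Rightarrow> real^'y" where
  "kushner1 \<nu> \<phi> t = (\<chi> \<kappa>. Phi c t (\<nu> t) \<phi> \<kappa>)"

text \<open>
  The transposition matches the index convention of the Kushner--Stratonovich equation, where
  \<open>\<Phi>'\<^sub>\<iota>\<^sub>\<kappa>\<close> is paired with the entry \<open>(\<kappa>, \<iota>)\<close> of the second level of the rough path.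
\<close>

definition kushner2 :: "(real \<Rightarrow> (real^'x) measure) \<Rightarrow> (real^'x \<Rightarrow> real) \<Rightarrow> real \<Rightarrow> real^'y^'y" where
  "kushner2 \<nu> \<phi> t = (\<chi> \<kappa> \<iota>. Phi' c t (\<nu> t) \<phi> \<iota> \<kappa>)"

definition psi1 :: "(real \<Rightarrow> (real^'x) measure) \<Rightarrow> real \<Rightarrow> real^'y" where
  "psi1 \<nu> t = (\<chi> \<kappa>. Psi c t (\<nu> t) \<kappa>)"

definition psi2 :: "(real \<Rightarrow> (real^'x) measure) \<Rightarrow> real \<Rightarrow> real^'y^'y" where
  "psi2 \<nu> t = (\<chi> \<kappa> \<iota>. Psi' c t (\<nu> t) \<iota> \<kappa>)"

text \<open>
  The identities that express the Zakai coefficients by those of the Kushner--Stratonovich equation hold for a single measure and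
  are purely algebraic.
\<close>

lemma zakai1_eq: "zakai1 \<nu> \<phi> t = kushner1 \<nu> \<phi> t + ev \<nu> \<phi> t *\<^sub>R psi1 \<nu> t"
  by (simp add: vec_eq_iff zakai1_def kushner1_def psi1_def Phi_def Psi_def)

lemma zakai2_eq: "zakai2 \<nu> \<phi> t = kushner2 \<nu> \<phi> t + outer (psi1 \<nu> t) (kushner1 \<nu> \<phi> t) + outer (kushner1 \<nu> \<phi> t) (psi1 \<nu> t)
    + ev \<nu> \<phi> t *\<^sub>R (psi2 \<nu> t + outer (psi1 \<nu> t) (psi1 \<nu> t))"
  by (simp add: vec_eq_iff zakai2_def psi1_def psi2_def kushner1_def kushner2_def Psi_def Psi'_def Phi_def Phi'_def Gam_deriv_def
    test_deriv_def Gam_1 Gam2_1 outer_def algebra_simps)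

lemma zakai1_1: "zakai1 \<nu> (\<lambda>_. 1) t = psi1 \<nu> t"
  by (simp add: vec_eq_iff zakai1_def psi1_def Psi_def Gam_1)

lemma zakai2_1: "zakai2 \<nu> (\<lambda>_. 1) t = psi2 \<nu> t + outer (psi1 \<nu> t) (psi1 \<nu> t)"
  by (simp add: vec_eq_iff zakai2_def psi1_def psi2_def Psi_def Psi'_def Gam2_1 outer_def)

lemma Phi_bracket_h_eq: "Phi_bracket_h T Y c t (\<nu> t) \<phi> = outer (kushner1 \<nu> \<phi> t) (psi1 \<nu> t) \<bullet> B t"
  by (simp add: Phi_bracket_h_def inner_vec_def outer_def kushner1_def psi1_def Psi_def mult_ac)

lemma unif_bdd_zakai:
  assumes \<mu>: "weakly_continuous T \<mu>"
  shows "unif_bdd T (tests R) (ev \<mu>)" "unif_bdd T (tests R) (evA \<mu>)"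
    "unif_bdd T (tests R) (zakai1 \<mu>)" "unif_bdd T (tests R) (zakai2 \<mu>)"
proof -
  obtain K where K: "0 \<le> K"
    "\<And>\<phi> t x \<kappa>. \<phi> \<in> tests R \<Longrightarrow> 0 \<le> t \<Longrightarrow> t \<le> T \<Longrightarrow> \<bar>Gam c t \<kappa> \<phi> x\<bar> \<le> K"
    "\<And>\<phi> t x \<kappa> \<iota>. \<phi> \<in> tests R \<Longrightarrow> 0 \<le> t \<Longrightarrow> t \<le> T \<Longrightarrow> \<bar>Gam2 c t \<kappa> \<iota> \<phi> x\<bar> \<le> K"
    "\<And>\<phi> t x. \<phi> \<in> tests R \<Longrightarrow> 0 \<le> t \<Longrightarrow> t \<le> T \<Longrightarrow> \<bar>A_op T Y c t \<phi> x\<bar> \<le> K"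
    by (rule operator_bounds[of R]) (rule that)
  show "unif_bdd T (tests R) (ev \<mu>)"
    by (rule unif_bdd_integral[OF \<mu>]) (rule tests_bounds(1))
  show "unif_bdd T (tests R) (evA \<mu>)"
    by (rule unif_bdd_integral[OF \<mu>]) (rule K(4))
  show "unif_bdd T (tests R) (zakai1 \<mu>)"
    unfolding zakai1_def[abs_def]
    by (rule unif_bdd_vecI, simp only: vec_lambda_beta, rule unif_bdd_integral[OF \<mu>]) (rule K(2))
  show "unif_bdd T (tests R) (zakai2 \<mu>)"
    unfolding zakai2_def[abs_def]
    by (rule unif_bdd_vecI, rule unif_bdd_vecI, simp only: vec_lambda_beta, rule unif_bdd_integral[OF \<mu>]) (rule K(3))
qed

lemma one_in_tests: obtains R1 where "(\<lambda>_::real^'x. 1) \<in> tests R1"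
  by (rule exE[OF tests_cover[OF const_in_Cb]])

lemma unif_bdd_psi:
  assumes \<mu>: "weakly_continuous T \<mu>"
  shows "unif_bdd T P (\<lambda>_. psi1 \<mu>)" "unif_bdd T P (\<lambda>_. psi2 \<mu>)"
proof -
  obtain R1 where R1: "(\<lambda>_::real^'x. 1) \<in> tests R1" by (rule one_in_tests)
  note j = unif_bdd_zakai[OF \<mu>, of R1]
  have "unif_bdd T P (\<lambda>_. zakai1 \<mu> (\<lambda>_. 1))" by (rule unif_bdd_reindex[OF j(3)]) (rule R1)
  then show p1: "unif_bdd T P (\<lambda>_. psi1 \<mu>)" by (rule unif_bdd_cong) (simp add: zakai1_1)
  have "unif_bdd T P (\<lambda>_. zakai2 \<mu> (\<lambda>_. 1))" by (rule unif_bdd_reindex[OF j(4)]) (rule R1)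
  then show "unif_bdd T P (\<lambda>_. psi2 \<mu>)"
    by (rule unif_bdd_cong[OF unif_bdd_diff[OF _ unif_bdd_bilinear[OF bounded_bilinear_outer p1 p1]]])
      (simp add: zakai2_1)
qed

lemma unif_bdd_kushner:
  assumes \<mu>: "weakly_continuous T \<mu>"
  shows "unif_bdd T (tests R) (kushner1 \<mu>)" "unif_bdd T (tests R) (kushner2 \<mu>)"
    "unif_bdd T (tests R) (\<lambda>\<phi> t. evA \<mu> \<phi> t - Phi_bracket_h T Y c t (\<mu> t) \<phi>)"
proof -
  note j = unif_bdd_zakai[OF \<mu>, of R] and p = unif_bdd_psi[OF \<mu>, of "tests R"]
  show k: "unif_bdd T (tests R) (kushner1 \<mu>)"
    by (rule unif_bdd_cong[OF unif_bdd_diff[OF j(3) unif_bdd_bilinear[OF bounded_bilinear_scaleR j(1) p(1)]]])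
      (simp add: zakai1_eq)
  have "unif_bdd T (tests R) (\<lambda>\<phi> t. zakai2 \<mu> \<phi> t - (outer (psi1 \<mu> t) (kushner1 \<mu> \<phi> t) + outer (kushner1 \<mu> \<phi> t) (psi1 \<mu> t)
    + ev \<mu> \<phi> t *\<^sub>R (psi2 \<mu> t + outer (psi1 \<mu> t) (psi1 \<mu> t))))"
    by (intro unif_bdd_diff unif_bdd_add j p k unif_bdd_bilinear[OF bounded_bilinear_outer]
      unif_bdd_bilinear[OF bounded_bilinear_scaleR])
  then show "unif_bdd T (tests R) (kushner2 \<mu>)" by (rule unif_bdd_cong) (simp add: zakai2_eq)
  show "unif_bdd T (tests R) (\<lambda>\<phi> t. evA \<mu> \<phi> t - Phi_bracket_h T Y c t (\<mu> t) \<phi>)"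
    unfolding Phi_bracket_h_eq
    by (intro unif_bdd_diff j unif_bdd_bilinear[OF bounded_bilinear_inner] B_bdd
      unif_bdd_bilinear[OF bounded_bilinear_outer] k p)
qed

lemma zakai_solution_iff:
  "zakai_solution T \<alpha> Y c \<mu> \<longleftrightarrow> weakly_continuous T \<mu> \<and>
     (\<forall>\<phi>\<in>Cb 3. set_integrable lborel {0..T} (evA \<mu> \<phi>)) \<and>
     solves (ev \<mu>) (evA \<mu>) (\<lambda>\<phi> t \<kappa>. zakai1 \<mu> \<phi> t $ \<kappa>) (\<lambda>\<phi> t \<kappa> \<iota>. zakai2 \<mu> \<phi> t $ \<kappa> $ \<iota>)"
  by (simp add: zakai_solution_def solves_def estimates_def zakai1_def zakai2_def)

lemma Phi'_swap:
  "(\<forall>\<kappa> \<iota>. \<bar>Phi' c t M \<phi> \<iota> \<kappa> - Phi' c s N \<phi> \<iota> \<kappa>\<bar> \<le> b) \<longleftrightarrow>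
   (\<forall>\<kappa> \<iota>. \<bar>Phi' c t M \<phi> \<kappa> \<iota> - Phi' c s N \<phi> \<kappa> \<iota>\<bar> \<le> b)"
  by (rule all_comm)

lemma kushner_solution_iff:
  "kushner_solution T \<alpha> Y c \<nu> \<longleftrightarrow> weakly_continuous T \<nu> \<and>
     (\<forall>\<phi>\<in>Cb 3. set_integrable lborel {0..T} (evA \<nu> \<phi>) \<and>
        set_integrable lborel {0..T} (\<lambda>t. Phi_bracket_h T Y c t (\<nu> t) \<phi>)) \<and>
     solves (ev \<nu>) (\<lambda>\<phi> t. evA \<nu> \<phi> t - Phi_bracket_h T Y c t (\<nu> t) \<phi>)
       (\<lambda>\<phi> t \<kappa>. kushner1 \<nu> \<phi> t $ \<kappa>) (\<lambda>\<phi> t \<kappa> \<iota>. kushner2 \<nu> \<phi> t $ \<kappa> $ \<iota>)"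
  unfolding kushner_solution_def solves_def estimates_def kushner1_def kushner2_def vec_lambda_beta
    Phi'_swap ..

text \<open>
  The bounds for the operators make all coefficients bounded over a ball of test functions, so that the separate
  remainders \<open>o(|t-s|)\<close> become uniform by \<open>rough_ito_of_small_o\<close>. Conversely, every test function lies in some ball.
\<close>

lemma zakai_solution_iff_rough_ito:
  "zakai_solution T \<alpha> Y c \<mu> \<longleftrightarrow> weakly_continuous T \<mu> \<and> (\<forall>R. rough_ito (tests R) (ev \<mu>) (evA \<mu>) (zakai1 \<mu>) (zakai2 \<mu>))"
  (is "?l \<longleftrightarrow> ?r")
proof
  assume l: ?l
  then have w: "weakly_continuous T \<mu>" by (simp add: zakai_solution_iff)
  have "rough_ito (tests R) (ev \<mu>) (evA \<mu>) (vec1 (\<lambda>\<phi> t \<kappa>. zakai1 \<mu> \<phi> t $ \<kappa>)) (vec2 (\<lambda>\<phi> t \<kappa> \<iota>. zakai2 \<mu> \<phi> t $ \<kappa> $ \<iota>))" for R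
    by (rule rough_ito_of_solves)
      (use l unif_bdd_zakai[OF w, of R] in \<open>simp_all add: zakai_solution_iff integrable_drift_def tests_subset\<close>)
  then show ?r using w by simp
next
  assume r: ?r
  have "solves (ev \<mu>) (evA \<mu>) (\<lambda>\<phi> t \<kappa>. zakai1 \<mu> \<phi> t $ \<kappa>) (\<lambda>\<phi> t \<kappa> \<iota>. zakai2 \<mu> \<phi> t $ \<kappa> $ \<iota>)"
    by (rule solves_of_rough_ito) (use r in simp)
  moreover have "set_integrable lborel {0..T} (evA \<mu> \<phi>)" if \<phi>: "\<phi> \<in> Cb 3" for \<phi>
  proof -
    obtain R where R: "\<phi> \<in> tests R" by (rule exE[OF tests_cover[OF \<phi>]])
    have "rough_ito (tests R) (ev \<mu>) (evA \<mu>) (zakai1 \<mu>) (zakai2 \<mu>)" using r by simp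
    from integrable_driftD(2)[OF rough_itoD(2)[OF this] R] show ?thesis .
  qed
  ultimately show ?l using r by (simp add: zakai_solution_iff)
qed

lemma kushner_solution_iff_rough_ito:
  "kushner_solution T \<alpha> Y c \<nu> \<longleftrightarrow> weakly_continuous T \<nu> \<and>
     (\<forall>\<phi>\<in>Cb 3. set_integrable lborel {0..T} (evA \<nu> \<phi>) \<and>
        set_integrable lborel {0..T} (\<lambda>t. Phi_bracket_h T Y c t (\<nu> t) \<phi>)) \<and>
     (\<forall>R. rough_ito (tests R) (ev \<nu>) (\<lambda>\<phi> t. evA \<nu> \<phi> t - Phi_bracket_h T Y c t (\<nu> t) \<phi>) (kushner1 \<nu>) (kushner2 \<nu>))"
  (is "?l \<longleftrightarrow> ?r")
proof
  assume l: ?l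
  then have w: "weakly_continuous T \<nu>" by (simp add: kushner_solution_iff)
  have i: "integrable_drift (tests R) (\<lambda>\<phi> t. evA \<nu> \<phi> t - Phi_bracket_h T Y c t (\<nu> t) \<phi>)" for R
    unfolding integrable_drift_def
  proof (intro conjI ballI unif_bdd_kushner(3)[OF w])
    fix \<phi> :: "real^'x \<Rightarrow> real" assume "\<phi> \<in> tests R"
    then have "\<phi> \<in> Cb 3" by (rule tests_subset)
    then show "set_integrable lborel {0..T} (\<lambda>t. evA \<nu> \<phi> t - Phi_bracket_h T Y c t (\<nu> t) \<phi>)"
      using l by (intro set_integral_diff) (simp_all add: kushner_solution_iff)
  qed
  have "rough_ito (tests R) (ev \<nu>) (\<lambda>\<phi> t. evA \<nu> \<phi> t - Phi_bracket_h T Y c t (\<nu> t) \<phi>)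
    (vec1 (\<lambda>\<phi> t \<kappa>. kushner1 \<nu> \<phi> t $ \<kappa>)) (vec2 (\<lambda>\<phi> t \<kappa> \<iota>. kushner2 \<nu> \<phi> t $ \<kappa> $ \<iota>))" for R
    by (rule rough_ito_of_solves)
      (use l i unif_bdd_zakai[OF w, of R] unif_bdd_kushner[OF w, of R] in \<open>simp_all add: kushner_solution_iff\<close>)
  then show ?r using l by (simp add: kushner_solution_iff)
next
  assume r: ?r
  have "solves (ev \<nu>) (\<lambda>\<phi> t. evA \<nu> \<phi> t - Phi_bracket_h T Y c t (\<nu> t) \<phi>)
       (\<lambda>\<phi> t \<kappa>. kushner1 \<nu> \<phi> t $ \<kappa>) (\<lambda>\<phi> t \<kappa> \<iota>. kushner2 \<nu> \<phi> t $ \<kappa> $ \<iota>)"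
    by (rule solves_of_rough_ito) (use r in simp)
  then show ?l using r by (simp add: kushner_solution_iff)
qed

subsection \<open>Normalisation and the logarithm of the total mass\<close>


text \<open>
  \<open>L\<close> is the logarithm of the total mass that \<open>\<nu>\<close> had before normalisation: \<open>dL = \<Psi> dY - (1/2) \<Psi> [Y]' \<Psi>\<^sup>T dt\<close>.
\<close>

definition log_density :: "(real \<Rightarrow> (real^'x) measure) \<Rightarrow> (real \<Rightarrow> real) \<Rightarrow> bool" where
  "log_density \<nu> L \<longleftrightarrow> rough_ito {()} (\<lambda>_. L) (\<lambda>_ t. - (1 / 2) * (outer (psi1 \<nu> t) (psi1 \<nu> t) \<bullet> B t))
     (\<lambda>_. psi1 \<nu>) (\<lambda>_. psi2 \<nu>)"

lemma log_density_continuous: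
  assumes "log_density \<nu> L"
  shows "continuous_on {0..T} L"
  by (rule continuous_on_of_unif_bigo[OF rough_itoD(6)[OF assms[unfolded log_density_def]]]) (use alpha_gt in auto)

text \<open>
  For \<open>k = 1\<close> the drift cancels and \<open>exp L\<close> solves \<open>dm = m \<Psi> dY\<close>; for \<open>k = -1\<close> the two contributions add up.
\<close>

lemma log_density_exp:
  assumes L: "log_density \<nu> L" and k: "\<bar>k\<bar> = 1"
  shows "rough_ito P (\<lambda>_ t. exp (k * L t))
    (\<lambda>_ t. (1 - k) / 2 * exp (k * L t) * (outer (psi1 \<nu> t) (psi1 \<nu> t) \<bullet> B t))
    (\<lambda>_ t. (k * exp (k * L t)) *\<^sub>R psi1 \<nu> t)
    (\<lambda>_ t. (k * exp (k * L t)) *\<^sub>R psi2 \<nu> t + exp (k * L t) *\<^sub>R outer (psi1 \<nu> t) (psi1 \<nu> t))"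
  by (rule rough_ito_cong[OF rough_ito_reindex[OF rough_ito_exp[OF L[unfolded log_density_def] k], of P "\<lambda>_. ()"]])
    (simp_all add: field_simps)

lemma coefficients_scale:
  assumes "0 < r" "\<mu> t = scale_measure (ennreal r) (\<nu> t)"
  shows "ev \<mu> \<phi> t = r * ev \<nu> \<phi> t" "zakai1 \<mu> \<phi> t = r *\<^sub>R zakai1 \<nu> \<phi> t" "zakai2 \<mu> \<phi> t = r *\<^sub>R zakai2 \<nu> \<phi> t"
  using assms by (simp_all add: zakai1_def zakai2_def integral_scale_measure vec_eq_iff)

text \<open>
  Both directions are the product rule, for \<open>\<nu>(\<phi>) exp L\<close> and for \<open>\<mu>(\<phi>) exp (- L)\<close>, followed by a comparison of
  coefficients. In the second case the bracket correction of the product, together with the drift of \<open>exp (- L)\<close>, is exactly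
  the term \<open>- \<Phi> [Y]' \<Psi>\<^sup>T\<close> of the Kushner--Stratonovich drift.
\<close>

lemma zakai_solution_iff_kushner_solution:
  assumes L: "log_density \<nu> L" and \<mu>: "\<And>t. t \<in> {0..T} \<Longrightarrow> \<mu> t = scale_measure (ennreal (exp (L t))) (\<nu> t)"
  shows "zakai_solution T \<alpha> Y c \<mu> \<longleftrightarrow> kushner_solution T \<alpha> Y c \<nu>"
proof
  assume "kushner_solution T \<alpha> Y c \<nu>"
  then have w: "weakly_continuous T \<nu>"
    and k: "rough_ito (tests R) (ev \<nu>) (\<lambda>\<phi> t. evA \<nu> \<phi> t - Phi_bracket_h T Y c t (\<nu> t) \<phi>) (kushner1 \<nu>) (kushner2 \<nu>)" for R
    by (simp_all add: kushner_solution_iff_rough_ito)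
  have "weakly_continuous T \<mu>"
    by (rule weakly_continuous_scale[OF w _ _ \<mu>]) (auto intro!: continuous_intros log_density_continuous[OF L])
  moreover have "rough_ito (tests R) (ev \<mu>) (evA \<mu>) (zakai1 \<mu>) (zakai2 \<mu>)" for R
  proof (rule rough_ito_cong[OF rough_ito_prod[OF k[of R] log_density_exp[OF L, of 1 "tests R"]]])
    fix \<phi> :: "real^'x \<Rightarrow> real" and t :: real assume "0 \<le> t" "t \<le> T"
    then have t: "t \<in> {0..T}" by simp
    note s = coefficients_scale[where r = "exp (L t)" and \<mu> = \<mu> and \<nu> = \<nu> and t = t, OF exp_gt_zero \<mu>[OF t]]
    show "ev \<mu> \<phi> t = ev \<nu> \<phi> t * exp (1 * L t)"
      by (simp add: s)
    show "evA \<mu> \<phi> t = ev \<nu> \<phi> t * ((1 - 1) / 2 * exp (1 * L t) * (outer (psi1 \<nu> t) (psi1 \<nu> t) \<bullet> B t))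
        + exp (1 * L t) * (evA \<nu> \<phi> t - Phi_bracket_h T Y c t (\<nu> t) \<phi>)
        + outer (kushner1 \<nu> \<phi> t) ((1 * exp (1 * L t)) *\<^sub>R psi1 \<nu> t) \<bullet> B t"
      by (simp add: s Phi_bracket_h_eq outer_scaleR_right algebra_simps)
    show "zakai1 \<mu> \<phi> t = ev \<nu> \<phi> t *\<^sub>R (1 * exp (1 * L t)) *\<^sub>R psi1 \<nu> t + exp (1 * L t) *\<^sub>R kushner1 \<nu> \<phi> t"
      unfolding s unfolding zakai1_eq by (simp add: scaleR_add_right mult.commute add.commute)
    show "zakai2 \<mu> \<phi> t = ev \<nu> \<phi> t *\<^sub>R ((1 * exp (1 * L t)) *\<^sub>R psi2 \<nu> t + exp (1 * L t) *\<^sub>R outer (psi1 \<nu> t) (psi1 \<nu> t))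
        + outer (kushner1 \<nu> \<phi> t) ((1 * exp (1 * L t)) *\<^sub>R psi1 \<nu> t)
        + (exp (1 * L t) *\<^sub>R kushner2 \<nu> \<phi> t + outer ((1 * exp (1 * L t)) *\<^sub>R psi1 \<nu> t) (kushner1 \<nu> \<phi> t))"
      unfolding s unfolding zakai2_eq by (simp add: outer_scaleR_right outer_scaleR_left scaleR_add_right mult.commute add_ac)
  qed simp
  ultimately show "zakai_solution T \<alpha> Y c \<mu>" by (simp add: zakai_solution_iff_rough_ito)
next
  assume "zakai_solution T \<alpha> Y c \<mu>"
  then have w: "weakly_continuous T \<mu>" and z: "rough_ito (tests R) (ev \<mu>) (evA \<mu>) (zakai1 \<mu>) (zakai2 \<mu>)" for R
    by (simp_all add: zakai_solution_iff_rough_ito)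
  have \<nu>: "\<nu> t = scale_measure (ennreal (exp (- L t))) (\<mu> t)" if "t \<in> {0..T}" for t
    by (simp only: \<mu>[OF that] scale_measure_exp_inverse)
  have wn: "weakly_continuous T \<nu>"
    by (rule weakly_continuous_scale[OF w _ _ \<nu>]) (auto intro!: continuous_intros log_density_continuous[OF L])
  have k: "rough_ito (tests R) (ev \<nu>) (\<lambda>\<phi> t. evA \<nu> \<phi> t - Phi_bracket_h T Y c t (\<nu> t) \<phi>) (kushner1 \<nu>) (kushner2 \<nu>)" for R
  proof (rule rough_ito_cong[OF rough_ito_prod[OF z[of R] log_density_exp[OF L, of "-1" "tests R"]]])
    fix \<phi> :: "real^'x \<Rightarrow> real" and t :: real assume "0 \<le> t" "t \<le> T"
    then have t: "t \<in> {0..T}" by simp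
    note s = coefficients_scale[where r = "exp (L t)" and \<mu> = \<mu> and \<nu> = \<nu> and t = t, OF exp_gt_zero \<mu>[OF t]]
    have e: "exp (L t) * exp (- L t) = 1" by (simp flip: exp_add)
    have e': "exp (- L t) * exp (L t) = 1" "a * (exp (- L t) * exp (L t)) = a" "exp (- L t) * (exp (L t) * a) = a"
      "exp (L t) * (exp (- L t) * a) = a" for a
      using e by (simp_all add: mult_ac flip: mult.assoc)
    show "ev \<nu> \<phi> t = ev \<mu> \<phi> t * exp (- 1 * L t)"
      using e by (simp add: s mult_ac)
    show "evA \<nu> \<phi> t - Phi_bracket_h T Y c t (\<nu> t) \<phi>
        = ev \<mu> \<phi> t * ((1 - (- 1)) / 2 * exp (- 1 * L t) * (outer (psi1 \<nu> t) (psi1 \<nu> t) \<bullet> B t))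
        + exp (- 1 * L t) * evA \<mu> \<phi> t
        + outer (zakai1 \<mu> \<phi> t) ((- 1 * exp (- 1 * L t)) *\<^sub>R psi1 \<nu> t) \<bullet> B t"
    proof -
      have "ev \<mu> \<phi> t * ((1 - (- 1)) / 2 * exp (- 1 * L t) * (outer (psi1 \<nu> t) (psi1 \<nu> t) \<bullet> B t))
        + exp (- 1 * L t) * evA \<mu> \<phi> t
        + outer (zakai1 \<mu> \<phi> t) ((- 1 * exp (- 1 * L t)) *\<^sub>R psi1 \<nu> t) \<bullet> B t
        = (exp (L t) * exp (- L t)) * (ev \<nu> \<phi> t * (outer (psi1 \<nu> t) (psi1 \<nu> t) \<bullet> B t) + evA \<nu> \<phi> t
           - outer (zakai1 \<nu> \<phi> t) (psi1 \<nu> t) \<bullet> B t)"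
        by (simp add: s outer_scaleR_left outer_scaleR_right outer_minus_left outer_minus_right algebra_simps)
      then show ?thesis unfolding e by (simp add: Phi_bracket_h_eq zakai1_eq outer_add_left outer_scaleR_left inner_add_left)
    qed
    show "kushner1 \<nu> \<phi> t = ev \<mu> \<phi> t *\<^sub>R (- 1 * exp (- 1 * L t)) *\<^sub>R psi1 \<nu> t + exp (- 1 * L t) *\<^sub>R zakai1 \<mu> \<phi> t"
    proof -
      have "ev \<mu> \<phi> t *\<^sub>R (- 1 * exp (- 1 * L t)) *\<^sub>R psi1 \<nu> t + exp (- 1 * L t) *\<^sub>R zakai1 \<mu> \<phi> t
        = (exp (L t) * exp (- L t)) *\<^sub>R (zakai1 \<nu> \<phi> t - ev \<nu> \<phi> t *\<^sub>R psi1 \<nu> t)"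
        by (simp add: s algebra_simps)
      then show ?thesis unfolding e by (simp add: zakai1_eq)
    qed
    show "kushner2 \<nu> \<phi> t = ev \<mu> \<phi> t *\<^sub>R ((- 1 * exp (- 1 * L t)) *\<^sub>R psi2 \<nu> t + exp (- 1 * L t) *\<^sub>R outer (psi1 \<nu> t) (psi1 \<nu> t))
        + outer (zakai1 \<mu> \<phi> t) ((- 1 * exp (- 1 * L t)) *\<^sub>R psi1 \<nu> t)
        + (exp (- 1 * L t) *\<^sub>R zakai2 \<mu> \<phi> t + outer ((- 1 * exp (- 1 * L t)) *\<^sub>R psi1 \<nu> t) (zakai1 \<mu> \<phi> t))"
    proof -
      have "ev \<mu> \<phi> t *\<^sub>R ((- 1 * exp (- 1 * L t)) *\<^sub>R psi2 \<nu> t + exp (- 1 * L t) *\<^sub>R outer (psi1 \<nu> t) (psi1 \<nu> t))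
        + outer (zakai1 \<mu> \<phi> t) ((- 1 * exp (- 1 * L t)) *\<^sub>R psi1 \<nu> t)
        + (exp (- 1 * L t) *\<^sub>R zakai2 \<mu> \<phi> t + outer ((- 1 * exp (- 1 * L t)) *\<^sub>R psi1 \<nu> t) (zakai1 \<mu> \<phi> t))
        = (exp (L t) * exp (- L t)) *\<^sub>R (ev \<nu> \<phi> t *\<^sub>R (outer (psi1 \<nu> t) (psi1 \<nu> t) - psi2 \<nu> t)
            - outer (zakai1 \<nu> \<phi> t) (psi1 \<nu> t) + zakai2 \<nu> \<phi> t - outer (psi1 \<nu> t) (zakai1 \<nu> \<phi> t))"
        by (simp add: s outer_scaleR_left outer_scaleR_right outer_minus_left outer_minus_right algebra_simps)
      then show ?thesis unfolding e
        by (simp add: zakai1_eq zakai2_eq outer_add_left outer_add_right outer_scaleR_left outer_scaleR_right algebra_simps)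
    qed
  qed simp
  have "set_integrable lborel {0..T} (evA \<nu> \<phi>) \<and> set_integrable lborel {0..T} (\<lambda>t. Phi_bracket_h T Y c t (\<nu> t) \<phi>)"
    if \<phi>: "\<phi> \<in> Cb 3" for \<phi>
  proof -
    obtain R where R: "\<phi> \<in> tests R" by (rule exE[OF tests_cover[OF \<phi>]])
    have a: "set_integrable lborel {0..T} (evA \<mu> \<phi>)" by (rule integrable_driftD(2)[OF rough_itoD(2)[OF z] R])
    have "continuous_on {0..T} (\<lambda>t. exp (- L t))"
      by (intro continuous_intros log_density_continuous[OF L])
    from set_integrable_mult_continuous[OF a this]
    have "set_integrable lborel {0..T} (\<lambda>t. exp (- L t) * evA \<mu> \<phi> t)" .
    moreover have "set_integrable lborel {0..T} (evA \<nu> \<phi>) = set_integrable lborel {0..T} (\<lambda>t. exp (- L t) * evA \<mu> \<phi> t)"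
      by (rule set_integrable_cong) (auto simp: \<nu> integral_scale_measure)
    ultimately have 1: "set_integrable lborel {0..T} (evA \<nu> \<phi>)" by simp
    have "set_integrable lborel {0..T} (\<lambda>t. evA \<nu> \<phi> t - (evA \<nu> \<phi> t - Phi_bracket_h T Y c t (\<nu> t) \<phi>))"
      by (rule set_integral_diff(1)[OF 1 integrable_driftD(2)[OF rough_itoD(2)[OF k] R]])
    with 1 show ?thesis by simp
  qed
  with wn k show "kushner_solution T \<alpha> Y c \<nu>" by (simp add: kushner_solution_iff_rough_ito)
qed

lemma Psi_controlled_iff:
  assumes \<nu>: "weakly_continuous T \<nu>"
  shows "Psi_controlled T \<alpha> Y c \<nu> \<longleftrightarrow> controlled {()} (\<lambda>_. psi1 \<nu>) (\<lambda>_. psi2 \<nu>)"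
proof
  assume "Psi_controlled T \<alpha> Y c \<nu>"
  then have 2: "\<exists>C. \<forall>s t. 0 \<le> s \<and> s \<le> t \<and> t \<le> T \<longrightarrow>
        \<bar>Psi' c t (\<nu> t) \<kappa> \<iota> - Psi' c s (\<nu> s) \<kappa> \<iota>\<bar> \<le> C * \<bar>t - s\<bar> powr \<alpha>"
    and 1: "\<exists>C. \<forall>s t. 0 \<le> s \<and> s \<le> t \<and> t \<le> T \<longrightarrow>
        \<bar>Psi c t (\<nu> t) \<kappa> - Psi c s (\<nu> s) \<kappa> - (\<Sum>\<eta>\<in>UNIV. Psi' c s (\<nu> s) \<kappa> \<eta> * dY s t $ \<eta>)\<bar>
        \<le> C * \<bar>t - s\<bar> powr (2 * \<alpha>)" for \<kappa> \<iota>
    by (simp_all add: Psi_controlled_def)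
  have "unif_bigo T {()} \<alpha> (\<lambda>_ s t. psi2 \<nu> t - psi2 \<nu> s)"
  proof (intro unif_bigo_vecI)
    fix \<iota> \<kappa>
    obtain C where "\<forall>s t. 0 \<le> s \<and> s \<le> t \<and> t \<le> T \<longrightarrow>
        \<bar>Psi' c t (\<nu> t) \<kappa> \<iota> - Psi' c s (\<nu> s) \<kappa> \<iota>\<bar> \<le> C * \<bar>t - s\<bar> powr \<alpha>" by (rule exE[OF 2])
    then show "unif_bigo T {()} \<alpha> (\<lambda>_ s t. (psi2 \<nu> t - psi2 \<nu> s) $ \<iota> $ \<kappa>)"
      by (intro unif_bigoI[of _ _ _ C]) (simp add: psi2_def)
  qed
  moreover have "unif_bigo T {()} (2 * \<alpha>) (\<lambda>_ s t. psi1 \<nu> t - psi1 \<nu> s - dY s t v* psi2 \<nu> s)"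
  proof (intro unif_bigo_vecI)
    fix \<kappa>
    obtain C where "\<forall>s t. 0 \<le> s \<and> s \<le> t \<and> t \<le> T \<longrightarrow>
        \<bar>Psi c t (\<nu> t) \<kappa> - Psi c s (\<nu> s) \<kappa> - (\<Sum>\<eta>\<in>UNIV. Psi' c s (\<nu> s) \<kappa> \<eta> * dY s t $ \<eta>)\<bar>
        \<le> C * \<bar>t - s\<bar> powr (2 * \<alpha>)" by (rule exE[OF 1])
    then show "unif_bigo T {()} (2 * \<alpha>) (\<lambda>_ s t. (psi1 \<nu> t - psi1 \<nu> s - dY s t v* psi2 \<nu> s) $ \<kappa>)"
      by (intro unif_bigoI[of _ _ _ C]) (simp add: psi1_def psi2_def vector_matrix_mult_def mult.commute)
  qed
  ultimately show "controlled {()} (\<lambda>_. psi1 \<nu>) (\<lambda>_. psi2 \<nu>)"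
    using unif_bdd_psi[OF \<nu>, of "{()}"] by (simp add: controlled_def)
next
  assume "controlled {()} (\<lambda>_. psi1 \<nu>) (\<lambda>_. psi2 \<nu>)"
  note c = controlledD[OF this]
  obtain C1 where C1: "\<And>s t. 0 \<le> s \<Longrightarrow> s \<le> t \<Longrightarrow> t \<le> T \<Longrightarrow>
      norm (psi1 \<nu> t - psi1 \<nu> s - dY s t v* psi2 \<nu> s) \<le> C1 * (t - s) powr (2 * \<alpha>)"
    by (rule unif_bigoE[OF c(4)]) auto
  obtain C2 where C2: "\<And>s t. 0 \<le> s \<Longrightarrow> s \<le> t \<Longrightarrow> t \<le> T \<Longrightarrow>
      norm (psi2 \<nu> t - psi2 \<nu> s) \<le> C2 * (t - s) powr \<alpha>"
    by (rule unif_bigoE[OF c(3)]) auto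
  show "Psi_controlled T \<alpha> Y c \<nu>"
    unfolding Psi_controlled_def
  proof (intro conjI allI)
    fix \<kappa> \<iota>
    show "\<exists>C. \<forall>s t. 0 \<le> s \<and> s \<le> t \<and> t \<le> T \<longrightarrow>
        \<bar>Psi' c t (\<nu> t) \<kappa> \<iota> - Psi' c s (\<nu> s) \<kappa> \<iota>\<bar> \<le> C * \<bar>t - s\<bar> powr \<alpha>"
    proof (intro exI[of _ C2] allI impI)
      fix s t assume st: "0 \<le> s \<and> s \<le> t \<and> t \<le> T"
      let ?d = "psi2 \<nu> t - psi2 \<nu> s"
      have "\<bar>Psi' c t (\<nu> t) \<kappa> \<iota> - Psi' c s (\<nu> s) \<kappa> \<iota>\<bar> \<le> norm (?d $ \<iota>)"
        using component_le_norm_cart[of "?d $ \<iota>" \<kappa>] by (simp add: psi2_def)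
      also have "\<dots> \<le> norm ?d" by (rule Finite_Cartesian_Product.norm_nth_le)
      also have "\<dots> \<le> C2 * (t - s) powr \<alpha>" using C2 st by simp
      finally show "\<bar>Psi' c t (\<nu> t) \<kappa> \<iota> - Psi' c s (\<nu> s) \<kappa> \<iota>\<bar> \<le> C2 * \<bar>t - s\<bar> powr \<alpha>" using st by simp
    qed
  next
    fix \<kappa>
    show "\<exists>C. \<forall>s t. 0 \<le> s \<and> s \<le> t \<and> t \<le> T \<longrightarrow>
        \<bar>Psi c t (\<nu> t) \<kappa> - Psi c s (\<nu> s) \<kappa> - (\<Sum>\<eta>\<in>UNIV. Psi' c s (\<nu> s) \<kappa> \<eta> * dY s t $ \<eta>)\<bar>
        \<le> C * \<bar>t - s\<bar> powr (2 * \<alpha>)"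
    proof (intro exI[of _ C1] allI impI)
      fix s t assume st: "0 \<le> s \<and> s \<le> t \<and> t \<le> T"
      let ?d = "psi1 \<nu> t - psi1 \<nu> s - dY s t v* psi2 \<nu> s"
      have "\<bar>Psi c t (\<nu> t) \<kappa> - Psi c s (\<nu> s) \<kappa> - (\<Sum>\<eta>\<in>UNIV. Psi' c s (\<nu> s) \<kappa> \<eta> * dY s t $ \<eta>)\<bar> \<le> norm ?d"
        using component_le_norm_cart[of ?d \<kappa>] by (simp add: psi1_def psi2_def vector_matrix_mult_def mult.commute)
      also have "\<dots> \<le> C1 * (t - s) powr (2 * \<alpha>)" using C1 st by simp
      finally show "\<bar>Psi c t (\<nu> t) \<kappa> - Psi c s (\<nu> s) \<kappa> - (\<Sum>\<eta>\<in>UNIV. Psi' c s (\<nu> s) \<kappa> \<eta> * dY s t $ \<eta>)\<bar>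
        \<le> C1 * \<bar>t - s\<bar> powr (2 * \<alpha>)" using st by simp
    qed
  qed
qed

text \<open>
  Controlledness of \<open>\<Psi>\<close> is what makes \<open>\<Psi>\<close> integrable against the rough path.
\<close>

lemma log_density_exists:
  assumes "weakly_continuous T \<nu>" "Psi_controlled T \<alpha> Y c \<nu>"
  obtains L where "L 0 = 0" "log_density \<nu> L"
proof -
  have c: "controlled {()} (\<lambda>_. psi1 \<nu>) (\<lambda>_. psi2 \<nu>)" using assms Psi_controlled_iff by simp
  note cD = controlledD(1)[OF c] controlled_incr[OF c]
  have i: "integrable_drift {()} (\<lambda>_ t. outer (psi1 \<nu> t) (psi1 \<nu> t) \<bullet> B t)"
  proof (rule integrable_drift_bracket)
    show "unif_bdd T {()} (\<lambda>_ t. outer (psi1 \<nu> t) (psi1 \<nu> t))"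
      by (rule unif_bdd_bilinear[OF bounded_bilinear_outer cD(1) cD(1)])
    show "unif_bigo T {()} \<alpha> (\<lambda>_ s t. outer (psi1 \<nu> t) (psi1 \<nu> t) - outer (psi1 \<nu> s) (psi1 \<nu> s))"
      by (rule unif_bigo_incr_bilinear[OF bounded_bilinear_outer cD cD]) (use alpha_gt in simp)
  qed
  have a: "integrable_drift {()} (\<lambda>_ t. - (1 / 2) * (outer (psi1 \<nu> t) (psi1 \<nu> t) \<bullet> B t))"
    by (rule integrable_drift_mult[where Z = "\<lambda>_ _. - (1 / 2)", OF unif_bdd_const _ i])
      (rule unif_bigoI[of _ _ _ 0], simp)
  show ?thesis
    by (rule rough_integral_exists[OF a c]) (rule that, assumption, simp add: log_density_def)
qed

text \<open>
  The test function \<open>1\<close> gives the total mass: \<open>A 1 = 0\<close> and \<open>\<Gamma> 1 = h\<close>.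
\<close>

lemma zakai_mass:
  assumes "zakai_solution T \<alpha> Y c \<mu>" and \<mu>: "\<And>t. t \<in> {0..T} \<Longrightarrow> 0 < m t \<and> \<mu> t = scale_measure (ennreal (m t)) (\<nu> t)"
  shows "rough_ito {()} (\<lambda>_. ev \<mu> (\<lambda>_. 1)) (\<lambda>_ _. 0) (\<lambda>_ t. m t *\<^sub>R psi1 \<nu> t)
    (\<lambda>_ t. m t *\<^sub>R (psi2 \<nu> t + outer (psi1 \<nu> t) (psi1 \<nu> t)))"
proof -
  obtain R1 where R1: "(\<lambda>_::real^'x. 1) \<in> tests R1" by (rule one_in_tests)
  have "rough_ito (tests R1) (ev \<mu>) (evA \<mu>) (zakai1 \<mu>) (zakai2 \<mu>)"
    using assms(1) by (simp add: zakai_solution_iff_rough_ito)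
  then have "rough_ito {()} (\<lambda>_. ev \<mu> (\<lambda>_. 1)) (\<lambda>_. evA \<mu> (\<lambda>_. 1)) (\<lambda>_. zakai1 \<mu> (\<lambda>_. 1)) (\<lambda>_. zakai2 \<mu> (\<lambda>_. 1))"
    by (rule rough_ito_reindex) (rule R1)
  then show ?thesis
  proof (rule rough_ito_cong)
    fix t :: real assume "0 \<le> t" "t \<le> T"
    then have t: "t \<in> {0..T}" by simp
    note s = coefficients_scale[where r = "m t" and \<mu> = \<mu> and \<nu> = \<nu> and t = t, OF \<mu>[OF t, THEN conjunct1] \<mu>[OF t, THEN conjunct2]]
    show "0 = evA \<mu> (\<lambda>_. 1) t" by (simp add: A_op_1)
    show "m t *\<^sub>R psi1 \<nu> t = zakai1 \<mu> (\<lambda>_. 1) t" using s(2)[of "\<lambda>_. 1"] by (simp only: zakai1_1)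
    show "m t *\<^sub>R (psi2 \<nu> t + outer (psi1 \<nu> t) (psi1 \<nu> t)) = zakai2 \<mu> (\<lambda>_. 1) t" using s(3)[of "\<lambda>_. 1"] by (simp only: zakai2_1)
  qed simp
qed

lemma log_density_ln_mass:
  assumes z: "zakai_solution T \<alpha> Y c \<mu>" and pos: "\<And>t. t \<in> {0..T} \<Longrightarrow> 0 < ev \<mu> (\<lambda>_. 1) t"
    and \<mu>: "\<And>t. t \<in> {0..T} \<Longrightarrow> \<mu> t = scale_measure (ennreal (ev \<mu> (\<lambda>_. 1) t)) (\<nu> t)"
  shows "log_density \<nu> (\<lambda>t. ln (ev \<mu> (\<lambda>_. 1) t))"
  unfolding log_density_def
proof (rule rough_ito_cong[OF rough_ito_ln[OF zakai_mass[OF z]]])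
  fix t assume "t \<in> {0..T}"
  with pos \<mu> show "0 < ev \<mu> (\<lambda>_. 1) t \<and> \<mu> t = scale_measure (ennreal (ev \<mu> (\<lambda>_. 1) t)) (\<nu> t)" by blast
next
  fix t :: real assume "0 \<le> t" "t \<le> T"
  then have m: "0 < ev \<mu> (\<lambda>_. 1) t" using pos by simp
  then show "0 < ev \<mu> (\<lambda>_. 1) t" .
  define m where "m = ev \<mu> (\<lambda>_. 1) t"
  have m0: "0 < m" using m by (simp only: m_def)
  show "- (1 / 2) * (outer (psi1 \<nu> t) (psi1 \<nu> t) \<bullet> B t) = 1 / ev \<mu> (\<lambda>_. 1) t * 0
      + ((- 1 / (ev \<mu> (\<lambda>_. 1) t)\<^sup>2 / 2) *\<^sub>R outer (ev \<mu> (\<lambda>_. 1) t *\<^sub>R psi1 \<nu> t) (ev \<mu> (\<lambda>_. 1) t *\<^sub>R psi1 \<nu> t)) \<bullet> B t"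
    unfolding m_def[symmetric] using m0 by (simp add: outer_scaleR_left outer_scaleR_right power2_eq_square)
  show "psi1 \<nu> t = (1 / ev \<mu> (\<lambda>_. 1) t) *\<^sub>R ev \<mu> (\<lambda>_. 1) t *\<^sub>R psi1 \<nu> t"
    unfolding m_def[symmetric] using m0 by simp
  show "psi2 \<nu> t = (1 / ev \<mu> (\<lambda>_. 1) t) *\<^sub>R ev \<mu> (\<lambda>_. 1) t *\<^sub>R (psi2 \<nu> t + outer (psi1 \<nu> t) (psi1 \<nu> t))
      + outer ((- 1 / (ev \<mu> (\<lambda>_. 1) t)\<^sup>2) *\<^sub>R ev \<mu> (\<lambda>_. 1) t *\<^sub>R psi1 \<nu> t) (ev \<mu> (\<lambda>_. 1) t *\<^sub>R psi1 \<nu> t)"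
    unfolding m_def[symmetric] using m0 by (simp add: outer_scaleR_left outer_scaleR_right outer_minus_left power2_eq_square)
qed simp

text \<open>
  Both sides have the same expansion and the same initial value. In particular \<open>\<nu>\<^sub>t\<close> has mass \<open>1\<close> at
  all times if it does initially.
\<close>

lemma mass_eq_exp:
  assumes z: "zakai_solution T \<alpha> Y c \<mu>" and L: "log_density \<nu> L"
    and \<mu>: "\<And>t. t \<in> {0..T} \<Longrightarrow> \<mu> t = scale_measure (ennreal (exp (L t))) (\<nu> t)"
    and 0: "ev \<mu> (\<lambda>_. 1) 0 = exp (L 0)" and t: "0 \<le> t" "t \<le> T"
  shows "ev \<mu> (\<lambda>_. 1) t = exp (L t)"
proof (rule rough_ito_unique[where X = "ev \<mu> (\<lambda>_. 1)" and X' = "\<lambda>t. exp (L t)" and p = "()", OF _ _ 0 t])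
  show "rough_ito {()} (\<lambda>_. ev \<mu> (\<lambda>_. 1)) (\<lambda>_ _. 0) (\<lambda>_ t. exp (L t) *\<^sub>R psi1 \<nu> t)
    (\<lambda>_ t. exp (L t) *\<^sub>R (psi2 \<nu> t + outer (psi1 \<nu> t) (psi1 \<nu> t)))"
    by (rule zakai_mass[where m = "\<lambda>t. exp (L t)", OF z]) (simp add: \<mu>)
  show "rough_ito {()} (\<lambda>_ t. exp (L t)) (\<lambda>_ _. 0) (\<lambda>_ t. exp (L t) *\<^sub>R psi1 \<nu> t)
     (\<lambda>_ t. exp (L t) *\<^sub>R (psi2 \<nu> t + outer (psi1 \<nu> t) (psi1 \<nu> t)))"
    by (rule rough_ito_cong[OF log_density_exp[OF L, of 1]]) (simp_all add: scaleR_add_right)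
qed

lemma log_density_unique:
  assumes L: "log_density \<nu> L" and L': "log_density \<nu>' L'" and \<nu>: "\<And>t. t \<in> {0..T} \<Longrightarrow> \<nu> t = \<nu>' t"
    and 0: "L 0 = L' 0" and t: "0 \<le> t" "t \<le> T"
  shows "L t = L' t"
proof (rule rough_ito_unique[where X = L and X' = L' and p = "()", OF L[unfolded log_density_def] _ 0 t])
  have "psi1 \<nu> t = psi1 \<nu>' t" "psi2 \<nu> t = psi2 \<nu>' t" if "0 \<le> t" "t \<le> T" for t
    using \<nu> that by (simp_all add: psi1_def psi2_def)
  then show "rough_ito {()} (\<lambda>_. L') (\<lambda>_ t. - (1 / 2) * (outer (psi1 \<nu> t) (psi1 \<nu> t) \<bullet> B t)) (\<lambda>_. psi1 \<nu>) (\<lambda>_. psi2 \<nu>)"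
    by (intro rough_ito_cong[OF L'[unfolded log_density_def]]) simp_all
qed

text \<open>
  Take \<open>L = ln \<mu>(1)\<close> and normalise. That \<open>\<Psi>\<close> is controlled is part of the expansion of \<open>ln \<mu>(1)\<close>.
\<close>

lemma kushner_of_zakai:
  assumes z: "zakai_solution T \<alpha> Y c \<mu>" and pos: "\<And>t. t \<in> {0..T} \<Longrightarrow> 0 < ev \<mu> (\<lambda>_. 1) t"
    and p: "prob_space (\<mu> 0)"
  obtains \<nu> L where "kushner_solution T \<alpha> Y c \<nu>" "Psi_controlled T \<alpha> Y c \<nu>" "\<nu> 0 = \<mu> 0"
    "log_density \<nu> L" "L 0 = 0" "\<And>t. t \<in> {0..T} \<Longrightarrow> \<mu> t = scale_measure (ennreal (exp (L t))) (\<nu> t)"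
proof -
  define L where "L t = ln (ev \<mu> (\<lambda>_. 1) t)" for t
  define \<nu> where "\<nu> t = scale_measure (ennreal (exp (- L t))) (\<mu> t)" for t
  have L0: "L 0 = 0" using p by (simp add: L_def prob_space.prob_space)
  have \<mu>: "\<mu> t = scale_measure (ennreal (exp (L t))) (\<nu> t)" for t
    using scale_measure_exp_inverse[of "- L t" "\<mu> t"] by (simp add: \<nu>_def)
  have m: "ev \<mu> (\<lambda>_. 1) t = exp (L t)" if "t \<in> {0..T}" for t
    using pos[OF that] by (simp only: L_def exp_ln)
  have L: "log_density \<nu> L"
    unfolding L_def
  proof (rule log_density_ln_mass[OF z pos])
    fix t assume "t \<in> {0..T}"
    show "\<mu> t = scale_measure (ennreal (ev \<mu> (\<lambda>_. 1) t)) (\<nu> t)"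
      unfolding m[OF \<open>t \<in> {0..T}\<close>] by (rule \<mu>)
  qed
  have k: "kushner_solution T \<alpha> Y c \<nu>"
    using zakai_solution_iff_kushner_solution[OF L \<mu>] z by simp
  then have "weakly_continuous T \<nu>" by (simp add: kushner_solution_iff)
  then have "Psi_controlled T \<alpha> Y c \<nu>"
    using rough_itoD(3)[OF L[unfolded log_density_def]] by (simp add: Psi_controlled_iff)
  moreover have "\<nu> 0 = \<mu> 0" by (simp add: \<nu>_def L0)
  ultimately show ?thesis using k L L0 \<mu> by (intro that[of \<nu> L])
qed

text \<open>
  The last conclusion recovers \<open>\<nu>\<close> from \<open>\<mu>\<close>, which transports uniqueness.
\<close>

lemma zakai_of_kushner:
  assumes k: "kushner_solution T \<alpha> Y c \<nu>" and psi: "Psi_controlled T \<alpha> Y c \<nu>" and p: "prob_space (\<nu> 0)"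
  obtains \<mu> where "zakai_solution T \<alpha> Y c \<mu>" "\<And>t. t \<in> {0..T} \<Longrightarrow> 0 < ev \<mu> (\<lambda>_. 1) t" "\<mu> 0 = \<nu> 0"
    "\<And>t. t \<in> {0..T} \<Longrightarrow> \<nu> t = scale_measure (ennreal (1 / ev \<mu> (\<lambda>_. 1) t)) (\<mu> t)"
proof -
  have w: "weakly_continuous T \<nu>" using k by (simp add: kushner_solution_iff)
  obtain L where L0: "L 0 = 0" and L: "log_density \<nu> L" by (rule log_density_exists[OF w psi])
  define \<mu> where "\<mu> t = scale_measure (ennreal (exp (L t))) (\<nu> t)" for t
  have z: "zakai_solution T \<alpha> Y c \<mu>"
    using zakai_solution_iff_kushner_solution[OF L \<mu>_def] k by simp
  have \<mu>0: "\<mu> 0 = \<nu> 0" by (simp add: \<mu>_def L0)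
  have 0: "ev \<mu> (\<lambda>_. 1) 0 = exp (L 0)" using p by (simp add: \<mu>0 L0 prob_space.prob_space)
  have m: "ev \<mu> (\<lambda>_. 1) t = exp (L t)" if "t \<in> {0..T}" for t
    by (rule mass_eq_exp[OF z L \<mu>_def 0]) (use that in auto)
  show ?thesis
  proof (rule that[OF z _ \<mu>0])
    fix t assume t: "t \<in> {0..T}"
    show "0 < ev \<mu> (\<lambda>_. 1) t" by (simp only: m[OF t] exp_gt_zero)
    have "\<nu> t = scale_measure (ennreal (exp (- L t))) (\<mu> t)" unfolding \<mu>_def by (rule scale_measure_exp_inverse[symmetric])
    then show "\<nu> t = scale_measure (ennreal (1 / ev \<mu> (\<lambda>_. 1) t)) (\<mu> t)"
      by (simp only: m[OF t] exp_minus inverse_eq_divide)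
  qed
qed

end


section \<open>Equivalence of the two uniqueness statements\<close>


text \<open>
  A solution of either equation is turned into one of the other, and can be recovered from it: \<open>\<nu>\<close> is the normalisation
  of \<open>\<mu>\<close>, and \<open>\<mu> = exp L \<nu>\<close>, where \<open>L\<close> is determined by \<open>\<nu>\<close> and \<open>L\<^sub>0 = 0\<close>.
\<close>

theorem theorem3p16:
  fixes T \<alpha> :: real
    and c :: "'y::finite rough_path \<Rightarrow> ('x::finite, 'y, 'b::finite) coeffs"
    and Y :: "'y rough_path"
    and \<mu>0 :: "(real^'x) measure"
  assumes "0 < T" and "1 / 3 < \<alpha>" and "\<alpha> \<le> 1 / 2"
    and "assumption_E T \<alpha> c"
    and "Y \<in> rough_paths_0_1 T \<alpha>"
    and "prob_space \<mu>0" and "sets \<mu>0 = sets borel"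
  shows "at_most_one_curve T (\<lambda>\<mu>. zakai_solution T \<alpha> Y (c Y) \<mu> \<and> \<mu> 0 = \<mu>0 \<and>
             (\<forall>t\<in>{0..T}. integral\<^sup>L (\<mu> t) (\<lambda>_. 1 :: real) > 0))
     \<longleftrightarrow> at_most_one_curve T (\<lambda>\<nu>. kushner_solution T \<alpha> Y (c Y) \<nu> \<and> \<nu> 0 = \<mu>0 \<and>
             Psi_controlled T \<alpha> Y (c Y) \<nu>)"
    (is "at_most_one_curve T ?Z \<longleftrightarrow> at_most_one_curve T ?K")
proof -
  interpret rough_filtering T \<alpha> Y "c Y"
    using assms(1-5) unfolding assumption_E_def by unfold_locales simp_all
  show ?thesis
  proof
    assume unique: "at_most_one_curve T ?Z"
    show "at_most_one_curve T ?K"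
      unfolding at_most_one_curve_def
    proof (intro allI impI ballI)
      fix \<nu> \<nu>' t assume K: "?K \<nu> \<and> ?K \<nu>'" and t: "t \<in> {0..T}"
      obtain \<mu> where \<mu>: "zakai_solution T \<alpha> Y (c Y) \<mu>" "\<And>t. t \<in> {0..T} \<Longrightarrow> 0 < ev \<mu> (\<lambda>_. 1) t" "\<mu> 0 = \<nu> 0"
        "\<And>t. t \<in> {0..T} \<Longrightarrow> \<nu> t = scale_measure (ennreal (1 / ev \<mu> (\<lambda>_. 1) t)) (\<mu> t)"
        by (rule zakai_of_kushner[of \<nu>]) (use K assms(6) in simp_all)
      obtain \<mu>' where \<mu>': "zakai_solution T \<alpha> Y (c Y) \<mu>'" "\<And>t. t \<in> {0..T} \<Longrightarrow> 0 < ev \<mu>' (\<lambda>_. 1) t" "\<mu>' 0 = \<nu>' 0"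
        "\<And>t. t \<in> {0..T} \<Longrightarrow> \<nu>' t = scale_measure (ennreal (1 / ev \<mu>' (\<lambda>_. 1) t)) (\<mu>' t)"
        by (rule zakai_of_kushner[of \<nu>']) (use K assms(6) in simp_all)
      have "?Z \<mu>" "?Z \<mu>'" using \<mu>(1-3) \<mu>'(1-3) K by (simp_all only: simp_thms) blast+
      then have "\<mu> t = \<mu>' t" using unique t unfolding at_most_one_curve_def by blast
      then show "\<nu> t = \<nu>' t" using \<mu>(4)[OF t] \<mu>'(4)[OF t] by simp
    qed
  next
    assume unique: "at_most_one_curve T ?K"
    show "at_most_one_curve T ?Z"
      unfolding at_most_one_curve_def
    proof (intro allI impI ballI)
      fix \<mu> \<mu>' t assume Z: "?Z \<mu> \<and> ?Z \<mu>'" and t: "t \<in> {0..T}"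
      have pos: "0 < ev \<mu> (\<lambda>_. 1) t" "0 < ev \<mu>' (\<lambda>_. 1) t" if "t \<in> {0..T}" for t
        using Z that by blast+
      obtain \<nu> L where \<nu>: "kushner_solution T \<alpha> Y (c Y) \<nu>" "Psi_controlled T \<alpha> Y (c Y) \<nu>" "\<nu> 0 = \<mu> 0"
        "log_density \<nu> L" "L 0 = 0" "\<And>t. t \<in> {0..T} \<Longrightarrow> \<mu> t = scale_measure (ennreal (exp (L t))) (\<nu> t)"
        by (rule kushner_of_zakai[of \<mu>, OF _ pos(1)]) (use Z assms(6) in simp_all)
      obtain \<nu>' L' where \<nu>': "kushner_solution T \<alpha> Y (c Y) \<nu>'" "Psi_controlled T \<alpha> Y (c Y) \<nu>'" "\<nu>' 0 = \<mu>' 0"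
        "log_density \<nu>' L'" "L' 0 = 0" "\<And>t. t \<in> {0..T} \<Longrightarrow> \<mu>' t = scale_measure (ennreal (exp (L' t))) (\<nu>' t)"
        by (rule kushner_of_zakai[of \<mu>', OF _ pos(2)]) (use Z assms(6) in simp_all)
      have "?K \<nu>" "?K \<nu>'" using \<nu>(1-3) \<nu>'(1-3) Z by simp_all
      then have eq: "\<nu> t = \<nu>' t" if "t \<in> {0..T}" for t
        using unique that unfolding at_most_one_curve_def by blast
      have "L t = L' t"
        by (rule log_density_unique[OF \<nu>(4) \<nu>'(4) eq]) (use \<nu>(5) \<nu>'(5) t in auto)
      then show "\<mu> t = \<mu>' t" using \<nu>(6)[OF t] \<nu>'(6)[OF t] eq[OF t] by simp
    qed
  qed
qed

end
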